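(* Let $X_0,X_1$ be non-zero Banach spaces. Then $X_0\hat{\otimes}_\varepsilon X_1$ is Asymptotic $c_0$ if and only if $X_0$ and $X_1$ are Asymptotic $c_0$. Equivalently, $X_0\hat{\otimes}_\varepsilon X_1$ has summable Szlenk index if and only if $X_0$ and $X_1$ have summable Szlenk index.
   Context: The scalar field $\mathbb{K}$ is $\mathbb{R}$ or $\mathbb{C}$; $S_X$ is the unit sphere of $X$. The injective tensor product $X\hat{\otimes}_\varepsilon Y$ is the closed span, in the space of bounded linear operators from $Y^*$ to $X$ with the operator norm, of the operators $x\otimes y:Y^*\to X$, $(x\otimes y)(y^* )=y^*(y)x$. Asymptotic $c_0$: for a directed set $D$ and $n\in\mathbb{N}$, $D^{\leqslant n}=\bigcup_{i=1}^nD^i$; for $t=(u_i)_{i=1}^k\in D^{\leqslant n}$ and $0\leqslant j\leqslant k$, $t|_j=(u_i)_{i=1}^j$; $(t,u)$ is $t$ with $u$ appended. A collection $(x_t)_{t\in D^{\leqslant n}}\subset X$ is weakly null if for every $t\in\{\varnothing\}\cup D^{\leqslant n-1}$, $(x_{(t,u)})_{u\in D}$ is a weakly null net. $\{X\}_n$ is the set of all norms $|\cdot|$ on $\mathbb{K}^n$ such that for any $b>1$ there exist a directed set $D$ and a weakly null collection $(x_t)_{t\in D^{\leqslant n}}\subset S_X$ such that for any $(a_i)_{i=1}^n\in S_{\ell_\infty^n}$ and any $t\in D^n$, $b^{-1}\|\sum_{i=1}^na_ix_{t|_i}\|\leqslant|\sum_{i=1}^na_ie_i|\leqslant b\|\sum_{i=1}^na_ix_{t|_i}\|$.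 $X$ is Asymptotic $c_0$ if $\dim X=\infty$ and there exists $C\geqslant 1$ such that $C^{-1}\|\sum_{i=1}^na_ie_i\|_{\ell_\infty^n}\leqslant|\sum_{i=1}^na_ie_i|\leqslant C\|\sum_{i=1}^na_ie_i\|_{\ell_\infty^n}$ for each $n\in\mathbb{N}$, each $|\cdot|\in\{X\}_n$ and each $(a_i)_{i=1}^n\in\mathbb{K}^n$. Summable Szlenk index: for a weak$^*$-compact $K\subset X^*$ and $\varepsilon>0$, $s_\varepsilon(K)$ denotes the set of those $x^*\in K$ such that $\mathrm{diam}(V\cap K)>\varepsilon$ (norm diameter) for every weak$^*$-neighborhood $V$ of $x^*$; for $\varepsilon\leqslant 0$, $s_\varepsilon(K)=K$. $K$ has $M$-summable Szlenk index ($M\geqslant 0$) if whenever $n\in\mathbb{N}$ and $\varepsilon_1,\ldots,\varepsilon_n\in\mathbb{R}$ (equivalently, $\varepsilon_1,\ldots,\varepsilon_n>0$) are such that $s_{\varepsilon_1}\cdots s_{\varepsilon_n}(K)\neq\varnothing$ (with $s_{\varepsilon_n}$ applied first), then $\sum_{i=1}^n\varepsilon_i\leqslant M$; $K$ has summable Szlenk index if this holds for some $M\geqslant 0$. A Banach space $X$ has summable Szlenk index if its closed dual unit ball $B_{X^*}$ does.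
   Formalization: The Asymptotic c_0 equivalence fails if exactly one factor is finite-dimensional (e.g. X_0=K, X_1=c_0); in that case it is replaced by: the tensor product is Asymptotic c_0 iff the infinite-dimensional factor is. The Szlenk equivalence is unchanged. *)

theory Defs
  imports "HOL-Analysis.Analysis" "HOL-Library.Function_Algebras"
begin

section \<open>Normed spaces over the real or the complex numbers\<close>

text \<open>
  The scalar field is a type of the following class. Up to isometric isomorphism its only members
  are the reals and the complex numbers: an absolute value on the complex numbers which extends
  the usual one of the reals is the usual one.
\<close>

class real_or_complex = real_normed_field +
  assumes real_or_complex:
    "(\<forall>x. \<exists>a. x = a *\<^sub>R 1) \<or> (\<exists>i. i * i = - 1 \<and> (\<forall>x. \<exists>a b. x = a *\<^sub>R 1 + b *\<^sub>R i))"

instance real :: real_or_complex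
  by standard simp

instance complex :: real_or_complex
proof
  have "\<exists>a b. x = a *\<^sub>R 1 + b *\<^sub>R \<i>" for x :: complex
    by (rule exI[of _ "Re x"], rule exI[of _ "Im x"]) (simp add: complex_eq_iff)
  then show "(\<forall>x::complex. \<exists>a. x = a *\<^sub>R 1) \<or>
      (\<exists>i::complex. i * i = - 1 \<and> (\<forall>x. \<exists>a b. x = a *\<^sub>R 1 + b *\<^sub>R i))"
    by (metis i_squared)
qed

text \<open>
  Dual spaces and tensor products depend on the scalar multiplication, so they cannot be types with
  a norm class. A normed space is therefore a subspace of an additive group together with a scalar
  multiplication and a norm. Addition is that of the type; for functions it is pointwise.
\<close>

record ('k, 'e) nspace =
  vecs :: "'e set"
  smul :: "'k \<Rightarrow> 'e \<Rightarrow> 'e"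
  nrm :: "'e \<Rightarrow> real"

definition whole :: "('k \<Rightarrow> 'e \<Rightarrow> 'e) \<Rightarrow> ('k, 'e::real_normed_vector) nspace" where
  "whole s = \<lparr>vecs = UNIV, smul = s, nrm = norm\<rparr>"

definition infinite_dim :: "('k::field, 'e::ab_group_add) nspace \<Rightarrow> bool" where
  "infinite_dim E \<longleftrightarrow> \<not> (\<exists>B. finite B \<and> module.span (smul E) B = vecs E)"

definition nsphere :: "('k, 'e) nspace \<Rightarrow> 'e set" where
  "nsphere E = {x \<in> vecs E. nrm E x = 1}"

definition nball :: "('k, 'e) nspace \<Rightarrow> 'e set" where
  "nball E = {x \<in> vecs E. nrm E x \<le> 1}"

text \<open>
  The bounded linear operators, with the operator norm. They are set to \<open>0\<close> outside the domain, so
  that equal operators are equal functions.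
\<close>

definition bounded_ops ::
    "('k, 'e::ab_group_add) nspace \<Rightarrow> ('k, 'f::ab_group_add) nspace \<Rightarrow> ('k, 'e \<Rightarrow> 'f) nspace" where
  "bounded_ops E F =
    \<lparr>vecs = {T. (\<forall>x. x \<notin> vecs E \<longrightarrow> T x = 0) \<and> (\<forall>x\<in>vecs E. T x \<in> vecs F) \<and>
        (\<forall>x\<in>vecs E. \<forall>y\<in>vecs E. T (x + y) = T x + T y) \<and>
        (\<forall>c. \<forall>x\<in>vecs E. T (smul E c x) = smul F c (T x)) \<and>
        (\<exists>B. \<forall>x\<in>vecs E. nrm F (T x) \<le> B * nrm E x)},
     smul = (\<lambda>c T x. smul F c (T x)),
     nrm = (\<lambda>T. SUP x\<in>nball E. nrm F (T x))\<rparr>"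

definition dual :: "('k::real_or_complex, 'e::ab_group_add) nspace \<Rightarrow> ('k, 'e \<Rightarrow> 'k) nspace" where
  "dual E = bounded_ops E (whole (*))"


section \<open>The injective tensor product\<close>

definition elem_tensor :: "('k::real_or_complex, 'e::ab_group_add) nspace \<Rightarrow>
    ('k, 'f::ab_group_add) nspace \<Rightarrow> 'e \<Rightarrow> 'f \<Rightarrow> ('f \<Rightarrow> 'k) \<Rightarrow> 'e" where
  "elem_tensor X Y x y = (\<lambda>f. if f \<in> vecs (dual Y) then smul X (f y) x else 0)"

definition inj_tensor :: "('k::real_or_complex, 'e::ab_group_add) nspace \<Rightarrow>
    ('k, 'f::ab_group_add) nspace \<Rightarrow> ('k, ('f \<Rightarrow> 'k) \<Rightarrow> 'e) nspace" where
  "inj_tensor X Y =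
    (let L = bounded_ops (dual Y) X;
         R = {elem_tensor X Y x y |x y. x \<in> vecs X \<and> y \<in> vecs Y}
     in L\<lparr>vecs := {u \<in> vecs L. \<forall>e>0. \<exists>v\<in>module.span (smul L) R. nrm L (u - v) < e}\<rparr>)"


section \<open>Asymptotic \<open>c\<^sub>0\<close> spaces\<close>

definition directed :: "'d set \<Rightarrow> ('d \<Rightarrow> 'd \<Rightarrow> bool) \<Rightarrow> bool" where
  "directed D le \<longleftrightarrow> D \<noteq> {} \<and> (\<forall>u\<in>D. le u u) \<and>
    (\<forall>u\<in>D. \<forall>v\<in>D. \<forall>w\<in>D. le u v \<longrightarrow> le v w \<longrightarrow> le u w) \<and>
    (\<forall>u\<in>D. \<forall>v\<in>D. \<exists>w\<in>D. le u w \<and> le v w)"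

definition weakly_null_net :: "('k::real_or_complex, 'e::ab_group_add) nspace \<Rightarrow>
    'd set \<Rightarrow> ('d \<Rightarrow> 'd \<Rightarrow> bool) \<Rightarrow> ('d \<Rightarrow> 'e) \<Rightarrow> bool" where
  "weakly_null_net E D le x \<longleftrightarrow>
    (\<forall>f\<in>vecs (dual E). \<forall>e>0. \<exists>u\<in>D. \<forall>v\<in>D. le u v \<longrightarrow> norm (f (x v)) < e)"

text \<open>Nodes \<open>t = (u\<^sub>1, \<dots>, u\<^sub>k)\<close> are lists, and the restriction of \<open>t\<close> to its first \<open>i\<close> entries is
  \<open>take i t\<close>.\<close>

definition weakly_null_tree :: "('k::real_or_complex, 'e::ab_group_add) nspace \<Rightarrow>
    'd set \<Rightarrow> ('d \<Rightarrow> 'd \<Rightarrow> bool) \<Rightarrow> nat \<Rightarrow> ('d list \<Rightarrow> 'e) \<Rightarrow> bool" where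
  "weakly_null_tree E D le n x \<longleftrightarrow>
    (\<forall>t. set t \<subseteq> D \<and> length t < n \<longrightarrow> weakly_null_net E D le (\<lambda>u. x (t @ [u])))"

text \<open>The space of scalar \<open>n\<close>-tuples, indexed by \<open>{1..n}\<close>.\<close>

definition tuples :: "nat \<Rightarrow> (nat \<Rightarrow> 'k::zero) set" where
  "tuples n = {a. \<forall>i. i \<notin> {1..n} \<longrightarrow> a i = 0}"

definition norm_on_tuples :: "nat \<Rightarrow> ((nat \<Rightarrow> 'k::real_or_complex) \<Rightarrow> real) \<Rightarrow> bool" where
  "norm_on_tuples n p \<longleftrightarrow>
    (\<forall>a\<in>tuples n. p a \<ge> 0 \<and> (p a = 0 \<longleftrightarrow> a = 0)) \<and>
    (\<forall>c. \<forall>a\<in>tuples n. p (\<lambda>i. c * a i) = norm c * p a) \<and>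
    (\<forall>a\<in>tuples n. \<forall>b\<in>tuples n. p (a + b) \<le> p a + p b)"

definition sup_norm :: "nat \<Rightarrow> (nat \<Rightarrow> 'k::real_normed_field) \<Rightarrow> real" where
  "sup_norm n a = (MAX i\<in>{1..n}. norm (a i))"

definition tree_represents :: "('k::real_or_complex, 'e::ab_group_add) nspace \<Rightarrow> nat \<Rightarrow>
    ((nat \<Rightarrow> 'k) \<Rightarrow> real) \<Rightarrow> real \<Rightarrow> 'd set \<Rightarrow> ('d \<Rightarrow> 'd \<Rightarrow> bool) \<Rightarrow> ('d list \<Rightarrow> 'e) \<Rightarrow> bool" where
  "tree_represents E n p b D le x \<longleftrightarrow> directed D le \<and> weakly_null_tree E D le n x \<and>
    (\<forall>t. set t \<subseteq> D \<and> 1 \<le> length t \<and> length t \<le> n \<longrightarrow> x t \<in> nsphere E) \<and>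
    (\<forall>a\<in>tuples n. sup_norm n a = 1 \<longrightarrow> (\<forall>t. set t \<subseteq> D \<and> length t = n \<longrightarrow>
      inverse b * nrm E (\<Sum>i=1..n. smul E (a i) (x (take i t))) \<le> p a \<and>
      p a \<le> b * nrm E (\<Sum>i=1..n. smul E (a i) (x (take i t)))))"

text \<open>
  The collection \<open>{E}\<^sub>n\<close>. One cannot quantify over directed sets of all types; those whose elements
  are sets of vectors (with an arbitrary ordering) suffice, because any representing tree can be
  reindexed by weak neighbourhoods of \<open>0\<close>: see lemma \<open>tree_represents_reindex\<close>.
\<close>

definition asymptotic_norms :: "('k::real_or_complex, 'e::ab_group_add) nspace \<Rightarrow> nat \<Rightarrow>
    ((nat \<Rightarrow> 'k) \<Rightarrow> real) set" where
  "asymptotic_norms E n = {p. norm_on_tuples n p \<and>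
    (\<forall>b>1. \<exists>(D :: 'e set set) le x. tree_represents E n p b D le x)}"

definition asymptotic_c0 :: "('k::real_or_complex, 'e::ab_group_add) nspace \<Rightarrow> bool" where
  "asymptotic_c0 E \<longleftrightarrow> infinite_dim E \<and>
    (\<exists>C\<ge>1. \<forall>n\<ge>1. \<forall>p\<in>asymptotic_norms E n. \<forall>a\<in>tuples n.
      inverse C * sup_norm n a \<le> p a \<and> p a \<le> C * sup_norm n a)"

lemma tree_represents_reindex:
  fixes E :: "('k::real_or_complex, 'e::ab_group_add) nspace" and D :: "'d set"
  assumes "tree_represents E n p b D le x"
  shows "\<exists>(D' :: 'e set set) le' x'. tree_represents E n p b D' le' x'"
proof -
  define N where "N F e = {z. \<forall>f\<in>F. norm (f z) < e}" for F :: "('e \<Rightarrow> 'k) set" and e :: real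
  define D' where "D' = {N F e |F e. finite F \<and> F \<subseteq> vecs (dual E) \<and> e > 0}"
  define le' where "le' U V \<longleftrightarrow> V \<subseteq> U" for U V :: "'e set"
  have dir: "directed D le" and wn: "weakly_null_tree E D le n x"
    using assms by (auto simp: tree_represents_def)
  have dir': "directed D' le'"
  proof -
    have "N {} 1 \<in> D'"
      unfolding D'_def by force
    moreover have "\<exists>W\<in>D'. le' U W \<and> le' V W" if UV: "U \<in> D'" "V \<in> D'" for U V
    proof -
      obtain F e where U: "U = N F e" "finite F" "F \<subseteq> vecs (dual E)" "e > 0"
        using UV(1) unfolding D'_def by blast
      obtain G d where V: "V = N G d" "finite G" "G \<subseteq> vecs (dual E)" "d > 0"
        using UV(2) unfolding D'_def by blast
      have "N (F \<union> G) (min e d) \<in> D'"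
        unfolding D'_def using U V by (auto intro!: exI[of _ "F \<union> G"] exI[of _ "min e d"])
      moreover have "N (F \<union> G) (min e d) \<subseteq> U" "N (F \<union> G) (min e d) \<subseteq> V"
        using U(1) V(1) by (auto simp: N_def)
      ultimately show ?thesis
        unfolding le'_def by (intro bexI[of _ "N (F \<union> G) (min e d)"] conjI)
    qed
    moreover have "le' U U" "le' U V \<Longrightarrow> le' V W \<Longrightarrow> le' U W" for U V W
      by (auto simp: le'_def)
    ultimately show ?thesis
      unfolding directed_def by (intro conjI) (blast, metis+)
  qed
  have pick: "\<exists>u\<in>D. x (t @ [u]) \<in> V" if t: "set t \<subseteq> D" "length t < n" and V: "V \<in> D'" for t V
  proof -
    obtain F e where F: "V = N F e" "finite F" "F \<subseteq> vecs (dual E)" "e > 0"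
      using V unfolding D'_def by blast
    have net: "weakly_null_net E D le (\<lambda>u. x (t @ [u]))"
      using wn t unfolding weakly_null_tree_def by blast
    from F(2,3) have "\<exists>u\<in>D. \<forall>v\<in>D. le u v \<longrightarrow> (\<forall>f\<in>F. norm (f (x (t @ [v]))) < e)"
    proof (induction F rule: finite_induct)
      case empty
      then show ?case using dir unfolding directed_def by blast
    next
      case (insert f F)
      then obtain u where u: "u \<in> D" "\<forall>v\<in>D. le u v \<longrightarrow> (\<forall>f\<in>F. norm (f (x (t @ [v]))) < e)"
        by auto
      obtain w where w: "w \<in> D" "\<forall>v\<in>D. le w v \<longrightarrow> norm (f (x (t @ [v]))) < e"
        using net insert.prems F(4) unfolding weakly_null_net_def by blast
      obtain z where "z \<in> D" "le u z" "le w z"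
        using dir u(1) w(1) unfolding directed_def by blast
      moreover from this have "le u v" "le w v" if "v \<in> D" "le z v" for v
        using dir u(1) w(1) that unfolding directed_def by metis+
      ultimately have "\<forall>v\<in>D. le z v \<longrightarrow> (\<forall>f\<in>insert f F. norm (f (x (t @ [v]))) < e)"
        using u w by auto
      then show ?case using \<open>z \<in> D\<close> by blast
    qed
    then obtain u where "u \<in> D" "\<forall>v\<in>D. le u v \<longrightarrow> (\<forall>f\<in>F. norm (f (x (t @ [v]))) < e)"
      by blast
    moreover from this have "le u u"
      using dir unfolding directed_def by blast
    ultimately have "u \<in> D" "\<forall>f\<in>F. norm (f (x (t @ [u]))) < e"
      by auto
    then show ?thesis
      using F(1) by (auto simp: N_def)
  qed
  define \<phi> where "\<phi> t V = (if length t < n then SOME u. u \<in> D \<and> x (t @ [u]) \<in> V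
      else SOME u. u \<in> D)" for t V
  have \<phi>: "x (t @ [\<phi> t V]) \<in> V" if "set t \<subseteq> D" "length t < n" "V \<in> D'" for t V
    using pick[OF that] that(2) unfolding \<phi>_def by (auto intro: someI2)
  have \<phi>D: "\<phi> t V \<in> D" if "set t \<subseteq> D" "V \<in> D'" for t V
  proof (cases "length t < n")
    case True
    then show ?thesis
      using pick[OF that(1) True that(2)] unfolding \<phi>_def by (auto intro: someI2)
  next
    case False
    then show ?thesis
      using dir unfolding \<phi>_def directed_def by (auto simp: some_in_eq)
  qed
  define g where "g = foldl (\<lambda>t V. t @ [\<phi> t V]) []"
  have g_snoc: "g (ts @ [V]) = g ts @ [\<phi> (g ts) V]" for ts V
    by (simp add: g_def)
  have g_len: "length (g ts) = length ts" for ts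
    by (induction ts rule: rev_induct) (simp_all add: g_snoc, simp add: g_def)
  have gD: "set (g ts) \<subseteq> D" if "set ts \<subseteq> D'" for ts
    using that
  proof (induction ts rule: rev_induct)
    case Nil
    then show ?case by (simp add: g_def)
  next
    case (snoc V ts)
    then show ?case by (simp add: g_snoc \<phi>D)
  qed
  have g_take: "take i (g ts) = g (take i ts)" for i ts
  proof (induction ts rule: rev_induct)
    case Nil
    then show ?case by (simp add: g_def)
  next
    case (snoc V ts)
    then show ?case
      by (cases "i \<le> length ts") (simp_all add: g_snoc g_len)
  qed
  have "weakly_null_tree E D' le' n (x \<circ> g)"
    unfolding weakly_null_tree_def weakly_null_net_def
  proof (intro allI impI ballI)
    fix ts f and e :: real
    assume ts: "set ts \<subseteq> D' \<and> length ts < n" and f: "f \<in> vecs (dual E)" and e: "e > 0"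
    have ND: "N {f} e \<in> D'"
      unfolding D'_def using f e by (auto intro!: exI[of _ "{f}"] exI[of _ e])
    have "norm (f ((x \<circ> g) (ts @ [V]))) < e" if "V \<in> D'" "le' (N {f} e) V" for V
    proof -
      have "x (g ts @ [\<phi> (g ts) V]) \<in> V"
        using \<phi> gD g_len ts that(1) by simp
      then show ?thesis
        using that(2) by (auto simp: le'_def N_def g_snoc)
    qed
    then show "\<exists>U\<in>D'. \<forall>V\<in>D'. le' U V \<longrightarrow> norm (f ((x \<circ> g) (ts @ [V]))) < e"
      using ND by blast
  qed
  then have "tree_represents E n p b D' le' (x \<circ> g)"
    using assms dir' unfolding tree_represents_def
    by (auto simp: g_take[symmetric] g_len gD)
  then show ?thesis
    by blast
qed


section \<open>The summable Szlenk index\<close>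

text \<open>
  The library's topology on a function type is that of pointwise convergence, and elements of the
  dual vanish outside the space; so the subspace topology of the dual is the weak-star topology.
\<close>

definition weak_star :: "('k::real_or_complex, 'e::ab_group_add) nspace \<Rightarrow> ('e \<Rightarrow> 'k) topology" where
  "weak_star E = top_of_set (vecs (dual E))"

definition ndiameter :: "('k, 'e::ab_group_add) nspace \<Rightarrow> 'e set \<Rightarrow> real" where
  "ndiameter E A = (if A = {} then 0 else SUP (x, y)\<in>A \<times> A. nrm E (x - y))"

definition szlenk_derivation :: "('k::real_or_complex, 'e::ab_group_add) nspace \<Rightarrow> real \<Rightarrow>
    ('e \<Rightarrow> 'k) set \<Rightarrow> ('e \<Rightarrow> 'k) set" where
  "szlenk_derivation E \<epsilon> K = (if \<epsilon> \<le> 0 then K else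
    {f \<in> K. \<forall>V. openin (weak_star E) V \<and> f \<in> V \<longrightarrow> ndiameter (dual E) (V \<inter> K) > \<epsilon>})"

text \<open>The rightmost member of the list is the first one to be applied.\<close>

definition M_summable_szlenk :: "('k::real_or_complex, 'e::ab_group_add) nspace \<Rightarrow> real \<Rightarrow>
    ('e \<Rightarrow> 'k) set \<Rightarrow> bool" where
  "M_summable_szlenk E M K \<longleftrightarrow>
    (\<forall>es. es \<noteq> [] \<and> foldr (szlenk_derivation E) es K \<noteq> {} \<longrightarrow> sum_list es \<le> M)"

definition summable_szlenk :: "('k::real_or_complex, 'e::ab_group_add) nspace \<Rightarrow> bool" where
  "summable_szlenk E \<longleftrightarrow> (\<exists>M\<ge>0. M_summable_szlenk E M (nball (dual E)))"

end

theory Submission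
  imports Defs
begin

text \<open>
  Everything is reduced to one intermediate property: there is \<open>C\<close> such that every weakly null tree
  in the unit ball has a branch with sum of norm at most \<open>C\<close>.
  From a tree in \<open>X\<^sub>0 \<otimes> X\<^sub>1\<close> all of whose branches have large sums, take functionals \<open>f \<otimes> g\<close> norming the
  branches and pass to weak-star limits from the leaves to the root. In each step the value of
  \<open>f \<otimes> g\<close> on the last vector is bounded by the distances of \<open>f\<close> and of \<open>g\<close> to their limits, because
  the limits nearly vanish there; and these distances are exactly what the Szlenk derivations of the two
  dual balls measure. So the two sums for \<open>X\<^sub>0\<close> and \<open>X\<^sub>1\<close> bound a branch sum. Conversely, a
  point of an iterated Szlenk derivation yields a tree: weakly null vectors are differences of two
  vectors on which nearby functionals in the set are large. In infinite dimensions, a cluster point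
  of the norms \<open>a \<mapsto> \<parallel>\<Sum> a\<^sub>i x\<^sub>i\<parallel>\<close> over the branches with large sums is an asymptotic norm.
\<close>

section \<open>Scalars\<close>

text \<open>Limits are taken along filters: passing to a finer filter replaces passing to a subnet,
  and trees over directed sets appear only where asymptotic norms enter. Two obstacles shape the
  estimates. A Szlenk sum belongs to one fixed list of numbers, whereas the distances to a limit
  vary with the vector; they are therefore rounded to a finite grid and frozen by the pigeonhole
  principle, at a cost per level that can be made as small as the depth demands. And
  \<open>f (u g)\<close> passes to weak-star limits in \<open>f\<close> and \<open>g\<close> jointly
  because \<open>u\<close> is a norm limit of finite sums of elementary tensors. Branches are taken
  in the ball, not in the sphere: the ball absorbs coefficients of modulus at most 1, and the
  equivalence with the Szlenk index then holds in every dimension. Infinite dimension is needed to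
  return to the sphere.\<close>

lemma norm_real_plus_imaginary:
  fixes i :: "'k::real_normed_field"
  assumes "i * i = - 1"
  shows "norm (of_real a + of_real b * i) \<ge> (\<bar>a\<bar> + \<bar>b\<bar>) / 2"
proof -
  have "norm i * norm i = 1"
    using assms by (metis norm_minus_cancel norm_mult norm_one)
  then have i: "norm i = 1"
    by (metis abs_norm_cancel abs_square_eq_1 power2_eq_square)
  \<comment> \<open>The norm is known to be multiplicative, so the number is estimated through its
    product with the conjugate, whose norm the triangle inequality bounds by
    \<open>\<bar>a\<bar> + \<bar>b\<bar>\<close>.\<close>
  have "(of_real a + of_real b * i) * (of_real a - of_real b * i) = of_real (a\<^sup>2 + b\<^sup>2)"
  proof -
    have "(of_real a + of_real b * i) * (of_real a - of_real b * i)
        = of_real a * of_real a - of_real b * of_real b * (i * i)"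
      by (simp add: algebra_simps)
    then show ?thesis
      by (simp add: assms power2_eq_square)
  qed
  then have "norm (of_real a + of_real b * i) * norm (of_real a - of_real b * i) = a\<^sup>2 + b\<^sup>2"
    by (metis norm_mult norm_of_real abs_of_nonneg sum_power2_ge_zero)
  moreover have "norm (of_real a - of_real b * i) \<le> \<bar>a\<bar> + \<bar>b\<bar>"
    by (rule norm_triangle_le_diff) (simp add: norm_mult i)
  ultimately have "a\<^sup>2 + b\<^sup>2 \<le> norm (of_real a + of_real b * i) * (\<bar>a\<bar> + \<bar>b\<bar>)"
    by (metis mult_left_mono norm_ge_zero)
  moreover have "(\<bar>a\<bar> + \<bar>b\<bar>) * (\<bar>a\<bar> + \<bar>b\<bar>) \<le> 2 * (a\<^sup>2 + b\<^sup>2)"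
  proof -
    have "0 \<le> (\<bar>a\<bar> - \<bar>b\<bar>)\<^sup>2" by simp
    also have "\<dots> = 2 * (a\<^sup>2 + b\<^sup>2) - (\<bar>a\<bar> + \<bar>b\<bar>) * (\<bar>a\<bar> + \<bar>b\<bar>)"
      by (simp add: power2_eq_square algebra_simps)
    finally show ?thesis by simp
  qed
  ultimately have "(\<bar>a\<bar> + \<bar>b\<bar>) * (\<bar>a\<bar> + \<bar>b\<bar>)
      \<le> (2 * norm (of_real a + of_real b * i)) * (\<bar>a\<bar> + \<bar>b\<bar>)"
    by simp
  then have "\<bar>a\<bar> + \<bar>b\<bar> \<le> 2 * norm (of_real a + of_real b * i)"
  proof (cases "\<bar>a\<bar> + \<bar>b\<bar> > 0")
    case True
    assume "(\<bar>a\<bar> + \<bar>b\<bar>) * (\<bar>a\<bar> + \<bar>b\<bar>)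
      \<le> (2 * norm (of_real a + of_real b * i)) * (\<bar>a\<bar> + \<bar>b\<bar>)"
    then show ?thesis using True by (rule mult_right_le_imp_le)
  next
    case False
    then have "\<bar>a\<bar> + \<bar>b\<bar> \<le> 0" by simp
    then show ?thesis by (rule order_trans) simp
  qed
  then show ?thesis by simp
qed

text \<open>Power trick: applied to \<open>w ^ n\<close>, the estimate with the factor 1/2 loses
  this factor once and not \<open>n\<close> times, while a strict inequality for \<open>w\<close>
  would be amplified beyond it. The sharp bound lets the Hahn-Banach theorem keep the norm over
  complex scalars.\<close>

lemma abs_le_norm_real_plus_imaginary:
  fixes i :: "'k::real_normed_field"
  assumes i: "i * i = - 1"
  shows "\<bar>a\<bar> \<le> norm (of_real a + of_real b * i)"
proof (rule ccontr)
  define \<phi> where "\<phi> w = of_real (Re w) + of_real (Im w) * i" for w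
  have "\<phi> (v * w) = \<phi> v * \<phi> w" for v w
  proof -
    have "\<phi> v * \<phi> w = of_real (Re v * Re w) + of_real (Im v * Im w) * (i * i)
        + of_real (Re v * Im w + Im v * Re w) * i"
      by (simp add: \<phi>_def algebra_simps)
    then show ?thesis by (simp add: \<phi>_def i algebra_simps)
  qed
  then have pow: "\<phi> (w ^ n) = \<phi> w ^ n" for w n
    by (induction n) (simp_all add: \<phi>_def)
  have half: "cmod w / 2 \<le> norm (\<phi> w)" for w
    using norm_real_plus_imaginary[OF i, of "Re w" "Im w"] cmod_le[of w] by (simp add: \<phi>_def)
  define w where "w = Complex a b"
  assume "\<not> \<bar>a\<bar> \<le> norm (of_real a + of_real b * i)"
  then have less: "norm (\<phi> w) < cmod w"
    using abs_Re_le_cmod[of w] by (simp add: \<phi>_def w_def)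
  then have "norm (\<phi> w) > 0"
    using half[of w] by (smt (verit) norm_ge_zero half_gt_zero_iff)
  then have "1 < cmod w / norm (\<phi> w)" using less by simp
  then obtain n where "2 < (cmod w / norm (\<phi> w)) ^ n"
    using real_arch_pow by blast
  then have "2 * norm (\<phi> w) ^ n < cmod w ^ n"
    using \<open>norm (\<phi> w) > 0\<close> by (simp add: power_divide field_simps)
  moreover have "cmod w ^ n / 2 \<le> norm (\<phi> w) ^ n"
    using half[of "w ^ n"] pow[of w n] by (simp add: norm_power)
  ultimately show False by simp
qed

lemma compact_cball_scalar: "compact (cball (0::'k::real_or_complex) r)"
proof -
  consider "\<forall>x::'k. \<exists>a. x = a *\<^sub>R 1"
    | (im) i :: 'k where "i * i = - 1" "\<forall>x. \<exists>a b. x = a *\<^sub>R 1 + b *\<^sub>R i"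
    using real_or_complex by metis
  then show ?thesis
  proof cases
    case 1
    have "cball (0::'k) r = of_real ` {-r..r}"
    proof (intro set_eqI iffI)
      fix x :: 'k assume x: "x \<in> cball 0 r"
      obtain a where "x = a *\<^sub>R 1" using 1 by blast
      then show "x \<in> of_real ` {-r..r}"
        using x by (auto intro!: image_eqI[of _ _ a] simp: of_real_def)
    qed auto
    then show ?thesis
      by (auto intro!: compact_continuous_image continuous_intros)
  next
    case im
    let ?g = "\<lambda>(a, b). of_real a + of_real b * i"
    have "compact (?g ` ({-2*r..2*r} \<times> {-2*r..2*r}))"
      unfolding case_prod_beta
      by (intro compact_continuous_image compact_Times continuous_intros) auto
    \<comment> \<open>The factor 1/2 in the norm estimate is why the square reaches to
      \<open>2 * r\<close>.\<close>
    moreover have "cball 0 r \<subseteq> ?g ` ({-2*r..2*r} \<times> {-2*r..2*r})"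
    proof
      fix x :: 'k assume x: "x \<in> cball 0 r"
      obtain a b where ab: "x = a *\<^sub>R 1 + b *\<^sub>R i" using im(2) by blast
      then have eq: "x = of_real a + of_real b * i"
        by (simp add: scaleR_conv_of_real)
      have "\<bar>a\<bar> + \<bar>b\<bar> \<le> 2 * r"
        using norm_real_plus_imaginary[OF im(1), of a b] x eq by simp
      then show "x \<in> ?g ` ({-2*r..2*r} \<times> {-2*r..2*r})"
        using eq by (auto intro!: image_eqI[of _ _ "(a, b)"])
    qed
    ultimately show ?thesis
      by (metis closed_cball closed_Int_compact inf.absorb_iff1)
  qed
qed

section \<open>Tychonoff compactness and cluster points along filters\<close>

lemma compact_pointwise_bounded:
  "compact {h :: 'i \<Rightarrow> 'c::real_normed_vector. \<forall>i. h i \<in> cball 0 (R i)}"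
  if "\<And>r. compact (cball (0::'c) r)"
proof -
  have "compactin (product_topology (\<lambda>i::'i. euclidean :: 'c topology) UNIV) (PiE UNIV (\<lambda>i. cball 0 (R i)))"
    using that by (simp add: compactin_PiE)
  moreover have "PiE UNIV (\<lambda>i. cball 0 (R i)) = {h :: 'i \<Rightarrow> 'c. \<forall>i. h i \<in> cball 0 (R i)}"
    by (auto simp: PiE_def)
  ultimately show ?thesis
    by (simp add: euclidean_product_topology)
qed

text \<open>The infimum is the counterpart of a subnet: it is finer than \<open>F\<close>, and along
  it \<open>h\<close> converges to \<open>q\<close>. Limits of functionals, of vectors seen as
  functions on the dual, and of norms are all obtained in this way.\<close>

lemma compact_filter_cluster:
  assumes "compact K" "F \<noteq> bot" "eventually (\<lambda>x. h x \<in> K) F"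
  obtains q where "q \<in> K" "inf F (filtercomap h (nhds q)) \<noteq> bot"
proof -
  have "filtermap h F \<noteq> bot" "eventually (\<lambda>x. x \<in> K) (filtermap h F)"
    using assms by (auto simp: eventually_filtermap filtermap_bot_iff)
  then obtain q where q: "q \<in> K" "inf (nhds q) (filtermap h F) \<noteq> bot"
    using assms(1) unfolding compact_filter by blast
  have "inf F (filtercomap h (nhds q)) \<noteq> bot"
  proof
    assume "inf F (filtercomap h (nhds q)) = bot"
    then have "filtermap h (inf F (filtercomap h (nhds q))) = bot" by simp
    moreover have "inf (nhds q) (filtermap h F) \<le> filtermap h (inf F (filtercomap h (nhds q)))"
    proof (rule filter_leI)
      fix P assume "eventually P (filtermap h (inf F (filtercomap h (nhds q))))"
      then obtain A B where "eventually A F" "eventually B (nhds q)" "\<And>x. A x \<Longrightarrow> B (h x) \<Longrightarrow> P (h x)"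
        unfolding eventually_filtermap eventually_inf eventually_filtercomap by blast
      then show "eventually P (inf (nhds q) (filtermap h F))"
        unfolding eventually_inf eventually_filtermap
        by (intro exI[of _ B] exI[of _ "\<lambda>z. B z \<longrightarrow> P z"]) (auto elim: eventually_mono)
    qed
    ultimately show False using q(2) by (simp add: bot_unique)
  qed
  with q(1) show thesis by (rule that)
qed

section \<open>Normed spaces\<close>

text \<open>The vector space laws are demanded on the whole type, with \<open>vecs\<close> a
  subspace, so that \<open>module.span\<close> in the definitions is an honest span; only the norm
  axioms are restricted to \<open>vecs\<close>.\<close>

locale normed_nspace =
  fixes E :: "('k::real_or_complex, 'e::ab_group_add) nspace"
  assumes vector_space_smul: "vector_space (smul E)"
    and zero_mem: "0 \<in> vecs E"
    and add_mem: "x \<in> vecs E \<Longrightarrow> y \<in> vecs E \<Longrightarrow> x + y \<in> vecs E"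
    and smul_mem: "x \<in> vecs E \<Longrightarrow> smul E c x \<in> vecs E"
    and nrm_add: "x \<in> vecs E \<Longrightarrow> y \<in> vecs E \<Longrightarrow> nrm E (x + y) \<le> nrm E x + nrm E y"
    and nrm_smul: "x \<in> vecs E \<Longrightarrow> nrm E (smul E c x) = norm c * nrm E x"
    and nrm_eq_0D: "x \<in> vecs E \<Longrightarrow> nrm E x = 0 \<Longrightarrow> x = 0"
begin

sublocale vs: vector_space "smul E"
  by (rule vector_space_smul)

lemma uminus_mem: "x \<in> vecs E \<Longrightarrow> - x \<in> vecs E"
  using smul_mem[of x "- 1"] by simp

lemma diff_mem: "x \<in> vecs E \<Longrightarrow> y \<in> vecs E \<Longrightarrow> x - y \<in> vecs E"
  using add_mem[of x "- y"] uminus_mem by simp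

lemma subspace_vecs: "vs.subspace (vecs E)"
  by (simp add: vs.subspace_def zero_mem add_mem smul_mem)

lemma sum_mem: "(\<And>i. i \<in> I \<Longrightarrow> g i \<in> vecs E) \<Longrightarrow> (\<Sum>i\<in>I. g i) \<in> vecs E"
  using vs.subspace_sum[OF subspace_vecs] by blast

lemma nrm_zero [simp]: "nrm E 0 = 0"
  using nrm_smul[OF zero_mem, of 0] by simp

lemma nrm_minus: "x \<in> vecs E \<Longrightarrow> nrm E (- x) = nrm E x"
  using nrm_smul[of x "- 1"] by simp

lemma nrm_nonneg: "x \<in> vecs E \<Longrightarrow> 0 \<le> nrm E x"
  using nrm_add[of x "- x"] nrm_minus[of x] uminus_mem[of x] by simp

lemma nrm_diff: "x \<in> vecs E \<Longrightarrow> y \<in> vecs E \<Longrightarrow> nrm E (x - y) \<le> nrm E x + nrm E y"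
  using nrm_add[of x "- y"] uminus_mem[of y] nrm_minus[of y] by simp

lemma nrm_triangle_sub: "x \<in> vecs E \<Longrightarrow> y \<in> vecs E \<Longrightarrow> nrm E x \<le> nrm E y + nrm E (x - y)"
  using nrm_add[of y "x - y"] diff_mem[of x y] by simp

lemma nrm_sum:
  "(\<And>i. i \<in> I \<Longrightarrow> g i \<in> vecs E) \<Longrightarrow> nrm E (\<Sum>i\<in>I. g i) \<le> (\<Sum>i\<in>I. nrm E (g i))"
proof (induction I rule: infinite_finite_induct)
  case (insert j J)
  then show ?case
    using nrm_add[of "g j" "\<Sum>i\<in>J. g i"] sum_mem[of J g] by force
qed auto

lemma zero_in_ball: "0 \<in> nball E"
  by (simp add: nball_def zero_mem)

lemma nballD: "x \<in> nball E \<Longrightarrow> x \<in> vecs E" "x \<in> nball E \<Longrightarrow> nrm E x \<le> 1"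
  by (auto simp: nball_def)

end

lemma normed_nspace_scalars: "normed_nspace (whole ((*) :: 'k \<Rightarrow> 'k \<Rightarrow> 'k::real_or_complex))"
  by unfold_locales (auto simp: whole_def algebra_simps norm_triangle_ineq norm_mult)

locale normed_nspace_pair = E: normed_nspace E + F: normed_nspace F
  for E :: "('k::real_or_complex, 'e::ab_group_add) nspace"
    and F :: "('k, 'f::ab_group_add) nspace"
begin

abbreviation "L \<equiv> bounded_ops E F"

lemma op_iff:
  "T \<in> vecs L \<longleftrightarrow> (\<forall>x. x \<notin> vecs E \<longrightarrow> T x = 0) \<and> (\<forall>x\<in>vecs E. T x \<in> vecs F) \<and>
    (\<forall>x\<in>vecs E. \<forall>y\<in>vecs E. T (x + y) = T x + T y) \<and>
    (\<forall>c. \<forall>x\<in>vecs E. T (smul E c x) = smul F c (T x)) \<and>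
    (\<exists>B. \<forall>x\<in>vecs E. nrm F (T x) \<le> B * nrm E x)"
  by (simp add: bounded_ops_def)

lemma
  assumes "T \<in> vecs L"
  shows op_outside: "x \<notin> vecs E \<Longrightarrow> T x = 0"
    and op_mem: "T x \<in> vecs F"
    and op_add: "x \<in> vecs E \<Longrightarrow> y \<in> vecs E \<Longrightarrow> T (x + y) = T x + T y"
    and op_smul: "x \<in> vecs E \<Longrightarrow> T (smul E c x) = smul F c (T x)"
    and op_bound: "\<exists>B. \<forall>x\<in>vecs E. nrm F (T x) \<le> B * nrm E x"
  using assms F.zero_mem by (cases "x \<in> vecs E"; auto simp: op_iff)+

lemma op_zero: "T \<in> vecs L \<Longrightarrow> T 0 = 0"
  using op_add[OF _ E.zero_mem E.zero_mem] by simp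

lemma op_uminus: "T \<in> vecs L \<Longrightarrow> x \<in> vecs E \<Longrightarrow> T (- x) = - T x"
  using op_smul[of T x "- 1"] by simp

lemma op_diff: "T \<in> vecs L \<Longrightarrow> x \<in> vecs E \<Longrightarrow> y \<in> vecs E \<Longrightarrow> T (x - y) = T x - T y"
  using op_add[of T x "- y"] op_uminus[of T y] E.uminus_mem by simp

lemma op_sum:
  assumes "T \<in> vecs L"
  shows "(\<And>i. i \<in> I \<Longrightarrow> g i \<in> vecs E) \<Longrightarrow> T (\<Sum>i\<in>I. g i) = (\<Sum>i\<in>I. T (g i))"
proof (induction I rule: infinite_finite_induct)
  case (insert j J)
  then show ?case
    using op_add[OF assms, of "g j" "\<Sum>i\<in>J. g i"] E.sum_mem[of J g] by auto
qed (auto simp: op_zero[OF assms])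

lemma nrm_op: "nrm L T = (SUP x\<in>nball E. nrm F (T x))"
  by (simp add: bounded_ops_def)

lemma smul_op: "smul L c T x = smul F c (T x)"
  by (simp add: bounded_ops_def)

lemma op_bdd: assumes "T \<in> vecs L" shows "bdd_above ((\<lambda>x. nrm F (T x)) ` nball E)"
proof -
  obtain B where B: "\<forall>x\<in>vecs E. nrm F (T x) \<le> B * nrm E x"
    using op_bound[OF assms] by blast
  have "nrm F (T x) \<le> \<bar>B\<bar>" if "x \<in> nball E" for x
  proof -
    have "nrm F (T x) \<le> B * nrm E x" using B that E.nballD by blast
    also have "\<dots> \<le> \<bar>B\<bar> * 1"
      using that E.nballD E.nrm_nonneg by (intro mult_mono) auto
    finally show ?thesis by simp
  qed
  then show ?thesis by (auto intro!: bdd_aboveI2)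
qed

lemma nrm_op_upper: "T \<in> vecs L \<Longrightarrow> x \<in> nball E \<Longrightarrow> nrm F (T x) \<le> nrm L T"
  unfolding nrm_op by (rule cSUP_upper[OF _ op_bdd])

lemma nrm_op_least: "(\<And>x. x \<in> nball E \<Longrightarrow> nrm F (T x) \<le> B) \<Longrightarrow> nrm L T \<le> B"
  unfolding nrm_op by (rule cSUP_least) (use E.zero_in_ball in auto)

lemma less_nrm_op: "T \<in> vecs L \<Longrightarrow> c < nrm L T \<Longrightarrow> \<exists>x\<in>nball E. c < nrm F (T x)"
  unfolding nrm_op by (subst (asm) less_cSUP_iff) (use E.zero_in_ball op_bdd in auto)

lemma op_le: assumes T: "T \<in> vecs L" and x: "x \<in> vecs E" shows "nrm F (T x) \<le> nrm L T * nrm E x"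
proof (cases "nrm E x = 0")
  case True
  then show ?thesis using E.nrm_eq_0D[OF x] op_zero[OF T] by simp
next
  case False
  then have pos: "nrm E x > 0" using E.nrm_nonneg[OF x] by simp
  let ?c = "of_real (1 / nrm E x)"
  have "smul E ?c x \<in> nball E"
    using E.nrm_smul[OF x, of ?c] E.smul_mem[OF x, of ?c] pos by (auto simp: nball_def norm_divide)
  from nrm_op_upper[OF T this] have "norm (?c::'k) * nrm F (T x) \<le> nrm L T"
    using op_smul[OF T x, of ?c] F.nrm_smul[OF op_mem[OF T], of ?c] by simp
  then show ?thesis using pos by (simp add: norm_divide field_simps)
qed

lemma op_zero_mem: "0 \<in> vecs L"
  by (auto simp: op_iff F.zero_mem intro!: exI[of _ 0])

lemma op_add_mem: assumes S: "S \<in> vecs L" and T: "T \<in> vecs L" shows "S + T \<in> vecs L"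
proof -
  have "nrm F (S x + T x) \<le> (nrm L S + nrm L T) * nrm E x" if "x \<in> vecs E" for x
    using F.nrm_add[OF op_mem[OF S] op_mem[OF T], of x x] op_le[OF S that] op_le[OF T that]
    by (simp add: algebra_simps)
  then have "\<exists>B. \<forall>x\<in>vecs E. nrm F ((S + T) x) \<le> B * nrm E x"
    by auto
  then show ?thesis
    using S T unfolding op_iff
    by (intro conjI) (auto simp: F.add_mem algebra_simps F.vs.scale_right_distrib)
qed

lemma op_smul_mem: assumes T: "T \<in> vecs L" shows "smul L c T \<in> vecs L"
proof -
  have "nrm F (smul F c (T x)) \<le> (norm c * nrm L T) * nrm E x" if "x \<in> vecs E" for x
    using F.nrm_smul[OF op_mem[OF T], of c x] op_le[OF T that]
    by (simp add: mult_left_mono mult.assoc)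
  then have "\<exists>B. \<forall>x\<in>vecs E. nrm F (smul L c T x) \<le> B * nrm E x"
    by (auto simp: smul_op)
  then show ?thesis
    using T unfolding op_iff
    by (intro conjI) (auto simp: smul_op F.smul_mem F.vs.scale_right_distrib mult.commute)
qed

lemma normed_nspace_ops: "normed_nspace L"
proof
  fix a b :: 'k and S T :: "'e \<Rightarrow> 'f"
  show "smul L a (S + T) = smul L a S + smul L a T"
    by (rule ext) (simp add: smul_op F.vs.scale_right_distrib)
  show "smul L (a + b) S = smul L a S + smul L b S"
    by (rule ext) (simp add: smul_op F.vs.scale_left_distrib)
  show "smul L a (smul L b S) = smul L (a * b) S"
    by (rule ext) (simp add: smul_op)
  show "smul L 1 S = S"
    by (rule ext) (simp add: smul_op)
next
  fix S T assume S: "S \<in> vecs L" and T: "T \<in> vecs L"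
  show "nrm L (S + T) \<le> nrm L S + nrm L T"
  proof (rule nrm_op_least)
    fix x assume "x \<in> nball E"
    then show "nrm F ((S + T) x) \<le> nrm L S + nrm L T"
      using F.nrm_add[OF op_mem[OF S] op_mem[OF T], of x x] nrm_op_upper[OF S] nrm_op_upper[OF T]
      by force
  qed
next
  fix T c assume T: "T \<in> vecs L"
  \<comment> \<open>One inequality is enough: for nonzero \<open>c\<close>, its instance for
    \<open>inverse c\<close> yields the other.\<close>
  have le: "nrm L (smul L c T) \<le> norm c * nrm L T" if T: "T \<in> vecs L" for c T
  proof (rule nrm_op_least)
    fix x assume "x \<in> nball E"
    then show "nrm F (smul L c T x) \<le> norm c * nrm L T"
      using F.nrm_smul[OF op_mem[OF T], of c x] nrm_op_upper[OF T]
      by (simp add: smul_op mult_left_mono)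
  qed
  show "nrm L (smul L c T) = norm c * nrm L T"
  proof (cases "c = 0")
    case True
    then have "smul L c T = (\<lambda>x. 0)" by (auto simp: smul_op)
    moreover have "nball E \<noteq> {}" using E.zero_in_ball by blast
    ultimately show ?thesis using True by (simp add: nrm_op)
  next
    case False
    have "smul L (inverse c) (smul L c T) = T"
      using False by (auto simp: smul_op)
    then have "nrm L T \<le> norm (inverse c) * nrm L (smul L c T)"
      using le[OF op_smul_mem[OF T], where c = "inverse c"] by metis
    then show ?thesis
      using le[OF T, of c] False by (simp add: norm_divide inverse_eq_divide field_simps)
  qed
next
  fix T assume T: "T \<in> vecs L" and 0: "nrm L T = 0"
  show "T = 0"
  proof
    fix x
    show "T x = 0 x"
    proof (cases "x \<in> vecs E")
      case True
      then have "nrm F (T x) = 0"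
        using op_le[OF T True] 0 F.nrm_nonneg[OF op_mem[OF T], of x] by simp
      then show ?thesis using F.nrm_eq_0D[OF op_mem[OF T]] by simp
    qed (simp add: op_outside[OF T])
  qed
qed (auto simp: op_zero_mem op_add_mem op_smul_mem)

end

section \<open>The dual space and the weak-star compactness of its ball\<close>

context normed_nspace
begin

interpretation D: normed_nspace_pair E "whole ((*) :: 'k \<Rightarrow> 'k \<Rightarrow> 'k)"
  by (simp add: normed_nspace_pair_def normed_nspace_axioms normed_nspace_scalars)

lemma whole_scalars_simps [simp]:
  "vecs (whole ((*) :: 'k \<Rightarrow> 'k \<Rightarrow> 'k)) = UNIV" "smul (whole ((*) :: 'k \<Rightarrow> 'k \<Rightarrow> 'k)) = (*)"
  "nrm (whole ((*) :: 'k \<Rightarrow> 'k \<Rightarrow> 'k)) = norm"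
  by (simp_all add: whole_def)

lemma normed_nspace_dual: "normed_nspace (dual E)"
  unfolding dual_def by (rule D.normed_nspace_ops)

interpretation dual: normed_nspace "dual E"
  by (rule normed_nspace_dual)

lemmas dual_iff = D.op_iff[folded dual_def, unfolded whole_scalars_simps, simplified]
lemmas dual_outside = D.op_outside[folded dual_def]
lemmas dual_add = D.op_add[folded dual_def]
lemmas dual_smul = D.op_smul[folded dual_def, unfolded whole_scalars_simps]
lemmas dual_zero = D.op_zero[folded dual_def]
lemmas dual_diff = D.op_diff[folded dual_def]
lemmas dual_sum = D.op_sum[folded dual_def]
lemmas smul_dual = D.smul_op[folded dual_def, unfolded whole_scalars_simps]
lemmas nrm_dual_upper = D.nrm_op_upper[folded dual_def, unfolded whole_scalars_simps]
lemmas nrm_dual_least = D.nrm_op_least[folded dual_def, unfolded whole_scalars_simps]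
lemmas less_nrm_dual = D.less_nrm_op[folded dual_def, unfolded whole_scalars_simps]
lemmas dual_le = D.op_le[folded dual_def, unfolded whole_scalars_simps]

lemma dual_ball_le: "f \<in> nball (dual E) \<Longrightarrow> x \<in> vecs E \<Longrightarrow> norm (f x) \<le> nrm E x"
  using dual_le[of f x] dual.nballD[of f] nrm_nonneg[of x]
  by (meson mult_left_le_one_le dual.nrm_nonneg order_trans)

text \<open>On the right the operator norm has disappeared: every condition involves finitely many
  values of \<open>f\<close> and is closed for pointwise convergence.\<close>

lemma dual_ball_iff:
  "f \<in> nball (dual E) \<longleftrightarrow> (\<forall>x. x \<notin> vecs E \<longrightarrow> f x = 0) \<and>
    (\<forall>x\<in>vecs E. \<forall>y\<in>vecs E. f (x + y) = f x + f y) \<and>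
    (\<forall>c. \<forall>x\<in>vecs E. f (smul E c x) = c * f x) \<and> (\<forall>x\<in>vecs E. norm (f x) \<le> nrm E x)"
    (is "?l \<longleftrightarrow> ?r")
proof
  assume l: ?l
  then show ?r
    using dual_ball_le[OF l] dual.nballD(1)[OF l] dual_iff[of f] by blast
next
  assume r: ?r
  then have "f \<in> vecs (dual E)"
    unfolding dual_iff by (intro conjI exI[of _ 1]) auto
  moreover have "nrm (dual E) f \<le> 1"
    by (rule nrm_dual_least) (use r nballD in force)
  ultimately show ?l by (simp add: nball_def)
qed

lemma closed_dual_ball: "closed (nball (dual E))"
proof -
  have eq: "nball (dual E) = (\<Inter>x\<in>- vecs E. {f. f x = 0}) \<inter>
      (\<Inter>x\<in>vecs E. \<Inter>y\<in>vecs E. {f. f (x + y) = f x + f y}) \<inter>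
      (\<Inter>c. \<Inter>x\<in>vecs E. {f. f (smul E c x) = c * f x}) \<inter> (\<Inter>x\<in>vecs E. {f. norm (f x) \<le> nrm E x})"
    unfolding set_eq_iff dual_ball_iff by simp blast
  have c: "continuous_on UNIV (\<lambda>f :: 'e \<Rightarrow> 'k. f x)" for x
    by (rule continuous_on_product_coordinates)
  show ?thesis
    unfolding eq
    by (intro closed_Int closed_INT ballI closed_Collect_eq closed_Collect_le continuous_intros c)
qed

text \<open>Banach-Alaoglu: the ball is closed in a product of discs, whose radius is 0 outside the
  space.\<close>

theorem compact_dual_ball: "compact (nball (dual E))"
proof -
  let ?P = "{f :: 'e \<Rightarrow> 'k. \<forall>x. f x \<in> cball 0 (if x \<in> vecs E then nrm E x else 0)}"
  have "compact (?P \<inter> nball (dual E))"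
    by (intro compact_Int_closed compact_pointwise_bounded compact_cball_scalar closed_dual_ball)
  moreover have "nball (dual E) \<subseteq> ?P"
    by (auto simp: dual_ball_iff)
  ultimately show ?thesis by (simp add: Int_absorb1)
qed

end

section \<open>The Hahn-Banach theorem\<close>

context normed_nspace
begin

text \<open>Homogeneity is an inequality because \<open>r\<close> and \<open>1 / r\<close> together
  give equality. The value 0 outside the space lets the order of functions serve as the order of
  sublinear functionals in Zorn's lemma.\<close>

definition sublin :: "('e \<Rightarrow> real) \<Rightarrow> bool" where
  "sublin q \<longleftrightarrow> (\<forall>x. x \<notin> vecs E \<longrightarrow> q x = 0) \<and>
    (\<forall>x\<in>vecs E. \<forall>y\<in>vecs E. q (x + y) \<le> q x + q y) \<and>
    (\<forall>r>0. \<forall>x\<in>vecs E. q (smul E (of_real r) x) \<le> r * q x)"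

lemma sublin_add: "sublin q \<Longrightarrow> x \<in> vecs E \<Longrightarrow> y \<in> vecs E \<Longrightarrow> q (x + y) \<le> q x + q y"
  by (simp add: sublin_def)

lemma sublin_scale:
  assumes q: "sublin q" and x: "x \<in> vecs E" and r: "r > 0"
  shows "q (smul E (of_real r) x) = r * q x"
proof (rule antisym)
  show "q (smul E (of_real r) x) \<le> r * q x"
    using assms by (simp add: sublin_def)
  have "q (smul E (of_real (1 / r)) (smul E (of_real r) x)) \<le> (1 / r) * q (smul E (of_real r) x)"
    using q r smul_mem[OF x] unfolding sublin_def by (metis zero_less_divide_1_iff)
  moreover have "smul E (of_real (1 / r)) (smul E (of_real r) x) = x"
    using r by (simp flip: of_real_mult)
  ultimately show "r * q x \<le> q (smul E (of_real r) x)"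
    using r by (simp add: field_simps)
qed

lemma sublin_zero: "sublin q \<Longrightarrow> q 0 = 0"
  using sublin_scale[of q 0 2] zero_mem by simp

lemma sublin_minus: "sublin q \<Longrightarrow> x \<in> vecs E \<Longrightarrow> - q (- x) \<le> q x"
  using sublin_add[of q x "- x"] uminus_mem[of x] sublin_zero[of q] by simp

text \<open>The classical device for showing that minimal sublinear functionals are linear: the
  infimum is again sublinear, lies below \<open>q\<close>, and is at most \<open>- q y\<close> at
  \<open>- y\<close>.\<close>

definition lower :: "('e \<Rightarrow> real) \<Rightarrow> 'e \<Rightarrow> 'e \<Rightarrow> real" where
  "lower q y x = (if x \<in> vecs E then INF t\<in>{0..}. q (x + smul E (of_real t) y) - t * q y else 0)"

lemma lower_bdd:
  assumes q: "sublin q" and x: "x \<in> vecs E" and y: "y \<in> vecs E"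
  shows "bdd_below ((\<lambda>t. q (x + smul E (of_real t) y) - t * q y) ` {0..})"
proof (rule bdd_belowI2)
  fix t :: real assume "t \<in> {0..}"
  then have "q (smul E (of_real t) y) = t * q y"
    using sublin_scale[OF q y, of t] sublin_zero[OF q] by (cases "t = 0") auto
  moreover have "q (smul E (of_real t) y) \<le> q (x + smul E (of_real t) y) + q (- x)"
    using sublin_add[OF q add_mem[OF x smul_mem[OF y]] uminus_mem[OF x], of "of_real t"]
    by (simp add: algebra_simps)
  ultimately show "- q (- x) \<le> q (x + smul E (of_real t) y) - t * q y"
    by simp
qed

lemma lower_le:
  assumes "sublin q" "x \<in> vecs E" "y \<in> vecs E" "t \<ge> 0"
  shows "lower q y x \<le> q (x + smul E (of_real t) y) - t * q y"
  using cINF_lower[OF lower_bdd[OF assms(1-3)], of t] assms by (simp add: lower_def)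

lemma lower_greatest:
  assumes "x \<in> vecs E" "\<And>t. t \<ge> 0 \<Longrightarrow> c \<le> q (x + smul E (of_real t) y) - t * q y"
  shows "c \<le> lower q y x"
  using assms by (auto simp: lower_def intro!: cINF_greatest)

lemma lower_le_self: "sublin q \<Longrightarrow> y \<in> vecs E \<Longrightarrow> lower q y \<le> q"
proof (rule le_funI)
  fix x assume q: "sublin q" and y: "y \<in> vecs E"
  show "lower q y x \<le> q x"
  proof (cases "x \<in> vecs E")
    case True
    then show ?thesis using lower_le[OF q True y, of 0] by simp
  next
    case False
    then show ?thesis using q by (simp add: lower_def sublin_def)
  qed
qed

lemma sublin_lower:
  assumes q: "sublin q" and y: "y \<in> vecs E"
  shows "sublin (lower q y)"
  unfolding sublin_def
proof (intro conjI allI ballI impI)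
  fix x x' assume x: "x \<in> vecs E" and x': "x' \<in> vecs E"
  \<comment> \<open>The two infima on the right are treated one after the other; the parameters
    \<open>t\<close> and \<open>t'\<close> of the two summands add up to one for
    \<open>x + x'\<close>.\<close>
  have "lower q y (x + x') - lower q y x \<le> q (x' + smul E (of_real t') y) - t' * q y"
    if t': "t' \<ge> 0" for t'
  proof -
    have "lower q y (x + x') - (q (x' + smul E (of_real t') y) - t' * q y) \<le>
        q (x + smul E (of_real t) y) - t * q y" if t: "t \<ge> 0" for t
    proof -
      have "lower q y (x + x') \<le> q ((x + x') + smul E (of_real (t + t')) y) - (t + t') * q y"
        using lower_le[OF q add_mem[OF x x'] y, of "t + t'"] t t' by simp
      also have "(x + x') + smul E (of_real (t + t')) y =
          (x + smul E (of_real t) y) + (x' + smul E (of_real t') y)"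
        by (simp add: vs.scale_left_distrib algebra_simps)
      also have "q \<dots> \<le> q (x + smul E (of_real t) y) + q (x' + smul E (of_real t') y)"
        by (intro sublin_add q add_mem smul_mem x x' y)
      finally show ?thesis by (simp add: algebra_simps)
    qed
    from lower_greatest[OF x this] show ?thesis by simp
  qed
  from lower_greatest[OF x' this] show "lower q y (x + x') \<le> lower q y x + lower q y x'"
    by simp
next
  fix r :: real and x assume r: "r > 0" and x: "x \<in> vecs E"
  have "lower q y (smul E (of_real r) x) / r \<le> q (x + smul E (of_real t) y) - t * q y"
    if t: "t \<ge> 0" for t
  proof -
    have "lower q y (smul E (of_real r) x) \<le>
        q (smul E (of_real r) x + smul E (of_real (r * t)) y) - (r * t) * q y"
      using lower_le[OF q smul_mem[OF x] y, of "r * t"] r t by simp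
    also have "smul E (of_real r) x + smul E (of_real (r * t)) y =
        smul E (of_real r) (x + smul E (of_real t) y)"
      by (simp add: vs.scale_right_distrib)
    also have "q \<dots> = r * q (x + smul E (of_real t) y)"
      by (intro sublin_scale q add_mem x smul_mem y r)
    finally show ?thesis using r by (simp add: field_simps)
  qed
  from lower_greatest[OF x this] show "lower q y (smul E (of_real r) x) \<le> r * lower q y x"
    using r by (simp add: field_simps)
qed (simp add: lower_def)

text \<open>The infimum is finite because all members are at least \<open>- p (- x)\<close> at
  \<open>x\<close>. Subadditivity uses the chain: of two members, one for \<open>x\<close> and one
  for \<open>y\<close>, the smaller can serve for both.\<close>

lemma sublin_Inf_chain:
  assumes C: "C \<noteq> {}" "\<And>q. q \<in> C \<Longrightarrow> sublin q" "\<And>q. q \<in> C \<Longrightarrow> q \<le> p"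
    and chain: "\<And>q r. q \<in> C \<Longrightarrow> r \<in> C \<Longrightarrow> q \<le> r \<or> r \<le> q"
  shows "\<exists>u. sublin u \<and> (\<forall>q\<in>C. u \<le> q)"
proof -
  define u where "u x = (INF q\<in>C. q x)" for x
  have bdd: "bdd_below ((\<lambda>q. q x) ` C)" for x
  proof (rule bdd_belowI2)
    fix q assume q: "q \<in> C"
    show "(if x \<in> vecs E then - p (- x) else 0) \<le> q x"
      using sublin_minus[OF C(2)[OF q], of x] le_funD[OF C(3)[OF q], of "- x"] C(2)[OF q]
      by (auto simp: sublin_def)
  qed
  have le: "u x \<le> q x" if "q \<in> C" for q x
    unfolding u_def by (rule cINF_lower[OF bdd that])
  have ge: "c \<le> u x" if "\<And>q. q \<in> C \<Longrightarrow> c \<le> q x" for c x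
    unfolding u_def using C(1) that by (rule cINF_greatest)
  have "sublin u"
    unfolding sublin_def
  proof (intro conjI allI ballI impI)
    fix x assume "x \<notin> vecs E"
    then have "q x = 0" if "q \<in> C" for q using C(2)[OF that] by (simp add: sublin_def)
    then have "u x = (INF q\<in>C. 0)" unfolding u_def by (intro INF_cong) auto
    then show "u x = 0" using C(1) by simp
  next
    fix x y assume x: "x \<in> vecs E" and y: "y \<in> vecs E"
    have "u (x + y) - u x \<le> q y" if q: "q \<in> C" for q
    proof -
      have "u (x + y) - q y \<le> r x" if r: "r \<in> C" for r
      proof -
        have "u (x + y) \<le> r x + q y"
        proof (cases "q \<le> r")
          case True
          have "u (x + y) \<le> q x + q y"
            using le[OF q, of "x + y"] sublin_add[OF C(2)[OF q] x y] by simp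
          then show ?thesis using le_funD[OF True, of x] by simp
        next
          case False
          then have "r \<le> q" using chain[OF q r] by blast
          moreover have "u (x + y) \<le> r x + r y"
            using le[OF r, of "x + y"] sublin_add[OF C(2)[OF r] x y] by simp
          ultimately show ?thesis using le_funD[of r q y] by simp
        qed
        then show ?thesis by simp
      qed
      then have "u (x + y) - q y \<le> u x" by (rule ge)
      then show ?thesis by simp
    qed
    then have "u (x + y) - u x \<le> u y" by (rule ge)
    then show "u (x + y) \<le> u x + u y" by simp
  next
    fix r :: real and x assume r: "r > 0" and x: "x \<in> vecs E"
    have "u (smul E (of_real r) x) / r \<le> q x" if q: "q \<in> C" for q
      using le[OF q, of "smul E (of_real r) x"] sublin_scale[OF C(2)[OF q] x r] r
      by (simp add: field_simps)
    from ge[OF this] show "u (smul E (of_real r) x) \<le> r * u x"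
      using r by (simp add: field_simps)
  qed
  then show ?thesis using le by (auto simp: le_fun_def)
qed

lemma minimal_sublin_exists:
  assumes p: "sublin p"
  shows "\<exists>m. sublin m \<and> m \<le> p \<and> (\<forall>q. sublin q \<longrightarrow> q \<le> m \<longrightarrow> q = m)"
proof -
  define A where "A = {q. sublin q \<and> q \<le> p}"
  have "\<exists>m\<in>A. \<forall>a\<in>A. a \<le> m \<longrightarrow> a = m"
  proof (rule predicate_Zorn[where P = "\<lambda>q r. r \<le> q"])
    show "partial_order_on A (relation_of (\<lambda>q r. r \<le> q) A)"
      by (rule partial_order_on_relation_ofI) auto
    fix C assume C: "C \<in> Chains (relation_of (\<lambda>q r. r \<le> q) A)"
    show "\<exists>u\<in>A. \<forall>a\<in>C. u \<le> a"
    proof (cases "C = {}")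
      case True
      then show ?thesis using p by (auto simp: A_def)
    next
      case False
      have CA: "C \<subseteq> A" using C by (auto simp: Chains_def relation_of_def)
      have "\<exists>u. sublin u \<and> (\<forall>q\<in>C. u \<le> q)"
        using False CA C
        by (intro sublin_Inf_chain[of _ p]) (auto simp: A_def Chains_def relation_of_def)
      then obtain u where u: "sublin u" "\<forall>q\<in>C. u \<le> q" by blast
      then have "u \<le> p" using False CA unfolding A_def by (blast intro: order_trans)
      then show ?thesis using u by (auto simp: A_def)
    qed
  qed
  then show ?thesis unfolding A_def by (blast intro: order_trans)
qed

text \<open>By minimality \<open>lower m y\<close> equals \<open>m\<close>, and \<open>t = 1\<close>
  in its infimum gives the missing half of additivity.\<close>

lemma minimal_sublin_linear:
  assumes m: "sublin m" and min: "\<And>q. sublin q \<Longrightarrow> q \<le> m \<Longrightarrow> q = m"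
  shows "x \<in> vecs E \<Longrightarrow> y \<in> vecs E \<Longrightarrow> m (x + y) = m x + m y"
    and "x \<in> vecs E \<Longrightarrow> m (smul E (of_real r) x) = r * m x"
proof -
  have add: "m (x + y) = m x + m y" if x: "x \<in> vecs E" and y: "y \<in> vecs E" for x y
  proof (rule antisym)
    show "m (x + y) \<le> m x + m y" by (rule sublin_add[OF m x y])
    have "lower m y = m"
      by (intro min sublin_lower lower_le_self m y)
    then show "m x + m y \<le> m (x + y)"
      using lower_le[OF m x y, of 1] by simp
  qed
  then show "x \<in> vecs E \<Longrightarrow> y \<in> vecs E \<Longrightarrow> m (x + y) = m x + m y" .
  have neg: "m (- x) = - m x" if x: "x \<in> vecs E" for x
    using add[OF x uminus_mem[OF x]] sublin_zero[OF m] by simp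
  show "m (smul E (of_real r) x) = r * m x" if x: "x \<in> vecs E"
  proof -
    consider "r = 0" | "r > 0" | "r < 0" by linarith
    then show ?thesis
    proof cases
      case 3
      have "smul E (of_real r) x = - smul E (of_real (- r)) x" by simp
      then have "m (smul E (of_real r) x) = - m (smul E (of_real (- r)) x)"
        using neg[OF smul_mem[OF x]] by simp
      also have "\<dots> = r * m x" using sublin_scale[OF m x, of "- r"] 3 by simp
      finally show ?thesis .
    qed (use sublin_zero[OF m] sublin_scale[OF m x] in auto)
  qed
qed

text \<open>Instead of extending a functional from the line through \<open>x0\<close>, a minimal one
  is taken below \<open>lower N x0\<close>. That function is at most \<open>- nrm E x0\<close> at
  \<open>- x0\<close>, which forces equality at \<open>x0\<close>.\<close>

lemma real_norming_functional:
  assumes x0: "x0 \<in> vecs E"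
  shows "\<exists>u :: 'e \<Rightarrow> real. (\<forall>x\<in>vecs E. \<forall>y\<in>vecs E. u (x + y) = u x + u y) \<and>
    (\<forall>r. \<forall>x\<in>vecs E. u (smul E (of_real r) x) = r * u x) \<and>
    (\<forall>x\<in>vecs E. u x \<le> nrm E x) \<and> u x0 = nrm E x0"
proof -
  define N where "N x = (if x \<in> vecs E then nrm E x else 0)" for x
  have N: "sublin N"
    unfolding sublin_def N_def by (auto simp: add_mem smul_mem nrm_add nrm_smul)
  obtain u where u: "sublin u" "u \<le> lower N x0" "\<forall>q. sublin q \<longrightarrow> q \<le> u \<longrightarrow> q = u"
    using minimal_sublin_exists[OF sublin_lower[OF N x0]] by blast
  note lin = minimal_sublin_linear[OF u(1)] u(3)
  have le: "u \<le> N" using order_trans[OF u(2) lower_le_self[OF N x0]] .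
  have "u (- x0) \<le> lower N x0 (- x0)" using u(2) by (simp add: le_fun_def)
  also have "\<dots> \<le> - nrm E x0"
    using lower_le[OF N uminus_mem[OF x0] x0, of 1] by (simp add: N_def x0 zero_mem)
  finally have "u (- x0) \<le> - nrm E x0" .
  moreover have "u (- x0) = - u x0"
    using lin(2)[of x0 "- 1"] lin(3) x0 by simp
  ultimately have "u x0 = nrm E x0"
    using le_funD[OF le, of x0] x0 by (simp add: N_def)
  moreover have "u x \<le> nrm E x" if "x \<in> vecs E" for x
    using le_funD[OF le, of x] that by (simp add: N_def)
  ultimately show ?thesis
    using lin by (intro exI[of _ u]) blast
qed

lemma unimodular_rotation: "\<exists>c :: 'k. norm c = 1 \<and> c * z = of_real (norm z)"
proof (cases "z = 0")
  case False
  then show ?thesis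
    by (intro exI[of _ "of_real (norm z) / z"]) (simp add: norm_divide)
qed (auto intro: exI[of _ 1])

theorem norming_functional:
  assumes x0: "x0 \<in> vecs E"
  shows "\<exists>f. f \<in> nball (dual E) \<and> norm (f x0) = nrm E x0"
proof -
  obtain u :: "'e \<Rightarrow> real" where
    add: "\<And>x y. x \<in> vecs E \<Longrightarrow> y \<in> vecs E \<Longrightarrow> u (x + y) = u x + u y" and
    scale: "\<And>r x. x \<in> vecs E \<Longrightarrow> u (smul E (of_real r) x) = r * u x" and
    le: "\<And>x. x \<in> vecs E \<Longrightarrow> u x \<le> nrm E x" and x0': "u x0 = nrm E x0"
    using real_norming_functional[OF x0] by metis
  have minus: "u (- x) = - u x" if "x \<in> vecs E" for x
    using scale[OF that, of "- 1"] by simp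
  have abs_le: "\<bar>u x\<bar> \<le> nrm E x" if "x \<in> vecs E" for x
    using le[OF that] le[OF uminus_mem[OF that]] minus[OF that] nrm_minus[OF that] by simp
  have pick: ?thesis if f: "\<And>x. x \<in> vecs E \<Longrightarrow> f x = h x" "\<And>x. x \<notin> vecs E \<Longrightarrow> f x = 0"
    and h: "\<And>x y. x \<in> vecs E \<Longrightarrow> y \<in> vecs E \<Longrightarrow> h (x + y) = h x + h y"
      "\<And>c x. x \<in> vecs E \<Longrightarrow> h (smul E c x) = c * h x" "\<And>x. x \<in> vecs E \<Longrightarrow> norm (h x) \<le> nrm E x"
      "nrm E x0 \<le> norm (h x0)" for f h :: "'e \<Rightarrow> 'k"
  proof (intro exI conjI)
    show "f \<in> nball (dual E)"
      unfolding dual_ball_iff using f h(1-3) add_mem smul_mem by simp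
    show "norm (f x0) = nrm E x0"
      using f(1)[OF x0] h(3)[OF x0] h(4) by simp
  qed
  consider "\<forall>x::'k. \<exists>a. x = a *\<^sub>R 1"
    | (im) i :: 'k where "i * i = - 1" "\<forall>x. \<exists>a b. x = a *\<^sub>R 1 + b *\<^sub>R i"
    using real_or_complex by metis
  then show ?thesis
  proof cases
    case 1
    show ?thesis
    proof (rule pick[of "\<lambda>x. if x \<in> vecs E then of_real (u x) else 0" "\<lambda>x. of_real (u x)"])
      fix c :: 'k and x assume x: "x \<in> vecs E"
      obtain a where "c = a *\<^sub>R 1" using 1 by blast
      then have "c = of_real a" by (simp add: of_real_def)
      then show "(of_real (u (smul E c x)) :: 'k) = c * of_real (u x)"
        using scale[OF x] by simp
    qed (use add abs_le x0' in auto)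
  next
    case im
    \<comment> \<open>The scalar functional with real part \<open>u\<close>, as over the complex
      numbers.\<close>
    define h where "h x = of_real (u x) - of_real (u (smul E i x)) * i" for x
    have h_add: "h (x + y) = h x + h y" if "x \<in> vecs E" "y \<in> vecs E" for x y
      using that by (simp add: h_def add smul_mem vs.scale_right_distrib algebra_simps)
    have h_real: "h (smul E (of_real r) x) = of_real r * h x" if "x \<in> vecs E" for r x
    proof -
      have "smul E i (smul E (of_real r) x) = smul E (of_real r) (smul E i x)"
        by (simp add: mult.commute)
      then have "u (smul E i (smul E (of_real r) x)) = r * u (smul E i x)"
        by (simp only: scale smul_mem that)
      then show ?thesis
        by (simp only: h_def scale that) (simp add: algebra_simps)
    qed
    have h_i: "h (smul E i x) = i * h x" if x: "x \<in> vecs E" for x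
    proof -
      have "smul E i (smul E i x) = - x" by (simp add: im(1))
      then have "h (smul E i x) = of_real (u (smul E i x)) + of_real (u x) * i"
        using minus[OF x] by (simp add: h_def)
      also have "\<dots> = i * of_real (u x) - of_real (u (smul E i x)) * (i * i)"
        by (simp add: im(1))
      finally show ?thesis by (simp add: h_def algebra_simps)
    qed
    have h_smul: "h (smul E c x) = c * h x" if x: "x \<in> vecs E" for c x
    proof -
      obtain a b where "c = a *\<^sub>R 1 + b *\<^sub>R i" using im(2) by blast
      then have c: "c = of_real a + of_real b * i" by (simp add: scaleR_conv_of_real)
      have "smul E c x = smul E (of_real a) x + smul E (of_real b) (smul E i x)"
        by (simp add: c vs.scale_left_distrib)
      then have "h (smul E c x) = of_real a * h x + of_real b * (i * h x)"
        by (simp only: h_add h_real h_i smul_mem x)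
      then show ?thesis by (simp add: c algebra_simps)
    qed
    have u_le: "\<bar>u x\<bar> \<le> norm (h x)" for x
      using abs_le_norm_real_plus_imaginary[OF im(1), of "u x" "- u (smul E i x)"] by (simp add: h_def)
    have u_real: "u x = r" if "h x = of_real r" for x r
    proof -
      have "of_real (u x - r) + of_real (- u (smul E i x)) * i = 0"
        using that by (simp add: h_def algebra_simps)
      then show ?thesis
        using abs_le_norm_real_plus_imaginary[OF im(1), of "u x - r" "- u (smul E i x)"] by simp
    qed
    show ?thesis
    proof (rule pick[of "\<lambda>x. if x \<in> vecs E then h x else 0" h])
      fix x assume x: "x \<in> vecs E"
      \<comment> \<open>Once \<open>h x\<close> is rotated to a nonnegative real, \<open>h\<close>
        agrees with \<open>u\<close> there, so the bound for \<open>u\<close> carries over without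
        loss.\<close>
      obtain c :: 'k where c: "norm c = 1" "c * h x = of_real (norm (h x))"
        using unimodular_rotation by blast
      then have "u (smul E c x) = norm (h x)"
        by (intro u_real) (simp add: h_smul[OF x])
      then show "norm (h x) \<le> nrm E x"
        using le[OF smul_mem[OF x], of c] nrm_smul[OF x, of c] c(1) by simp
    qed (use h_add h_smul u_le[of x0] x0' in auto)
  qed
qed

end

section \<open>Iterated weak limits\<close>

context normed_nspace
begin

text \<open>The trace on \<open>A\<close> of the filter of weak neighbourhoods of 0. On the sphere
  it can be the trivial filter, for which everything holds eventually.\<close>

definition weak0 :: "'e set \<Rightarrow> 'e filter" where
  "weak0 A = inf (INF p\<in>vecs (dual E) \<times> {0<..}. principal {x. norm (fst p x) < snd p}) (principal A)"

lemma eventually_weak0: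
  "eventually P (weak0 A) \<longleftrightarrow> (\<exists>\<Phi> e. finite \<Phi> \<and> \<Phi> \<subseteq> vecs (dual E) \<and> 0 < e \<and>
    (\<forall>x\<in>A. (\<forall>f\<in>\<Phi>. norm (f x) < e) \<longrightarrow> P x))"
proof
  let ?G = "\<lambda>p. principal {x. norm (fst p x :: 'k) < snd p}"
  assume "eventually P (weak0 A)"
  then have "eventually (\<lambda>x. x \<in> A \<longrightarrow> P x) (INF p\<in>vecs (dual E) \<times> {0<..}. ?G p)"
    unfolding weak0_def eventually_inf_principal .
  from this[THEN eventually_INF[THEN iffD1]]
  obtain X where X: "X \<subseteq> vecs (dual E) \<times> {0<..}" "finite X"
    "eventually (\<lambda>x. x \<in> A \<longrightarrow> P x) (INF p\<in>X. ?G p)"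
    by blast
  have "(INF p\<in>X. ?G p) = principal (\<Inter>p\<in>X. {x. norm (fst p x) < snd p})"
    by (rule INF_principal_finite[OF X(2)])
  then have P: "x \<in> A \<Longrightarrow> (\<forall>p\<in>X. norm (fst p x) < snd p) \<Longrightarrow> P x" for x
    using X(3) by (simp add: eventually_principal)
  \<comment> \<open>The finitely many radii are replaced by their minimum; the 1 covers an empty
    family.\<close>
  define e where "e = Min (insert 1 (snd ` X))"
  have e: "0 < e" using X(1,2) by (auto simp: e_def)
  have e_le: "e \<le> snd p" if "p \<in> X" for p using that X(2) by (simp add: e_def)
  have le: "P x" if "x \<in> A" "\<forall>f\<in>fst ` X. norm (f x) < e" for x
    using that e_le by (intro P) force+
  show "\<exists>\<Phi> e. finite \<Phi> \<and> \<Phi> \<subseteq> vecs (dual E) \<and> 0 < e \<and>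
      (\<forall>x\<in>A. (\<forall>f\<in>\<Phi>. norm (f x) < e) \<longrightarrow> P x)"
    using X(1,2) e le by (intro exI[of _ "fst ` X"] exI[of _ e] conjI) auto
next
  assume "\<exists>\<Phi> e. finite \<Phi> \<and> \<Phi> \<subseteq> vecs (dual E) \<and> 0 < e \<and>
    (\<forall>x\<in>A. (\<forall>f\<in>\<Phi>. norm (f x) < e) \<longrightarrow> P x)"
  then obtain \<Phi> e where \<Phi>: "finite \<Phi>" "\<Phi> \<subseteq> vecs (dual E)" "0 < e"
    "\<forall>x\<in>A. (\<forall>f\<in>\<Phi>. norm (f x) < e) \<longrightarrow> P x" by blast
  have "eventually (\<lambda>x. norm (f x) < e) (weak0 A)" if "f \<in> \<Phi>" for f
  proof -
    have "weak0 A \<le> (INF p\<in>vecs (dual E) \<times> {0<..}. principal {x. norm (fst p x) < snd p})"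
      unfolding weak0_def by simp
    also have "\<dots> \<le> principal {x. norm (f x) < e}"
      using \<Phi>(2,3) that by (intro INF_lower2[of "(f, e)"]) auto
    finally show ?thesis by (simp add: le_principal)
  qed
  then have "eventually (\<lambda>x. \<forall>f\<in>\<Phi>. norm (f x) < e) (weak0 A)"
    using \<Phi>(1) by (simp add: eventually_ball_finite)
  moreover have "eventually (\<lambda>x. x \<in> A) (weak0 A)"
    by (simp add: weak0_def eventually_inf_principal)
  ultimately show "eventually P (weak0 A)"
    by eventually_elim (use \<Phi>(4) in blast)
qed

lemma eventually_weak0_mem: "eventually (\<lambda>x. x \<in> A) (weak0 A)"
  by (simp add: weak0_def eventually_inf_principal)

lemma eventually_weak0_less: "f \<in> vecs (dual E) \<Longrightarrow> 0 < e \<Longrightarrow> eventually (\<lambda>x. norm (f x) < e) (weak0 A)"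
  unfolding eventually_weak0 by (intro exI[of _ "{f}"] exI[of _ e]) auto

lemma tendsto_weak0: "f \<in> vecs (dual E) \<Longrightarrow> (f \<longlongrightarrow> 0) (weak0 A)"
  by (rule tendstoI) (simp add: eventually_weak0_less)

end

text \<open>The neighbourhood for each vector may depend on all earlier vectors, as in a tree. If
  \<open>nested\<close> fails for a property, then in every choice of neighbourhoods one finds
  vectors violating it, which amounts to a tree with all branches violating it.\<close>

fun nested :: "'e filter \<Rightarrow> nat \<Rightarrow> ('e list \<Rightarrow> bool) \<Rightarrow> bool" where
  "nested F 0 Q \<longleftrightarrow> Q []"
| "nested F (Suc n) Q \<longleftrightarrow> eventually (\<lambda>y. nested F n (\<lambda>l. Q (y # l))) F"

lemma nested_mono: "nested F n P \<Longrightarrow> (\<And>l. P l \<Longrightarrow> Q l) \<Longrightarrow> nested F n Q"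
proof (induction n arbitrary: P Q)
  case (Suc n)
  have "nested F n (\<lambda>l. P (y # l)) \<Longrightarrow> nested F n (\<lambda>l. Q (y # l))" for y
    by (rule Suc.IH[of "\<lambda>l. P (y # l)"]) (use Suc.prems in auto)
  then show ?case using Suc.prems(1) by (auto elim: eventually_mono)
qed simp

lemma nested_True: "nested F n (\<lambda>l. True)"
  by (induction n) auto

lemma nested_conj: "nested F n P \<Longrightarrow> nested F n Q \<Longrightarrow> nested F n (\<lambda>l. P l \<and> Q l)"
proof (induction n arbitrary: P Q)
  case (Suc n)
  from Suc.prems show ?case
    unfolding nested.simps
    by eventually_elim (rule Suc.IH[of "\<lambda>l. P (_ # l)" "\<lambda>l. Q (_ # l)"])
qed simp

text \<open>The iterated product of \<open>F\<close> with itself. Having it as a filter allows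
  cluster points of functions of a whole branch.\<close>

definition nested_filter :: "'e filter \<Rightarrow> nat \<Rightarrow> 'e list filter" where
  "nested_filter F n = Abs_filter (nested F n)"

lemma eventually_nested_filter: "eventually Q (nested_filter F n) \<longleftrightarrow> nested F n Q"
  unfolding nested_filter_def
proof (rule eventually_Abs_filter, rule is_filter.intro)
  show "nested F n P \<Longrightarrow> nested F n Q" if "\<forall>l. P l \<longrightarrow> Q l" for P Q
    using that by (meson nested_mono)
qed (rule nested_True, rule nested_conj)

lemma nested_lists:
  "eventually (\<lambda>x. x \<in> A) F \<Longrightarrow> nested F n (\<lambda>l. length l = n \<and> set l \<subseteq> A)"
proof (induction n)
  case (Suc n)
  show ?case
    unfolding nested.simps using Suc.prems
    by eventually_elim (rule nested_mono[OF Suc.IH[OF Suc.prems]], auto)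
qed simp

context normed_nspace
begin

text \<open>The vector \<open>x\<close> is the sum of the part of the branch already chosen; keeping
  it variable makes induction on \<open>n\<close> possible.\<close>

definition good :: "real \<Rightarrow> nat \<Rightarrow> 'e \<Rightarrow> bool" where
  "good C n x \<longleftrightarrow> nested (weak0 (nball E)) n (\<lambda>l. nrm E (x + sum_list l) \<le> C)"

lemma good_0: "good C 0 x \<longleftrightarrow> nrm E x \<le> C"
  by (simp add: good_def)

lemma good_Suc: "good C (Suc n) x \<longleftrightarrow> eventually (\<lambda>y. good C n (x + y)) (weak0 (nball E))"
  by (simp add: good_def add.assoc)

text \<open>The nested filters express that every weakly null tree in the unit ball has a branch whose sum has
  norm at most \<open>C\<close>.\<close>

definition bounded_branches :: bool where
  "bounded_branches \<longleftrightarrow> (\<exists>C. \<forall>n. good C n 0)"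

end

locale isometric_embedding = E: normed_nspace E + F: normed_nspace F
  for E :: "('k::real_or_complex, 'e::ab_group_add) nspace" and F :: "('k, 'f::ab_group_add) nspace" +
  fixes J :: "'e \<Rightarrow> 'f"
  assumes J_mem: "x \<in> vecs E \<Longrightarrow> J x \<in> vecs F"
    and J_add: "x \<in> vecs E \<Longrightarrow> y \<in> vecs E \<Longrightarrow> J (x + y) = J x + J y"
    and J_smul: "x \<in> vecs E \<Longrightarrow> J (smul E c x) = smul F c (J x)"
    and nrm_J: "x \<in> vecs E \<Longrightarrow> nrm F (J x) = nrm E x"
begin

definition pullback :: "('f \<Rightarrow> 'k) \<Rightarrow> 'e \<Rightarrow> 'k" where
  "pullback f x = (if x \<in> vecs E then f (J x) else 0)"

lemma pullback_mem:
  assumes f: "f \<in> vecs (dual F)"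
  shows "pullback f \<in> vecs (dual E)"
proof -
  have "norm (pullback f x) \<le> nrm (dual F) f * nrm E x" if "x \<in> vecs E" for x
    using F.dual_le[OF f J_mem[OF that]] nrm_J[OF that] that by (simp add: pullback_def)
  then show ?thesis
    unfolding E.dual_iff
    by (intro conjI) (auto simp: pullback_def J_mem J_add J_smul E.add_mem E.smul_mem
      F.dual_add[OF f] F.dual_smul[OF f])
qed

text \<open>The finitely many functionals that describe a weak neighbourhood in \<open>F\<close>
  pull back to ones describing a neighbourhood in \<open>E\<close> which \<open>J\<close> maps into
  it.\<close>

lemma good_embedding:
  "x \<in> vecs E \<Longrightarrow> F.good C n (J x) \<Longrightarrow> E.good C n x"
proof (induction n arbitrary: x)
  case 0
  then show ?case by (simp add: E.good_0 F.good_0 nrm_J)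
next
  case (Suc n)
  obtain \<Phi> e where \<Phi>: "finite \<Phi>" "\<Phi> \<subseteq> vecs (dual F)" "0 < e"
    "\<forall>y\<in>nball F. (\<forall>f\<in>\<Phi>. norm (f y) < e) \<longrightarrow> F.good C n (J x + y)"
    using Suc.prems(2) unfolding F.good_Suc F.eventually_weak0 by blast
  show ?case
    unfolding E.good_Suc E.eventually_weak0
  proof (intro exI[of _ "pullback ` \<Phi>"] exI[of _ e] conjI ballI impI)
    fix y assume y: "y \<in> nball E" "\<forall>f\<in>pullback ` \<Phi>. norm (f y) < e"
    then have "J y \<in> nball F" using J_mem nrm_J by (auto simp: nball_def)
    moreover have "\<forall>f\<in>\<Phi>. norm (f (J y)) < e" using y E.nballD[OF y(1)] by (auto simp: pullback_def)
    ultimately have "F.good C n (J (x + y))" using \<Phi>(4) J_add Suc.prems(1) E.nballD[OF y(1)] by simp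
    then show "E.good C n (x + y)"
      using Suc.IH E.add_mem Suc.prems(1) E.nballD[OF y(1)] by blast
  qed (use \<Phi> pullback_mem in auto)
qed

lemma bounded_branches_embedding: "F.bounded_branches \<Longrightarrow> E.bounded_branches"
proof -
  have "J 0 = 0" using J_add[of 0 0] E.zero_mem by simp
  then show "F.bounded_branches \<Longrightarrow> E.bounded_branches"
    using good_embedding[OF E.zero_mem]
    unfolding E.bounded_branches_def F.bounded_branches_def by auto
qed

end

section \<open>The Szlenk derivation\<close>

lemma inf_principal_not_bot: "inf F (principal A) \<noteq> bot \<longleftrightarrow> frequently (\<lambda>x. x \<in> A) F"
  using eventually_False[of "inf F (principal A)"] by (simp add: eventually_inf_principal frequently_def)

lemma tendsto_coordinate:
  fixes f :: "'i \<Rightarrow> 'c::topological_space"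
  assumes "(h \<longlongrightarrow> f) W"
  shows "((\<lambda>y. h y a) \<longlongrightarrow> f a) W"
proof (rule topological_tendstoI)
  fix B assume B: "open B" "f a \<in> B"
  have "open ((\<lambda>g :: 'i \<Rightarrow> 'c. g a) -` B)"
    by (rule open_vimage[OF B(1) continuous_on_product_coordinates])
  from topological_tendstoD[OF assms this] show "eventually (\<lambda>y. h y a \<in> B) W"
    using B(2) by simp
qed

text \<open>Used to make discrete data that depend on a vector, such as lists of rounded distances,
  constant along a finer filter.\<close>

lemma filter_pigeonhole:
  assumes "F \<noteq> bot" "finite A" "eventually (\<lambda>y. v y \<in> A) F"
  obtains a where "a \<in> A" "inf F (principal {y. v y = a}) \<noteq> bot"
proof -
  have "\<exists>a\<in>A. frequently (\<lambda>y. v y = a) F"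
  proof (rule ccontr)
    assume "\<not> ?thesis"
    then have "\<forall>a\<in>A. eventually (\<lambda>y. v y \<noteq> a) F" by (simp add: frequently_def)
    then have "eventually (\<lambda>y. \<forall>a\<in>A. v y \<noteq> a) F"
      using assms(2) by (simp add: eventually_ball_finite)
    with assms(3) have "eventually (\<lambda>y. False) F" by eventually_elim blast
    then show False using assms(1) by simp
  qed
  then show thesis using that by (auto simp: inf_principal_not_bot)
qed

text \<open>Rounding has to end strictly below \<open>r\<close>, because a Szlenk derivation asks
  for diameters strictly above its parameter. The exception \<open>s = 0\<close> is harmless, since
  the derivation with parameter 0 changes nothing.\<close>

lemma finite_rounding:
  assumes "(0::real) < d"
  obtains S where "finite S" "\<And>r. 0 \<le> r \<Longrightarrow> r \<le> B \<Longrightarrow> \<exists>s\<in>S. (s = 0 \<or> s < r) \<and> r \<le> s + d"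
proof
  let ?S = "(\<lambda>k. real k * d) ` {..nat \<lceil>B / d\<rceil>}"
  show "finite ?S" by simp
  fix r assume r: "0 \<le> r" "r \<le> B"
  show "\<exists>s\<in>?S. (s = 0 \<or> s < r) \<and> r \<le> s + d"
  proof (cases "r = 0")
    case True
    then show ?thesis using assms by (auto intro!: bexI[of _ 0] image_eqI[of _ _ 0])
  next
    case False
    \<comment> \<open>Ceiling minus one and not the floor, which would return \<open>r\<close>
      itself at a grid point.\<close>
    define k where "k = nat (\<lceil>r / d\<rceil> - 1)"
    have pos: "0 < r / d" using False r assms by simp
    then have k: "real k = of_int \<lceil>r / d\<rceil> - 1" by (simp add: k_def)
    then have "real k < r / d" "r / d \<le> real k + 1" by linarith+
    then have "real k * d < r" "r \<le> real k * d + d"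
      using assms by (simp_all add: field_simps)
    moreover have "k \<le> nat \<lceil>B / d\<rceil>"
      using ceiling_mono[of "r / d" "B / d"] r(2) assms by (simp add: k_def divide_right_mono nat_mono)
    ultimately show ?thesis by (intro bexI[of _ "real k * d"]) auto
  qed
qed

context normed_nspace
begin

interpretation dual: normed_nspace "dual E"
  by (rule normed_nspace_dual)

text \<open>Distances inside the dual ball are at most 2, so the supremum in
  \<open>ndiameter\<close> is a genuine one; \<open>0 < e\<close> takes care of the value 0 given to
  the empty set.\<close>

lemma less_ndiameter:
  assumes A: "A \<subseteq> nball (dual E)" and e: "0 < e"
  shows "e < ndiameter (dual E) A \<longleftrightarrow> (\<exists>g\<in>A. \<exists>h\<in>A. e < nrm (dual E) (g - h))"
proof (cases "A = {}")
  case False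
  have "nrm (dual E) (g - h) \<le> 2" if "g \<in> A" "h \<in> A" for g h
    using dual.nrm_diff[of g h] A that dual.nballD[of g] dual.nballD[of h] by fastforce
  then have "bdd_above ((\<lambda>p. nrm (dual E) (fst p - snd p)) ` (A \<times> A))"
    by (auto intro!: bdd_aboveI2)
  then show ?thesis
    using False unfolding ndiameter_def case_prod_beta
    by (simp add: less_cSUP_iff)
qed (use e in \<open>simp add: ndiameter_def\<close>)

text \<open>Since \<open>K\<close> lies in the dual, weak-star open sets and open sets of the
  function type have the same traces on it.\<close>

lemma szlenk_derivation_iff:
  assumes K: "K \<subseteq> nball (dual E)" and e: "0 < e"
  shows "f \<in> szlenk_derivation E e K \<longleftrightarrow> f \<in> K \<and>
    (\<forall>V. open V \<and> f \<in> V \<longrightarrow> (\<exists>g\<in>V \<inter> K. \<exists>h\<in>V \<inter> K. e < nrm (dual E) (g - h)))"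
proof -
  have *: "(vecs (dual E) \<inter> V) \<inter> K = V \<inter> K" for V
    using K dual.nballD(1) by blast
  have "(\<forall>V. openin (weak_star E) V \<and> f \<in> V \<longrightarrow> e < ndiameter (dual E) (V \<inter> K)) \<longleftrightarrow>
    (\<forall>V. open V \<and> f \<in> V \<longrightarrow> e < ndiameter (dual E) (V \<inter> K))" if "f \<in> K"
  proof -
    have "f \<in> vecs (dual E)" using that K dual.nballD(1) by blast
    moreover have "V \<inter> K = (vecs (dual E) \<inter> T) \<inter> K \<Longrightarrow> V \<inter> K = T \<inter> K" for V T
      by (simp only: *)
    ultimately show ?thesis
      unfolding weak_star_def openin_open by (metis * Int_iff)
  qed
  moreover have "V \<inter> K \<subseteq> nball (dual E)" for V using K by blast
  ultimately show ?thesis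
    using e by (auto simp: szlenk_derivation_def less_ndiameter)
qed

lemma szlenk_derivation_subset: "szlenk_derivation E e K \<subseteq> K"
  by (auto simp: szlenk_derivation_def)

lemma closed_szlenk_derivation:
  assumes K: "K \<subseteq> nball (dual E)" and "closed K"
  shows "closed (szlenk_derivation E e K)"
proof (cases "0 < e")
  case True
  define U where "U = \<Union>{V. open V \<and> (\<forall>g\<in>V \<inter> K. \<forall>h\<in>V \<inter> K. nrm (dual E) (g - h) \<le> e)}"
  have "szlenk_derivation E e K = K - U"
    unfolding set_eq_iff szlenk_derivation_iff[OF K True] U_def by (auto simp: not_le)
  moreover have "open U" unfolding U_def by (rule open_Union) blast
  ultimately show ?thesis using \<open>closed K\<close> by (simp add: closed_Diff)
qed (use assms in \<open>simp add: szlenk_derivation_def\<close>)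

lemma foldr_szlenk_subset:
  "foldr (szlenk_derivation E) es (nball (dual E)) \<subseteq> nball (dual E)"
  by (induction es) (use szlenk_derivation_subset in auto)

lemma closed_foldr_szlenk:
  "closed (foldr (szlenk_derivation E) es (nball (dual E)))"
  by (induction es)
    (simp_all add: closed_dual_ball closed_szlenk_derivation foldr_szlenk_subset)

text \<open>In every neighbourhood of \<open>f\<close>, the point \<open>f\<close> itself and some
  \<open>h y\<close> are at distance above \<open>s\<close>. The case \<open>s \<le> 0\<close> is
  there for distances that were rounded to 0.\<close>

lemma szlenk_derivation_limit:
  assumes K: "K \<subseteq> nball (dual E)" "closed K" and W: "W \<noteq> bot" "eventually (\<lambda>y. h y \<in> K) W"
    "(h \<longlongrightarrow> f) W" and s: "s \<le> 0 \<or> eventually (\<lambda>y. s < nrm (dual E) (h y - f)) W"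
  shows "f \<in> szlenk_derivation E s K"
proof -
  have f: "f \<in> K" by (rule Lim_in_closed_set[OF K(2) W(2,1,3)])
  show ?thesis
  proof (cases "s \<le> 0")
    case False
    have "\<exists>g\<in>V \<inter> K. \<exists>h\<in>V \<inter> K. s < nrm (dual E) (g - h)" if V: "open V" "f \<in> V" for V
    proof -
      have "eventually (\<lambda>y. h y \<in> V) W" using W(3) V by (rule topological_tendstoD)
      moreover have "eventually (\<lambda>y. s < nrm (dual E) (h y - f)) W" using s False by simp
      ultimately have "eventually (\<lambda>y. h y \<in> V \<inter> K \<and> s < nrm (dual E) (h y - f)) W"
        using W(2) by eventually_elim simp
      then obtain y where "h y \<in> V \<inter> K" "s < nrm (dual E) (h y - f)"
        using W(1) eventually_happens by blast
      then show ?thesis using f V(2) by blast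
    qed
    then show ?thesis using f False by (simp add: szlenk_derivation_iff[OF K(1)])
  qed (use f in \<open>simp add: szlenk_derivation_def\<close>)
qed

text \<open>Near \<open>f\<close> there are functionals in \<open>K\<close> at distance above
  \<open>e / 2\<close> from it, with witnesses in the ball, but these witnesses need not be weakly
  small. They cluster as functions on the dual, so half the difference of two of them is weakly
  small. If the second functional is close to \<open>f\<close> at the first witness, the value
  \<open>e / 2\<close> is merely halved, up to a small error.\<close>

lemma szlenk_derivation_pick:
  assumes K: "K \<subseteq> nball (dual E)" and e: "0 < e" and f: "f \<in> szlenk_derivation E e K"
    and \<Phi>: "finite \<Phi>" "\<Phi> \<subseteq> vecs (dual E)" and A: "finite A" and \<eta>: "0 < \<eta>"
  obtains g y where "g \<in> K" "y \<in> nball E" "\<forall>\<phi>\<in>\<Phi>. norm (\<phi> y) < \<eta>" "\<forall>a\<in>A. norm (g a - f a) < \<eta>"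
    "norm (g y - f y - of_real (e / 4)) < \<eta>"
proof -
  \<comment> \<open>Of two points more than \<open>e\<close> apart, one is more than
    \<open>e / 2\<close> away from \<open>f\<close>.\<close>
  define G where "G = {g \<in> K. e / 2 < nrm (dual E) (g - f)}"
  define N where "N = inf (nhds f) (principal G)"
  have fK: "f \<in> K" using f szlenk_derivation_subset by blast
  have dualK: "g \<in> vecs (dual E)" if "g \<in> K" for g using that K dual.nballD(1) by blast
  have "\<exists>g\<in>V. g \<in> G" if "open V" "f \<in> V" for V
  proof -
    have "\<exists>g\<in>V \<inter> K. \<exists>h\<in>V \<inter> K. e < nrm (dual E) (g - h)"
      using szlenk_derivation_iff[OF K e, THEN iffD1, OF f] that by metis
    then obtain g h where gh: "g \<in> V \<inter> K" "h \<in> V \<inter> K" "e < nrm (dual E) (g - h)"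
      by (elim bexE)
    have "nrm (dual E) (g - h) \<le> nrm (dual E) (g - f) + nrm (dual E) (h - f)"
      using dual.nrm_diff[of "g - f" "h - f"] gh dualK fK dual.diff_mem by force
    then have "e / 2 < nrm (dual E) (g - f) \<or> e / 2 < nrm (dual E) (h - f)" using gh(3) by linarith
    then show ?thesis using gh by (auto simp: G_def)
  qed
  then have N: "N \<noteq> bot"
    unfolding N_def inf_principal_not_bot frequently_def eventually_nhds by blast
  have "\<exists>y. y \<in> nball E \<and> g y - f y = of_real (e / 2)" if g: "g \<in> G" for g
  proof -
    have gf: "g - f \<in> vecs (dual E)" by (rule dual.diff_mem) (use g dualK fK in \<open>auto simp: G_def\<close>)
    obtain x where x: "x \<in> nball E" "e / 2 < norm ((g - f) x)"
      using less_nrm_dual[OF gf, of "e / 2"] g by (auto simp: G_def)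
    \<comment> \<open>Scaling turns a lower bound for the modulus into the exact value
      \<open>e / 2\<close>, so that the values collected at different levels add up without
      cancellation.\<close>
    define c where "c = of_real (e / 2) / (g - f) x"
    have "norm c = \<bar>e / 2\<bar> / norm ((g - f) x)"
      by (simp only: c_def norm_divide norm_of_real)
    then have "norm c \<le> 1" using x(2) e by (simp only: divide_le_eq_1) linarith
    then have "smul E c x \<in> nball E"
      using nballD[OF x(1)] nrm_nonneg[of x]
      by (simp add: nball_def smul_mem nrm_smul mult_le_one)
    moreover have "(g - f) (smul E c x) = of_real (e / 2)"
    proof -
      have "(g - f) x \<noteq> 0" using x(2) e by auto
      then have "c * (g - f) x = of_real (e / 2)" unfolding c_def by (rule nonzero_eq_divide_eq[THEN iffD1, OF _ refl])
      then show ?thesis using dual_smul[OF gf nballD(1)[OF x(1)], of c] by simp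
    qed
    ultimately show ?thesis by auto
  qed
  then obtain Y where Y: "\<And>g. g \<in> G \<Longrightarrow> Y g \<in> nball E" "\<And>g. g \<in> G \<Longrightarrow> g (Y g) - f (Y g) = of_real (e / 2)"
    by metis
  \<comment> \<open>The witness \<open>Y g\<close> as a function on the dual, where Tychonoff's
    theorem supplies a cluster point.\<close>
  define H :: "('e \<Rightarrow> 'k) \<Rightarrow> ('e \<Rightarrow> 'k) \<Rightarrow> 'k"
    where "H g \<phi> = (if \<phi> \<in> vecs (dual E) then \<phi> (Y g) else 0)" for g \<phi>
  have evG: "eventually (\<lambda>g. g \<in> G) N" by (simp add: N_def eventually_inf_principal)
  then have "eventually (\<lambda>g. H g \<in> {h. \<forall>\<phi>. h \<phi> \<in> cball 0 (if \<phi> \<in> vecs (dual E) then nrm (dual E) \<phi> else 0)}) N"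
    by eventually_elim (simp add: H_def nrm_dual_upper Y(1))
  from compact_filter_cluster[OF compact_pointwise_bounded[OF compact_cball_scalar] N this]
  obtain c where c: "inf N (filtercomap H (nhds c)) \<noteq> bot" .
  define N' where "N' = inf N (filtercomap H (nhds c))"
  have N': "N' \<noteq> bot" using c by (simp add: N'_def)
  have "N' \<le> nhds f" unfolding N'_def N_def by (simp add: le_infI1)
  have lim: "((\<lambda>g. g a) \<longlongrightarrow> f a) N'" for a
    by (rule tendsto_coordinate[OF filterlim_mono[OF filterlim_ident order_refl \<open>N' \<le> nhds f\<close>]])
  have "(H \<longlongrightarrow> c) N'"
    unfolding N'_def by (rule filterlim_mono[OF filterlim_filtercomap order_refl]) simp
  then have limH: "((\<lambda>g. H g \<phi>) \<longlongrightarrow> c \<phi>) N'" for \<phi>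
    by (rule tendsto_coordinate)
  have ev1: "eventually (\<lambda>g. g \<in> G \<and> (\<forall>\<phi>\<in>\<Phi>. dist (H g \<phi>) (c \<phi>) < \<eta>)) N'"
    using filter_leD[OF _ evG, of N'] \<Phi>(1) tendstoD[OF limH \<eta>]
    by (auto simp: N'_def intro!: eventually_conj eventually_ball_finite)
  then obtain g1 where g1: "g1 \<in> G" "\<forall>\<phi>\<in>\<Phi>. dist (H g1 \<phi>) (c \<phi>) < \<eta>"
    using N' eventually_happens by blast
  \<comment> \<open>The order matters: \<open>g1\<close> is already fixed, so closeness to
    \<open>f\<close> at its witness can be imposed on \<open>g2\<close>.\<close>
  have "eventually (\<lambda>g. \<forall>a\<in>insert (Y g1) A. dist (g a) (f a) < \<eta>) N'"
    by (rule eventually_ball_finite) (use A tendstoD[OF lim \<eta>] in auto)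
  with ev1 have "eventually (\<lambda>g. (g \<in> G \<and> (\<forall>\<phi>\<in>\<Phi>. dist (H g \<phi>) (c \<phi>) < \<eta>)) \<and>
      (\<forall>a\<in>insert (Y g1) A. dist (g a) (f a) < \<eta>)) N'"
    by (rule eventually_conj)
  then obtain g2 where g2: "g2 \<in> G" "\<forall>\<phi>\<in>\<Phi>. dist (H g2 \<phi>) (c \<phi>) < \<eta>"
      "\<forall>a\<in>insert (Y g1) A. dist (g2 a) (f a) < \<eta>"
    using N' eventually_happens by blast
  define y where "y = smul E (1 / 2) (Y g2 - Y g1)"
  have mem: "Y g1 \<in> vecs E" "Y g2 \<in> vecs E" using Y(1) g1 g2 nballD by blast+
  have app: "\<phi> y = (\<phi> (Y g2) - \<phi> (Y g1)) / 2" if "\<phi> \<in> vecs (dual E)" for \<phi>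
    using that mem by (simp add: y_def dual_smul dual_diff diff_mem)
  show thesis
  proof (rule that)
    show "g2 \<in> K" using g2 by (simp add: G_def)
    have "nrm E (Y g2 - Y g1) \<le> 2"
      using nrm_diff[OF mem(2,1)] Y(1)[OF g1(1)] Y(1)[OF g2(1)] by (simp add: nball_def)
    then show "y \<in> nball E"
      using mem by (simp add: nball_def y_def smul_mem diff_mem nrm_smul norm_divide)
    show "\<forall>\<phi>\<in>\<Phi>. norm (\<phi> y) < \<eta>"
    proof
      fix \<phi> assume \<phi>: "\<phi> \<in> \<Phi>"
      then have d: "\<phi> \<in> vecs (dual E)" using \<Phi>(2) by blast
      have "norm (\<phi> (Y g2) - \<phi> (Y g1)) < \<eta> + \<eta>"
        using dist_triangle_less_add[of "H g2 \<phi>" "c \<phi>" \<eta> "H g1 \<phi>" \<eta>] g1(2)[rule_format, OF \<phi>]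
          g2(2)[rule_format, OF \<phi>] d
        by (simp add: dist_norm H_def)
      then show "norm (\<phi> y) < \<eta>" by (simp add: app[OF d] norm_divide)
    qed
    show "\<forall>a\<in>A. norm (g2 a - f a) < \<eta>" using g2(3) by (simp add: dist_norm)
    have "g2 y - f y - of_real (e / 4) = - (g2 (Y g1) - f (Y g1)) / 2"
    proof -
      have "g2 y - f y = ((g2 (Y g2) - f (Y g2)) - (g2 (Y g1) - f (Y g1))) / 2"
        using app[of g2] app[of f] dualK fK g2(1) by (simp add: G_def field_simps)
      then have "g2 y - f y = (of_real (e / 2) - (g2 (Y g1) - f (Y g1))) / 2"
        by (simp only: Y(2)[OF g2(1)])
      then show ?thesis by (simp add: diff_divide_distrib)
    qed
    moreover have "norm (- (g2 (Y g1) - f (Y g1)) / 2) < \<eta>"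
      using g2(3) \<eta> by (simp add: dist_norm norm_divide norm_minus_commute)
    ultimately show "norm (g2 y - f y - of_real (e / 4)) < \<eta>" by (simp only:)
  qed
qed

text \<open>The number \<open>r\<close> is what has been collected so far, and the last assumption
  says that the error at \<open>x\<close> leaves some slack. Each level moves to a nearby functional
  and adds a weakly small vector on which its value is close to \<open>e / 4\<close>.\<close>

lemma not_good_of_szlenk:
  assumes "\<forall>e\<in>set es. 0 < e" "f \<in> foldr (szlenk_derivation E) es (nball (dual E))" "x \<in> vecs E"
    "norm (f x - of_real r) < r + sum_list es / 4 - C"
  shows "\<not> good C (length es) x"
  using assms
proof (induction es arbitrary: f x r)
  case Nil
  have "norm (of_real r :: 'k) \<le> norm (f x) + norm (f x - of_real r)"
    by (metis norm_minus_commute norm_triangle_sub)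
  then have "C < norm (f x)" using Nil.prems(4) by simp
  also have "\<dots> \<le> nrm E x" using Nil.prems(2,3) dual_ball_le by simp
  finally show ?case by (simp add: good_0)
next
  case (Cons e es)
  define K where "K = foldr (szlenk_derivation E) es (nball (dual E))"
  have K: "K \<subseteq> nball (dual E)" by (simp add: K_def foldr_szlenk_subset)
  have e: "0 < e" and f: "f \<in> szlenk_derivation E e K" using Cons.prems by (auto simp: K_def)
  have fd: "f \<in> vecs (dual E)"
    using f K szlenk_derivation_subset dual.nballD(1) by blast
  \<comment> \<open>One third of the slack for each error: the change of functional at
    \<open>x\<close>, the deviation from \<open>e / 4\<close>, and \<open>f y\<close>.\<close>
  define \<eta> where "\<eta> = (r + sum_list (e # es) / 4 - C - norm (f x - of_real r)) / 3"
  have \<eta>: "0 < \<eta>" using Cons.prems(4) by (simp add: \<eta>_def)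
  show ?case
  proof
    assume "good C (length (e # es)) x"
    then obtain \<Phi> \<delta> where \<Phi>: "finite \<Phi>" "\<Phi> \<subseteq> vecs (dual E)" "0 < \<delta>"
      "\<forall>y\<in>nball E. (\<forall>f\<in>\<Phi>. norm (f y) < \<delta>) \<longrightarrow> good C (length es) (x + y)"
      by (auto simp: good_Suc eventually_weak0)
    obtain g y where gy: "g \<in> K" "y \<in> nball E" "\<forall>\<phi>\<in>insert f \<Phi>. norm (\<phi> y) < min \<eta> \<delta>"
      "\<forall>a\<in>{x}. norm (g a - f a) < min \<eta> \<delta>" "norm (g y - f y - of_real (e / 4)) < min \<eta> \<delta>"
      using szlenk_derivation_pick[OF K e f, of "insert f \<Phi>" "{x}" "min \<eta> \<delta>"] \<Phi>(1-3) fd \<eta>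
      by (metis finite.emptyI finite_insert insert_subset min_less_iff_conj)
    have gd: "g \<in> vecs (dual E)" using gy(1) K dual.nballD(1) by blast
    have "g (x + y) = g x + g y"
      using dual_add[OF gd Cons.prems(3) nballD(1)[OF gy(2)]] .
    then have "g (x + y) - of_real (r + e / 4) =
        (f x - of_real r) + ((g x - f x) + ((g y - f y - of_real (e / 4)) + f y))"
      by simp
    also have "norm \<dots> \<le> norm (f x - of_real r) +
        (norm (g x - f x) + (norm (g y - f y - of_real (e / 4)) + norm (f y)))"
      by (intro norm_triangle_mono order_refl)
    also have "\<dots> < norm (f x - of_real r) + (\<eta> + (\<eta> + \<eta>))"
      using gy(3-5) by (intro add_strict_left_mono add_strict_mono) auto
    also have "\<dots> = (r + e / 4) + sum_list es / 4 - C" by (simp add: \<eta>_def field_simps)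
    finally have "\<not> good C (length es) (x + y)"
      using gy(1) Cons.prems(1,3) add_mem nballD(1)[OF gy(2)]
      by (intro Cons.IH[of g _ "r + e / 4"]) (auto simp: K_def)
    then show False using \<Phi>(4) gy(2,3) by simp
  qed
qed

theorem summable_szlenk_of_bounded_branches:
  assumes "bounded_branches"
  shows "summable_szlenk E"
proof -
  obtain C where C: "\<And>n. good C n 0" using assms by (auto simp: bounded_branches_def)
  have "sum_list es \<le> max 0 (4 * C)" if ne: "foldr (szlenk_derivation E) es (nball (dual E)) \<noteq> {}" for es
  proof -
    \<comment> \<open>Nonpositive parameters act as the identity and do not increase the
      sum.\<close>
    define es' where "es' = filter (\<lambda>e. 0 < e) es"
    have "foldr (szlenk_derivation E) es (nball (dual E)) = foldr (szlenk_derivation E) es' (nball (dual E))"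
      unfolding es'_def by (induction es) (auto simp: szlenk_derivation_def)
    then obtain f where f: "f \<in> foldr (szlenk_derivation E) es' (nball (dual E))" using ne by auto
    have "f 0 = 0" using f foldr_szlenk_subset dual.nballD(1) dual_zero by blast
    then have "\<not> norm (f 0 - of_real 0) < 0 + sum_list es' / 4 - C"
      using not_good_of_szlenk[of es' f 0 0 C] f C zero_mem by (auto simp: es'_def)
    then have "sum_list es' \<le> 4 * C" using \<open>f 0 = 0\<close> by simp
    moreover have "sum_list es \<le> sum_list es'" unfolding es'_def by (induction es) auto
    ultimately show ?thesis by simp
  qed
  then show ?thesis
    unfolding summable_szlenk_def M_summable_szlenk_def by (intro exI[of _ "max 0 (4 * C)"]) auto
qed

end

section \<open>From summable Szlenk index to bounded branches\<close>

text \<open>Common form of two cases: \<open>f (u g)\<close> for \<open>u\<close> in the tensor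
  product, and \<open>f z\<close> on a single space. Continuity is asked along filters on
  \<open>'z\<close> because the limits are taken along refinements of the weak filter of
  \<open>Z\<close>.\<close>

locale norming_pairing = Z: normed_nspace Z + X: normed_nspace X + Y: normed_nspace Y
  for Z :: "('k::real_or_complex, 'z::ab_group_add) nspace"
    and X :: "('k, 'x::ab_group_add) nspace" and Y :: "('k, 'y::ab_group_add) nspace" +
  fixes \<beta> :: "'z \<Rightarrow> ('x \<Rightarrow> 'k) \<Rightarrow> ('y \<Rightarrow> 'k) \<Rightarrow> 'k"
  assumes pairing_dual: "f \<in> nball (dual X) \<Longrightarrow> g \<in> nball (dual Y) \<Longrightarrow>
      (\<lambda>z. if z \<in> vecs Z then \<beta> z f g else 0) \<in> vecs (dual Z)"
    and pairing_lipschitz: "z \<in> nball Z \<Longrightarrow> f \<in> nball (dual X) \<Longrightarrow> f' \<in> nball (dual X) \<Longrightarrow>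
      g \<in> nball (dual Y) \<Longrightarrow> g' \<in> nball (dual Y) \<Longrightarrow>
      norm (\<beta> z f g - \<beta> z f' g') \<le> nrm (dual X) (f - f') + nrm (dual Y) (g - g')"
    and pairing_continuous: "z \<in> vecs Z \<Longrightarrow> f0 \<in> nball (dual X) \<Longrightarrow> g0 \<in> nball (dual Y) \<Longrightarrow>
      eventually (\<lambda>y :: 'z. h y \<in> nball (dual X) \<and> k y \<in> nball (dual Y)) W \<Longrightarrow>
      (h \<longlongrightarrow> f0) W \<Longrightarrow> (k \<longlongrightarrow> g0) W \<Longrightarrow> ((\<lambda>y. \<beta> z (h y) (k y)) \<longlongrightarrow> \<beta> z f0 g0) W"
    and pairing_norming: "z \<in> vecs Z \<Longrightarrow> c < nrm Z z \<Longrightarrow>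
      \<exists>f\<in>nball (dual X). \<exists>g\<in>nball (dual Y). c \<le> norm (\<beta> z f g)"
begin

interpretation Xd: normed_nspace "dual X" by (rule X.normed_nspace_dual)
interpretation Yd: normed_nspace "dual Y" by (rule Y.normed_nspace_dual)

abbreviation "KX es \<equiv> foldr (szlenk_derivation X) es (nball (dual X))"
abbreviation "KY es \<equiv> foldr (szlenk_derivation Y) es (nball (dual Y))"

lemma pairing_add:
  assumes "f \<in> nball (dual X)" "g \<in> nball (dual Y)" "z \<in> vecs Z" "z' \<in> vecs Z"
  shows "\<beta> (z + z') f g = \<beta> z f g + \<beta> z' f g"
  using Z.dual_add[OF pairing_dual[OF assms(1,2)] assms(3,4)] assms(3,4) by (simp add: Z.add_mem)

lemma pairing_zero: "f \<in> nball (dual X) \<Longrightarrow> g \<in> nball (dual Y) \<Longrightarrow> \<beta> 0 f g = 0"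
  using Z.dual_zero[OF pairing_dual] by (simp add: Z.zero_mem)

text \<open>The lists \<open>p\<close> and \<open>q\<close> collect, rounded to \<open>S\<close>,
  the distances of the functionals to their successive limits. Each level costs
  \<open>3 * d\<close>: \<open>d / 2\<close> for convergence at \<open>z\<close>,
  \<open>d / 2\<close> for the value of the limit pair at the new vector, and \<open>d\<close> for
  each of the two roundings.\<close>

lemma szlenk_of_not_good:
  assumes d: "0 < d" and S: "finite S" "\<And>r. 0 \<le> r \<Longrightarrow> r \<le> 2 \<Longrightarrow> \<exists>s\<in>S. (s = 0 \<or> s < r) \<and> r \<le> s + d"
  shows "z \<in> vecs Z \<Longrightarrow> \<not> Z.good C n z \<Longrightarrow>
    \<exists>f g p q. set p \<subseteq> S \<and> length p = n \<and> set q \<subseteq> S \<and> length q = n \<and> f \<in> KX p \<and> g \<in> KY q \<and>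
      C - 3 * real n * d \<le> norm (\<beta> z f g) + sum_list p + sum_list q"
proof (induction n arbitrary: z)
  case 0
  obtain f g where "f \<in> nball (dual X)" "g \<in> nball (dual Y)" "C \<le> norm (\<beta> z f g)"
    using pairing_norming[OF 0(1), of C] 0(2) by (auto simp: Z.good_0)
  then show ?case by (intro exI[of _ f] exI[of _ g] exI[of _ "[]"]) (auto simp: Z.good_0)
next
  case (Suc n)
  define B where "B = {y \<in> nball Z. \<not> Z.good C n (z + y)}"
  define W1 where "W1 = inf (Z.weak0 (nball Z)) (principal B)"
  have "frequently (\<lambda>y. y \<in> B) (Z.weak0 (nball Z))"
  proof -
    have "frequently (\<lambda>y. \<not> Z.good C n (z + y)) (Z.weak0 (nball Z))"
      using Suc.prems(2) by (simp add: Z.good_Suc frequently_def)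
    from frequently_eventually_conj[OF this Z.eventually_weak0_mem]
    show ?thesis by (rule frequently_elim1) (simp add: B_def)
  qed
  then have W1: "W1 \<noteq> bot" by (simp add: W1_def inf_principal_not_bot)
  have evB: "eventually (\<lambda>y. y \<in> B) W1" by (simp add: W1_def eventually_inf_principal)
  define R where "R y f g p q \<longleftrightarrow> set p \<subseteq> S \<and> length p = n \<and> set q \<subseteq> S \<and> length q = n \<and>
      f \<in> KX p \<and> g \<in> KY q \<and> C - 3 * real n * d \<le> norm (\<beta> (z + y) f g) + sum_list p + sum_list q"
    for y f g p q
  have "\<forall>y\<in>B. \<exists>f g p q. R y f g p q"
    using Suc.prems(1) unfolding R_def by (intro ballI Suc.IH) (auto simp: B_def Z.add_mem dest: Z.nballD)
  from bchoice[OF this] obtain f where "\<forall>y\<in>B. \<exists>g p q. R y (f y) g p q" ..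
  from bchoice[OF this] obtain g where "\<forall>y\<in>B. \<exists>p q. R y (f y) (g y) p q" ..
  from bchoice[OF this] obtain p where "\<forall>y\<in>B. \<exists>q. R y (f y) (g y) (p y) q" ..
  from bchoice[OF this] obtain q where "\<forall>y\<in>B. R y (f y) (g y) (p y) (q y)" ..
  then have fg: "\<And>y. y \<in> B \<Longrightarrow> set (p y) \<subseteq> S" "\<And>y. y \<in> B \<Longrightarrow> length (p y) = n"
      "\<And>y. y \<in> B \<Longrightarrow> set (q y) \<subseteq> S" "\<And>y. y \<in> B \<Longrightarrow> length (q y) = n"
      "\<And>y. y \<in> B \<Longrightarrow> f y \<in> KX (p y)" "\<And>y. y \<in> B \<Longrightarrow> g y \<in> KY (q y)"
      "\<And>y. y \<in> B \<Longrightarrow> C - 3 * real n * d \<le> norm (\<beta> (z + y) (f y) (g y)) + sum_list (p y) + sum_list (q y)"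
    unfolding R_def by simp_all
  have fb: "f y \<in> nball (dual X)" if "y \<in> B" for y using fg(5)[OF that] X.foldr_szlenk_subset by blast
  have gb: "g y \<in> nball (dual Y)" if "y \<in> B" for y using fg(6)[OF that] Y.foldr_szlenk_subset by blast
  have "eventually (\<lambda>y. (f y, g y) \<in> nball (dual X) \<times> nball (dual Y)) W1"
    using evB by eventually_elim (simp add: fb gb)
  from compact_filter_cluster[OF compact_Times[OF X.compact_dual_ball Y.compact_dual_ball] W1 this]
  obtain fg0 where fg0: "fg0 \<in> nball (dual X) \<times> nball (dual Y)"
    "inf W1 (filtercomap (\<lambda>y. (f y, g y)) (nhds fg0)) \<noteq> bot" .
  obtain f0 g0 where eq: "fg0 = (f0, g0)" by (cases fg0)
  define W2 where "W2 = inf W1 (filtercomap (\<lambda>y. (f y, g y)) (nhds (f0, g0)))"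
  have W2: "W2 \<noteq> bot" using fg0(2) by (simp add: W2_def eq)
  have f0: "f0 \<in> nball (dual X)" and g0: "g0 \<in> nball (dual Y)" using fg0(1) by (auto simp: eq)
  have lim: "((\<lambda>y. (f y, g y)) \<longlongrightarrow> (f0, g0)) W2"
    unfolding W2_def by (rule filterlim_mono[OF filterlim_filtercomap order_refl]) simp
  have limf: "(f \<longlongrightarrow> f0) W2" and limg: "(g \<longlongrightarrow> g0) W2"
    using tendsto_fst[OF lim] tendsto_snd[OF lim] by simp_all
  define r where "r y = nrm (dual X) (f y - f0)" for y
  define r' where "r' y = nrm (dual Y) (g y - g0)" for y
  have r: "0 \<le> r y \<and> r y \<le> 2" if "y \<in> B" for y
    using Xd.nballD[OF fb[OF that]] Xd.nballD[OF f0] Xd.nrm_diff[of "f y" f0] Xd.nrm_nonneg[of "f y - f0"]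
      Xd.diff_mem[of "f y" f0] by (simp add: r_def)
  have r': "0 \<le> r' y \<and> r' y \<le> 2" if "y \<in> B" for y
    using Yd.nballD[OF gb[OF that]] Yd.nballD[OF g0] Yd.nrm_diff[of "g y" g0] Yd.nrm_nonneg[of "g y - g0"]
      Yd.diff_mem[of "g y" g0] by (simp add: r'_def)
  obtain \<sigma> where \<sigma>: "\<And>r. 0 \<le> r \<Longrightarrow> r \<le> 2 \<Longrightarrow> \<sigma> r \<in> S" "\<And>r. 0 \<le> r \<Longrightarrow> r \<le> 2 \<Longrightarrow> \<sigma> r = 0 \<or> \<sigma> r < r"
    "\<And>r. 0 \<le> r \<Longrightarrow> r \<le> 2 \<Longrightarrow> r \<le> \<sigma> r + d"
    using S(2) by metis
  \<comment> \<open>Everything on which the Szlenk derivations depend. It ranges over the finite set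
    \<open>A\<close> and can therefore be frozen.\<close>
  define v where "v y = ((p y, q y), (\<sigma> (r y), \<sigma> (r' y)))" for y
  define A where "A = ({l. set l \<subseteq> S \<and> length l = n} \<times> {l. set l \<subseteq> S \<and> length l = n}) \<times> (S \<times> S)"
  have evB2: "eventually (\<lambda>y. y \<in> B) W2"
    using evB filter_leD[of W2 W1] by (simp add: W2_def)
  have "finite A" unfolding A_def by (intro finite_cartesian_product finite_lists_length_eq S(1))
  moreover have "eventually (\<lambda>y. v y \<in> A) W2"
    using evB2 by eventually_elim (auto simp: v_def A_def fg \<sigma> r r')
  ultimately obtain a where a: "a \<in> A" "inf W2 (principal {y. v y = a}) \<noteq> bot"
    using filter_pigeonhole[OF W2] by metis
  obtain p0 q0 s s' where a_eq: "a = ((p0, q0), (s, s'))" by (metis prod.exhaust)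
  define W where "W = inf W2 (principal {y. v y = a})"
  have W: "W \<noteq> bot" using a(2) by (simp add: W_def)
  have W_le: "W \<le> W2" by (simp add: W_def)
  have ev: "eventually (\<lambda>y. y \<in> B \<and> p y = p0 \<and> q y = q0 \<and> \<sigma> (r y) = s \<and> \<sigma> (r' y) = s') W"
  proof -
    have "eventually (\<lambda>y. v y = a) W" by (simp add: W_def eventually_inf_principal)
    with filter_leD[OF W_le evB2] show ?thesis by eventually_elim (simp add: v_def a_eq)
  qed
  note limf = tendsto_mono[OF W_le limf] and limg = tendsto_mono[OF W_le limg]
  have "f0 \<in> szlenk_derivation X s (KX p0)"
  proof (rule X.szlenk_derivation_limit[OF X.foldr_szlenk_subset X.closed_foldr_szlenk W _ limf])
    show "eventually (\<lambda>y. f y \<in> KX p0) W" using ev by eventually_elim (use fg(5) in blast)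
    have "eventually (\<lambda>y. s = 0 \<or> s < nrm (dual X) (f y - f0)) W"
      using ev by eventually_elim (use r \<sigma>(2) r_def in metis)
    then show "s \<le> 0 \<or> eventually (\<lambda>y. s < nrm (dual X) (f y - f0)) W" by (cases "s = 0") auto
  qed
  then have f0': "f0 \<in> KX (s # p0)" by simp
  have "g0 \<in> szlenk_derivation Y s' (KY q0)"
  proof (rule Y.szlenk_derivation_limit[OF Y.foldr_szlenk_subset Y.closed_foldr_szlenk W _ limg])
    show "eventually (\<lambda>y. g y \<in> KY q0) W" using ev by eventually_elim (use fg(6) in blast)
    have "eventually (\<lambda>y. s' = 0 \<or> s' < nrm (dual Y) (g y - g0)) W"
      using ev by eventually_elim (use r' \<sigma>(2) r'_def in metis)
    then show "s' \<le> 0 \<or> eventually (\<lambda>y. s' < nrm (dual Y) (g y - g0)) W" by (cases "s' = 0") auto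
  qed
  then have g0': "g0 \<in> KY (s' # q0)" by simp
  have "eventually (\<lambda>y. f y \<in> nball (dual X) \<and> g y \<in> nball (dual Y)) W"
    using ev by eventually_elim (use fb gb in blast)
  from pairing_continuous[OF Suc.prems(1) f0 g0 this limf limg]
  have "((\<lambda>y. \<beta> z (f y) (g y)) \<longlongrightarrow> \<beta> z f0 g0) W" .
  then have ev1: "eventually (\<lambda>y. dist (\<beta> z (f y) (g y)) (\<beta> z f0 g0) < d / 2) W"
    using d by (intro tendstoD) auto
  \<comment> \<open>The pair of limits acts as one fixed functional on \<open>Z\<close>, hence
    becomes small along the weak filter.\<close>
  have "W \<le> Z.weak0 (nball Z)" unfolding W_def W2_def W1_def by (simp add: le_infI1)
  then have "eventually (\<lambda>y. norm (if y \<in> vecs Z then \<beta> y f0 g0 else 0) < d / 2) W"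
    by (rule filter_leD[OF _ Z.eventually_weak0_less[OF pairing_dual[OF f0 g0]]]) (use d in simp)
  with ev ev1 have "eventually (\<lambda>y. (y \<in> B \<and> p y = p0 \<and> q y = q0 \<and> \<sigma> (r y) = s \<and> \<sigma> (r' y) = s') \<and>
      dist (\<beta> z (f y) (g y)) (\<beta> z f0 g0) < d / 2 \<and> norm (if y \<in> vecs Z then \<beta> y f0 g0 else 0) < d / 2) W"
    by eventually_elim blast
  then obtain y where y: "y \<in> B" "p y = p0" "q y = q0" "\<sigma> (r y) = s" "\<sigma> (r' y) = s'"
    "dist (\<beta> z (f y) (g y)) (\<beta> z f0 g0) < d / 2" "norm (if y \<in> vecs Z then \<beta> y f0 g0 else 0) < d / 2"
    using W eventually_happens by blast
  have yb: "y \<in> nball Z" "y \<in> vecs Z" using y(1) Z.nballD(1) by (auto simp: B_def)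
  have "norm (\<beta> (z + y) (f y) (g y)) \<le> norm (\<beta> z (f y) (g y)) + norm (\<beta> y (f y) (g y))"
    using pairing_add[OF fb[OF y(1)] gb[OF y(1)] Suc.prems(1) yb(2)] norm_triangle_ineq by metis
  moreover have "norm (\<beta> z (f y) (g y)) \<le> norm (\<beta> z f0 g0) + d / 2"
    using y(6) norm_triangle_sub[of "\<beta> z (f y) (g y)" "\<beta> z f0 g0"] by (simp add: dist_norm)
  moreover have "norm (\<beta> y (f y) (g y)) \<le> d / 2 + (r y + r' y)"
    using y(7) yb(2) norm_triangle_sub[of "\<beta> y (f y) (g y)" "\<beta> y f0 g0"]
      pairing_lipschitz[OF yb(1) fb[OF y(1)] f0 gb[OF y(1)] g0] by (simp add: r_def r'_def)
  moreover have "r y \<le> s + d" "r' y \<le> s' + d"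
    using \<sigma>(3) r[OF y(1)] r'[OF y(1)] y(4,5) by metis+
  moreover have "C - 3 * real n * d \<le> norm (\<beta> (z + y) (f y) (g y)) + sum_list p0 + sum_list q0"
    using fg(7)[OF y(1)] y(2,3) by simp
  ultimately have "C - 3 * real (Suc n) * d \<le>
      norm (\<beta> z f0 g0) + sum_list (s # p0) + sum_list (s' # q0)"
    by (simp add: algebra_simps)
  moreover have "set (s # p0) \<subseteq> S" "length (s # p0) = Suc n" "set (s' # q0) \<subseteq> S" "length (s' # q0) = Suc n"
    using a(1) by (auto simp: a_eq A_def)
  ultimately show ?case using f0' g0' by blast
qed

text \<open>At \<open>z = 0\<close> the pairing vanishes, so the two Szlenk sums alone would have to
  reach the bound.\<close>

theorem bounded_branches_of_summable_szlenk:
  assumes "summable_szlenk X" "summable_szlenk Y"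
  shows "Z.bounded_branches"
proof -
  obtain M N where M: "0 \<le> M" "M_summable_szlenk X M (nball (dual X))"
    and N: "0 \<le> N" "M_summable_szlenk Y N (nball (dual Y))"
    using assms unfolding summable_szlenk_def by blast
  have "Z.good (M + N + 1) n 0" for n
  proof (cases "n = 0")
    case True
    then show ?thesis using M(1) N(1) by (simp add: Z.good_0)
  next
    case False
    show ?thesis
    proof (rule ccontr)
      assume ng: "\<not> Z.good (M + N + 1) n 0"
      \<comment> \<open>With this \<open>d\<close> the accumulated error
        \<open>3 * real n * d\<close> stays below the 1 that was added to
        \<open>M + N\<close>.\<close>
      define d where "d = 1 / (3 * (real n + 1))"
      have d: "0 < d" by (simp add: d_def)
      obtain S where S: "finite S" "\<And>r. 0 \<le> r \<Longrightarrow> r \<le> 2 \<Longrightarrow> \<exists>s\<in>S. (s = 0 \<or> s < r) \<and> r \<le> s + d"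
        using finite_rounding[OF d, of 2] by metis
      obtain f g p q where *: "length p = n" "length q = n" "f \<in> KX p" "g \<in> KY q"
        "M + N + 1 - 3 * real n * d \<le> norm (\<beta> 0 f g) + sum_list p + sum_list q"
        using szlenk_of_not_good[OF d S Z.zero_mem ng] by blast
      have "f \<in> nball (dual X)" "g \<in> nball (dual Y)"
        using * X.foldr_szlenk_subset Y.foldr_szlenk_subset by blast+
      then have "\<beta> 0 f g = 0" by (rule pairing_zero)
      moreover have "p \<noteq> []" "q \<noteq> []" using * False by auto
      then have "sum_list p \<le> M" "sum_list q \<le> N"
        using M(2) N(2) *(3,4) unfolding M_summable_szlenk_def by blast+
      moreover have "3 * real n * d < 1" by (simp add: d_def)
      ultimately show False using *(5) by simp
    qed
  qed
  then show ?thesis unfolding Z.bounded_branches_def by blast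
qed

end

theorem (in normed_nspace) bounded_branches_iff_summable_szlenk:
  "bounded_branches \<longleftrightarrow> summable_szlenk E"
proof
  assume s: "summable_szlenk E"
  interpret dual: normed_nspace "dual E" by (rule normed_nspace_dual)
  interpret norming_pairing E E E "\<lambda>z f g. f z"
  proof
    fix f g :: "'e \<Rightarrow> 'k" assume f: "f \<in> nball (dual E)"
    have "(\<lambda>z. if z \<in> vecs E then f z else 0) = f"
      using dual_outside[OF dual.nballD(1)[OF f]] by auto
    then show "(\<lambda>z. if z \<in> vecs E then f z else 0) \<in> vecs (dual E)"
      using dual.nballD(1)[OF f] by simp
  next
    fix z f f' and g g' :: "'e \<Rightarrow> 'k"
    assume *: "z \<in> nball E" "f \<in> nball (dual E)" "f' \<in> nball (dual E)" "g \<in> nball (dual E)" "g' \<in> nball (dual E)"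
    then show "norm (f z - f' z) \<le> nrm (dual E) (f - f') + nrm (dual E) (g - g')"
      using nrm_dual_upper[of "f - f'" z] dual.nrm_nonneg[of "g - g'"] dual.diff_mem dual.nballD(1)
      by fastforce
  next
    fix z c assume "z \<in> vecs E" "c < nrm E z"
    then show "\<exists>f\<in>nball (dual E). \<exists>g\<in>nball (dual E). c \<le> norm (f z)"
      using norming_functional[of z] by (metis less_imp_le)
  qed (rule tendsto_coordinate)
  show bounded_branches using s s by (rule bounded_branches_of_summable_szlenk)
qed (rule summable_szlenk_of_bounded_branches)

section \<open>Asymptotic \<open>c\<^sub>0\<close> and bounded branches\<close>

text \<open>Nodes are lists of neighbourhoods. As the vector at a node lies in the last entry, the
  tree is weakly null once weak neighbourhoods are directed by reverse inclusion.\<close>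

lemma not_nested_tree:
  assumes D: "\<And>U. U \<in> D \<Longrightarrow> eventually (\<lambda>y. y \<in> U) F"
  shows "\<not> nested F n (\<lambda>l. \<not> Q l) \<Longrightarrow> \<exists>x :: 'e set list \<Rightarrow> 'e.
    (\<forall>t. set t \<subseteq> D \<and> t \<noteq> [] \<and> length t \<le> n \<longrightarrow> x t \<in> last t) \<and>
    (\<forall>t. set t \<subseteq> D \<and> length t = n \<longrightarrow> Q (map (\<lambda>i. x (take (Suc i) t)) [0..<n]))"
proof (induction n arbitrary: Q)
  case (Suc n)
  have "\<exists>y. y \<in> U \<and> \<not> nested F n (\<lambda>l. \<not> Q (y # l))" if "U \<in> D" for U
  proof -
    have "frequently (\<lambda>y. \<not> nested F n (\<lambda>l. \<not> Q (y # l))) F"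
      using Suc.prems by (simp add: frequently_def)
    from frequently_eventually_conj[OF this D[OF that]] show ?thesis
      by (auto dest!: frequently_ex)
  qed
  then obtain y where y: "\<And>U. U \<in> D \<Longrightarrow> y U \<in> U" "\<And>U. U \<in> D \<Longrightarrow> \<not> nested F n (\<lambda>l. \<not> Q (y U # l))"
    by metis
  have "\<forall>U\<in>D. \<exists>x :: 'e set list \<Rightarrow> 'e. (\<forall>t. set t \<subseteq> D \<and> t \<noteq> [] \<and> length t \<le> n \<longrightarrow> x t \<in> last t) \<and>
    (\<forall>t. set t \<subseteq> D \<and> length t = n \<longrightarrow> Q (y U # map (\<lambda>i. x (take (Suc i) t)) [0..<n]))"
  proof
    fix U assume "U \<in> D"
    from Suc.IH[OF y(2)[OF this]]
    show "\<exists>x :: 'e set list \<Rightarrow> 'e. (\<forall>t. set t \<subseteq> D \<and> t \<noteq> [] \<and> length t \<le> n \<longrightarrow> x t \<in> last t) \<and>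
      (\<forall>t. set t \<subseteq> D \<and> length t = n \<longrightarrow> Q (y U # map (\<lambda>i. x (take (Suc i) t)) [0..<n]))" .
  qed
  from bchoice[OF this] obtain X :: "'e set \<Rightarrow> 'e set list \<Rightarrow> 'e" where
    X: "\<And>U t. U \<in> D \<Longrightarrow> set t \<subseteq> D \<Longrightarrow> t \<noteq> [] \<Longrightarrow> length t \<le> n \<Longrightarrow> X U t \<in> last t"
      "\<And>U t. U \<in> D \<Longrightarrow> set t \<subseteq> D \<Longrightarrow> length t = n \<Longrightarrow> Q (y U # map (\<lambda>i. X U (take (Suc i) t)) [0..<n])"
    by blast
  \<comment> \<open>The first entry of a node selects the first vector and the subtree grown from
    it.\<close>
  define x where "x t = (if tl t = [] then y (hd t) else X (hd t) (tl t))" for t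
  have "Q (map (\<lambda>i. x (take (Suc i) t)) [0..<Suc n])" if t: "set t \<subseteq> D" "length t = Suc n" for t
  proof -
    obtain U t' where t': "t = U # t'" using t(2) by (cases t) auto
    have "map (\<lambda>i. x (take (Suc i) t)) [0..<Suc n] = y U # map (\<lambda>i. x (take (Suc (Suc i)) t)) [0..<n]"
      by (subst map_upt_Suc) (simp add: t' x_def)
    also have "map (\<lambda>i. x (take (Suc (Suc i)) t)) [0..<n] = map (\<lambda>i. X U (take (Suc i) t')) [0..<n]"
      using t(2) by (auto simp: t' x_def)
    finally show ?thesis using X(2)[of U t'] t by (simp add: t')
  qed
  moreover have "x t \<in> last t" if t: "set t \<subseteq> D" "t \<noteq> []" "length t \<le> Suc n" for t
  proof -
    obtain U t' where t': "t = U # t'" using t(2) by (cases t) auto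
    show ?thesis using X(1)[of U t'] y(1)[of U] t by (auto simp: t' x_def)
  qed
  ultimately show ?case by blast
qed auto

section \<open>Linear combinations along a branch\<close>

context normed_nspace
begin

text \<open>Lists count from 0 but coefficient tuples from 1; hence the shifts
  \<open>a (Suc i)\<close> below.\<close>

definition lincomb :: "(nat \<Rightarrow> 'k) \<Rightarrow> 'e list \<Rightarrow> 'e" where
  "lincomb a l = (\<Sum>i<length l. smul E (a i) (l ! i))"

lemma lincomb_Nil [simp]: "lincomb a [] = 0"
  by (simp add: lincomb_def)

lemma lincomb_Cons: "lincomb a (y # l) = smul E (a 0) y + lincomb (\<lambda>i. a (Suc i)) l"
  by (simp add: lincomb_def sum.lessThan_Suc_shift del: sum.lessThan_Suc)

lemma lincomb_mem: "set l \<subseteq> vecs E \<Longrightarrow> lincomb a l \<in> vecs E"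
  unfolding lincomb_def by (intro sum_mem smul_mem) auto

lemma lincomb_add: "lincomb (\<lambda>i. a i + b i) l = lincomb a l + lincomb b l"
  by (simp add: lincomb_def vs.scale_left_distrib sum.distrib)

lemma lincomb_diff: "lincomb (\<lambda>i. a i - b i) l = lincomb a l - lincomb b l"
  by (simp add: lincomb_def vs.scale_left_diff_distrib sum_subtractf)

lemma lincomb_scale: "lincomb (\<lambda>i. c * a i) l = smul E c (lincomb a l)"
  by (simp add: lincomb_def vs.scale_sum_right)

lemma sum_list_eq_lincomb: "sum_list l = lincomb (\<lambda>i. if i < length l then 1 else 0) l"
  by (simp add: lincomb_def sum_list_sum_nth atLeast0LessThan)

lemma nsphere_subset: "nsphere E \<subseteq> vecs E" "nsphere E \<subseteq> nball E"
  by (auto simp: nsphere_def nball_def)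

lemma nrm_lincomb_le:
  assumes "set l \<subseteq> nsphere E"
  shows "nrm E (lincomb a l) \<le> (\<Sum>i<length l. norm (a i))"
proof -
  have l: "l ! i \<in> vecs E" "nrm E (l ! i) = 1" if "i < length l" for i
    using subsetD[OF assms nth_mem[OF that]] by (simp_all add: nsphere_def)
  have "nrm E (lincomb a l) \<le> (\<Sum>i<length l. nrm E (smul E (a i) (l ! i)))"
    unfolding lincomb_def by (intro nrm_sum smul_mem l) auto
  also have "\<dots> = (\<Sum>i<length l. norm (a i))"
    by (intro sum.cong refl) (simp add: nrm_smul l)
  finally show ?thesis .
qed

text \<open>A coefficient of modulus at most 1 keeps a vector in the ball and does not enlarge the
  values of functionals, so it can be absorbed into the vector.\<close>

lemma nested_good_scaled:
  "good C n x \<Longrightarrow> (\<And>i. norm (a i) \<le> 1) \<Longrightarrow>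
    nested (weak0 (nsphere E)) n (\<lambda>l. nrm E (x + lincomb a l) \<le> C)"
proof (induction n arbitrary: x a)
  case (Suc n)
  obtain \<Phi> e where \<Phi>: "finite \<Phi>" "\<Phi> \<subseteq> vecs (dual E)" "0 < e"
    "\<forall>y\<in>nball E. (\<forall>f\<in>\<Phi>. norm (f y) < e) \<longrightarrow> good C n (x + y)"
    using Suc.prems(1) unfolding good_Suc eventually_weak0 by blast
  have "nested (weak0 (nsphere E)) n (\<lambda>l. nrm E (x + lincomb a (y # l)) \<le> C)"
    if y: "y \<in> nsphere E" "\<forall>f\<in>\<Phi>. norm (f y) < e" for y
  proof -
    have yv: "y \<in> vecs E" "nrm E y = 1" using y(1) by (auto simp: nsphere_def)
    have "smul E (a 0) y \<in> nball E"
      using yv Suc.prems(2)[of 0] by (simp add: nball_def smul_mem nrm_smul)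
    moreover have "norm (f (smul E (a 0) y)) < e" if f: "f \<in> \<Phi>" for f
    proof -
      have "norm (f (smul E (a 0) y)) = norm (a 0) * norm (f y)"
        using dual_smul[of f y "a 0"] \<Phi>(2) f yv(1) by (auto simp: norm_mult)
      also have "\<dots> \<le> 1 * norm (f y)" using Suc.prems(2)[of 0] by (intro mult_right_mono) auto
      finally show ?thesis using y(2) f by fastforce
    qed
    ultimately have "good C n (x + smul E (a 0) y)" using \<Phi>(4) by blast
    from Suc.IH[OF this, of "\<lambda>i. a (Suc i)"] Suc.prems(2) show ?thesis
      by (simp add: lincomb_Cons add.assoc)
  qed
  then show ?case unfolding nested.simps eventually_weak0 using \<Phi>(1-3) by blast
qed (simp add: good_0)

text \<open>Each new vector may be required to be so small at \<open>f\<close> that it uses up only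
  part of the slack \<open>norm (f x) - c\<close>.\<close>

lemma nested_functional_large:
  assumes "A \<subseteq> vecs E" "f \<in> vecs (dual E)"
  shows "x \<in> vecs E \<Longrightarrow> c < norm (f x) \<Longrightarrow> nested (weak0 A) n (\<lambda>l. c < norm (f (x + lincomb a l)))"
proof (induction n arbitrary: x a)
  case (Suc n)
  \<comment> \<open>The slack relative to the size of the coefficient; the added 1 avoids division
    by 0.\<close>
  define t where "t = (norm (f x) - c) / (norm (a 0) + 1)"
  have pos: "norm (a 0) + 1 > 0" by (simp add: add_nonneg_pos)
  then have t: "0 < t" using Suc.prems(2) by (simp add: t_def)
  have "eventually (\<lambda>y. norm (f y) < t) (weak0 A)"
    by (rule eventually_weak0_less[OF assms(2) t])
  then show ?case
    unfolding nested.simps using eventually_weak0_mem[of A]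
  proof eventually_elim
    case (elim y)
    have y: "y \<in> vecs E" using elim(2) assms(1) by blast
    have "norm (a 0) * norm (f y) \<le> (norm (a 0) + 1) * norm (f y)" by (intro mult_right_mono) auto
    also have "\<dots> < (norm (a 0) + 1) * t" using elim(1) pos by (rule mult_strict_left_mono)
    also have "\<dots> = norm (f x) - c" using pos by (simp add: t_def)
    finally have "norm (a 0 * f y) < norm (f x) - c" by (simp add: norm_mult)
    moreover have "f (x + smul E (a 0) y) = f x + a 0 * f y"
      using dual_add[OF assms(2) Suc.prems(1) smul_mem[OF y]] dual_smul[OF assms(2) y] by simp
    moreover have "norm (f x) - norm (a 0 * f y) \<le> norm (f x + a 0 * f y)"
      by (rule norm_diff_ineq)
    ultimately have "c < norm (f (x + smul E (a 0) y))" by simp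
    from Suc.IH[OF add_mem[OF Suc.prems(1) smul_mem[OF y]] this, of "\<lambda>i. a (Suc i)"]
    show ?case by (simp add: lincomb_Cons add.assoc)
  qed
qed simp

text \<open>Weak lower semicontinuity of the norm, iterated along a branch by means of a functional
  norming \<open>x\<close>.\<close>

lemma nested_nrm_large:
  assumes "A \<subseteq> vecs E" "x \<in> vecs E" "c < nrm E x"
  shows "nested (weak0 A) n (\<lambda>l. c \<le> nrm E (x + lincomb a l))"
proof -
  interpret dual: normed_nspace "dual E" by (rule normed_nspace_dual)
  obtain f where f: "f \<in> nball (dual E)" "norm (f x) = nrm E x" using norming_functional[OF assms(2)] by blast
  have "nested (weak0 A) n (\<lambda>l. c < norm (f (x + lincomb a l)) \<and> (length l = n \<and> set l \<subseteq> A))"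
    using f assms
    by (intro nested_conj nested_functional_large nested_lists eventually_weak0_mem dual.nballD) auto
  then show ?thesis
  proof (rule nested_mono)
    fix l assume l: "c < norm (f (x + lincomb a l)) \<and> (length l = n \<and> set l \<subseteq> A)"
    then have "set l \<subseteq> vecs E" using assms(1) by blast
    from dual_ball_le[OF f(1) add_mem[OF assms(2) lincomb_mem[OF this]], of a] l
    show "c \<le> nrm E (x + lincomb a l)" by simp
  qed
qed

text \<open>The step with coefficient \<open>a k\<close> moves the partial sum by a vector of norm
  at least \<open>r\<close>. So before or after it the norm exceeds \<open>r / 4\<close>, and later
  vectors, being weakly small, cannot bring it below that again.\<close>

lemma nested_lower_estimate:
  "x \<in> vecs E \<Longrightarrow> k < n \<Longrightarrow> 0 < r \<Longrightarrow> r \<le> norm (a k) \<Longrightarrow>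
    nested (weak0 (nsphere E)) n (\<lambda>l. r / 4 \<le> nrm E (x + lincomb a l))"
proof (induction n arbitrary: x a k)
  case (Suc n)
  show ?case
  proof (cases "r / 4 < nrm E x")
    case True
    then show ?thesis using nested_nrm_large[OF nsphere_subset(1) Suc.prems(1)] by blast
  next
    case False
    have "nested (weak0 (nsphere E)) n (\<lambda>l. r / 4 \<le> nrm E (x + lincomb a (y # l)))" if "y \<in> nsphere E" for y
    proof -
      have y: "y \<in> vecs E" "nrm E y = 1" using that by (auto simp: nsphere_def)
      have mem: "x + smul E (a 0) y \<in> vecs E" using Suc.prems(1) y by (simp add: add_mem smul_mem)
      have "nested (weak0 (nsphere E)) n (\<lambda>l. r / 4 \<le> nrm E ((x + smul E (a 0) y) + lincomb (\<lambda>i. a (Suc i)) l))"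
      proof (cases k)
        case 0
        have "nrm E (smul E (a 0) y) \<le> nrm E (x + smul E (a 0) y) + nrm E x"
          using nrm_diff[OF mem Suc.prems(1)] by simp
        then have "r / 4 < nrm E (x + smul E (a 0) y)"
          using False Suc.prems(3,4) y 0 by (simp add: nrm_smul)
        then show ?thesis by (rule nested_nrm_large[OF nsphere_subset(1) mem])
      next
        case (Suc j)
        then show ?thesis using Suc.prems by (intro Suc.IH[of _ j] mem) auto
      qed
      then show ?thesis by (simp add: lincomb_Cons add.assoc)
    qed
    then show ?thesis
      unfolding nested.simps using eventually_weak0_mem[of "nsphere E"] by (auto elim: eventually_mono)
  qed
qed simp

lemma weakly_null_net_pick:
  assumes "directed D le" "weakly_null_net E D le x" "finite \<Phi>" "\<Phi> \<subseteq> vecs (dual E)" "0 < e"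
  shows "\<exists>u\<in>D. \<forall>f\<in>\<Phi>. norm (f (x u)) < e"
proof -
  have dir: "D \<noteq> {}" "\<And>u. u \<in> D \<Longrightarrow> le u u"
      "\<And>u v w. u \<in> D \<Longrightarrow> v \<in> D \<Longrightarrow> w \<in> D \<Longrightarrow> le u v \<Longrightarrow> le v w \<Longrightarrow> le u w"
      "\<And>u v. u \<in> D \<Longrightarrow> v \<in> D \<Longrightarrow> \<exists>w\<in>D. le u w \<and> le v w"
    using assms(1) unfolding directed_def by blast+
  from assms(3,4) have "\<exists>u\<in>D. \<forall>v\<in>D. le u v \<longrightarrow> (\<forall>f\<in>\<Phi>. norm (f (x v)) < e)"
  proof (induction \<Phi> rule: finite_induct)
    case empty
    then show ?case using dir(1) by auto
  next
    case (insert f \<Phi>)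
    then obtain u where u: "u \<in> D" "\<forall>v\<in>D. le u v \<longrightarrow> (\<forall>f\<in>\<Phi>. norm (f (x v)) < e)" by auto
    obtain w where w: "w \<in> D" "\<forall>v\<in>D. le w v \<longrightarrow> norm (f (x v)) < e"
      using assms(2,5) insert.prems unfolding weakly_null_net_def by blast
    obtain z where z: "z \<in> D" "le u z" "le w z" using dir(4) u(1) w(1) by blast
    have "\<forall>v\<in>D. le z v \<longrightarrow> (\<forall>f\<in>insert f \<Phi>. norm (f (x v)) < e)"
      using u w z dir(3) by (metis insert_iff)
    then show ?case using z(1) by blast
  qed
  then show ?thesis using dir(2) by blast
qed

text \<open>The nested quantifiers are followed node by node: below the node \<open>s\<close>, some
  successor lies in the weak neighbourhood demanded at that stage.\<close>

lemma tree_branch: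
  assumes D: "directed D le" and null: "weakly_null_tree E D le n x"
    and A: "\<And>t. set t \<subseteq> D \<Longrightarrow> t \<noteq> [] \<Longrightarrow> length t \<le> n \<Longrightarrow> x t \<in> A"
  shows "set s \<subseteq> D \<Longrightarrow> length s + m = n \<Longrightarrow> nested (weak0 A) m Q \<Longrightarrow>
    \<exists>t. set t \<subseteq> D \<and> length t = m \<and> Q (map (\<lambda>i. x (s @ take (Suc i) t)) [0..<m])"
proof (induction m arbitrary: s Q)
  case (Suc m)
  obtain \<Phi> e where \<Phi>: "finite \<Phi>" "\<Phi> \<subseteq> vecs (dual E)" "0 < e"
    "\<forall>y\<in>A. (\<forall>f\<in>\<Phi>. norm (f y) < e) \<longrightarrow> nested (weak0 A) m (\<lambda>l. Q (y # l))"
    using Suc.prems(3) unfolding nested.simps eventually_weak0 by blast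
  have "weakly_null_net E D le (\<lambda>u. x (s @ [u]))"
    using null Suc.prems unfolding weakly_null_tree_def by auto
  from weakly_null_net_pick[OF D this \<Phi>(1-3)]
  obtain u where u: "u \<in> D" "\<forall>f\<in>\<Phi>. norm (f (x (s @ [u]))) < e" by blast
  have "nested (weak0 A) m (\<lambda>l. Q (x (s @ [u]) # l))"
    using \<Phi>(4) u A[of "s @ [u]"] Suc.prems by auto
  from Suc.IH[of "s @ [u]", OF _ _ this] obtain t where
    t: "set t \<subseteq> D" "length t = m" "Q (x (s @ [u]) # map (\<lambda>i. x ((s @ [u]) @ take (Suc i) t)) [0..<m])"
    using Suc.prems u(1) by auto
  have "Q (map (\<lambda>i. x (s @ take (Suc i) (u # t))) [0..<Suc m])"
    using t(3) by (subst map_upt_Suc) simp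
  then show ?case using t u(1) by (intro exI[of _ "u # t"]) auto
qed auto

lemma sum_take_eq_lincomb:
  "(\<Sum>i=1..n. smul E (a i) (x (take i t))) =
    lincomb (\<lambda>i. a (Suc i)) (map (\<lambda>i. x (take (Suc i) t)) [0..<n])"
  by (simp add: lincomb_def sum.atLeast1_atMost_eq)

end

lemma norm_le_sup_norm: "k \<in> {1..n} \<Longrightarrow> norm (a k) \<le> sup_norm n a"
  unfolding sup_norm_def by (rule Max_ge) auto

lemma sup_norm_attained: "1 \<le> n \<Longrightarrow> \<exists>k\<in>{1..n}. norm (a k) = sup_norm n a"
proof -
  assume "1 \<le> n"
  then have "sup_norm n a \<in> (\<lambda>i. norm (a i)) ` {1..n}" unfolding sup_norm_def by (intro Max_in) auto
  then show ?thesis by auto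
qed

text \<open>A representing tree compares \<open>p a\<close> with the sum along every branch, so each
  of the two estimates needs only one suitable branch.\<close>

lemma (in normed_nspace) asymptotic_c0_of_bounded_branches:
  assumes inf: "infinite_dim E" and "bounded_branches"
  shows "asymptotic_c0 E"
proof -
  obtain C where C: "\<And>n. good C n 0" using assms(2) by (auto simp: bounded_branches_def)
  \<comment> \<open>With the tolerance \<open>b = 2\<close> used below, the branch bounds
    \<open>C\<close> and \<open>1 / 4\<close> become \<open>2 * C\<close> and
    \<open>1 / 8\<close>.\<close>
  define K where "K = max 8 (2 * C)"
  have K: "1 \<le> K" "8 \<le> K" "2 * C \<le> K" by (auto simp: K_def)
  have unit: "inverse K \<le> p a \<and> p a \<le> K"
    if n: "1 \<le> n" and p: "p \<in> asymptotic_norms E n" and a: "a \<in> tuples n" "sup_norm n a = 1" for n p a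
  proof -
    obtain D :: "'e set set" and le x where tr: "tree_represents E n p 2 D le x"
      using p unfolding asymptotic_norms_def by force
    have D: "directed D le" "weakly_null_tree E D le n x"
      "\<And>t. set t \<subseteq> D \<Longrightarrow> t \<noteq> [] \<Longrightarrow> length t \<le> n \<Longrightarrow> x t \<in> nsphere E"
      using tr by (auto simp: tree_represents_def Suc_le_eq)
    have rep: "inverse 2 * nrm E (lincomb (\<lambda>i. a (Suc i)) (map (\<lambda>i. x (take (Suc i) t)) [0..<n])) \<le> p a \<and>
        p a \<le> 2 * nrm E (lincomb (\<lambda>i. a (Suc i)) (map (\<lambda>i. x (take (Suc i) t)) [0..<n]))"
      if "set t \<subseteq> D" "length t = n" for t
      using tr a that unfolding tree_represents_def sum_take_eq_lincomb by blast
    have branch: "\<exists>t. set t \<subseteq> D \<and> length t = n \<and> Q (map (\<lambda>i. x (take (Suc i) t)) [0..<n])"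
      if "nested (weak0 (nsphere E)) n Q" for Q
      using tree_branch[OF D(1,2), of "nsphere E" "[]" n Q] D(3) that by simp
    have "norm (a (Suc i)) \<le> 1" for i
      using norm_le_sup_norm[of "Suc i" n a] a by (cases "Suc i \<le> n") (auto simp: tuples_def)
    then have "nested (weak0 (nsphere E)) n (\<lambda>l. nrm E (0 + lincomb (\<lambda>i. a (Suc i)) l) \<le> C)"
      by (intro nested_good_scaled C)
    from branch[OF this] obtain t where "set t \<subseteq> D" "length t = n"
      "nrm E (lincomb (\<lambda>i. a (Suc i)) (map (\<lambda>i. x (take (Suc i) t)) [0..<n])) \<le> C" by auto
    with rep[of t] have upper: "p a \<le> K" using K(3) by simp
    obtain k where k: "k \<in> {1..n}" "norm (a k) = 1" using sup_norm_attained[OF n, of a] a(2) by auto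
    have "nested (weak0 (nsphere E)) n (\<lambda>l. 1 / 4 \<le> nrm E (0 + lincomb (\<lambda>i. a (Suc i)) l))"
      using k by (intro nested_lower_estimate[of _ "k - 1"] zero_mem) auto
    from branch[OF this] obtain t where "set t \<subseteq> D" "length t = n"
      "1 / 4 \<le> nrm E (lincomb (\<lambda>i. a (Suc i)) (map (\<lambda>i. x (take (Suc i) t)) [0..<n]))" by auto
    with rep[of t] have "1 / 8 \<le> p a" by simp
    moreover have "inverse K \<le> 1 / 8" using K(2) by (simp add: inverse_eq_divide frac_le)
    ultimately show ?thesis using upper by simp
  qed
  have "inverse K * sup_norm n a \<le> p a \<and> p a \<le> K * sup_norm n a"
    if n: "1 \<le> n" and p: "p \<in> asymptotic_norms E n" and a: "a \<in> tuples n" for n p a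
  proof -
    have hom: "p (\<lambda>i. c * b i) = norm c * p b" if "b \<in> tuples n" for c b
      using p that unfolding asymptotic_norms_def norm_on_tuples_def by blast
    obtain k where k: "k \<in> {1..n}" "norm (a k) = sup_norm n a" using sup_norm_attained[OF n] by blast
    show ?thesis
    proof (cases "sup_norm n a = 0")
      case True
      have "a i = 0" for i
        using norm_le_sup_norm[of i n a] a True by (cases "i \<in> {1..n}") (auto simp: tuples_def)
      then have "a = (\<lambda>i. 0)" by auto
      then have "p a = 0" using hom[OF a, of 0] by simp
      then show ?thesis using True by simp
    next
      case False
      then have pos: "0 < sup_norm n a" using k(2) norm_ge_zero[of "a k"] by linarith
      define s where "s = sup_norm n a"
      define b where "b = (\<lambda>i. of_real (1 / s) * a i)"
      have b: "b \<in> tuples n" using a by (simp add: b_def tuples_def)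
      have "sup_norm n b = 1"
      proof (rule antisym)
        obtain j where j: "j \<in> {1..n}" "norm (b j) = sup_norm n b" using sup_norm_attained[OF n] by blast
        show "sup_norm n b \<le> 1"
          unfolding j(2)[symmetric] using norm_le_sup_norm[OF j(1), of a] pos by (simp add: b_def s_def norm_mult norm_divide)
        show "1 \<le> sup_norm n b"
          using norm_le_sup_norm[OF k(1), of b] k(2) pos by (simp add: b_def s_def norm_mult norm_divide)
      qed
      then have "inverse K \<le> p b" "p b \<le> K" using unit[OF n p b] by auto
      moreover have "a = (\<lambda>i. of_real s * b i)" using pos by (simp add: b_def s_def fun_eq_iff)
      then have "p a = s * p b" using hom[OF b, of "of_real s"] pos by (simp add: s_def)
      ultimately show ?thesis using pos by (simp add: s_def mult.commute mult_left_mono)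
    qed
  qed
  then show ?thesis using inf K(1) unfolding asymptotic_c0_def by blast
qed

section \<open>Finitely many functionals, passage from the ball to the sphere, and finite
  dimension\<close>

context normed_nspace
begin

text \<open>The common kernel of finitely many functionals has finite codimension. A further
  functional requires one more vector in \<open>B\<close>, and none if it vanishes on the previous
  kernel.\<close>

lemma finite_functionals_separate:
  assumes "finite \<Phi>" "\<Phi> \<subseteq> vecs (dual E)"
  shows "\<exists>B. finite B \<and> B \<subseteq> vecs E \<and> (\<forall>x\<in>vecs E. \<exists>y\<in>vs.span B. \<forall>f\<in>\<Phi>. f (x - y) = 0)"
  using assms
proof (induction \<Phi> rule: finite_induct)
  case empty
  then show ?case by (intro exI[of _ "{}"]) (auto intro: vs.span_zero)
next
  case (insert f \<Phi>)
  obtain B where B: "finite B" "B \<subseteq> vecs E" "\<forall>x\<in>vecs E. \<exists>y\<in>vs.span B. \<forall>f\<in>\<Phi>. f (x - y) = 0"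
    using insert by blast
  have f: "f \<in> vecs (dual E)" and \<Phi>: "\<Phi> \<subseteq> vecs (dual E)" using insert.prems by auto
  have span: "vs.span B' \<subseteq> vecs E" if "B' \<subseteq> vecs E" for B'
    using vs.span_minimal[OF that subspace_vecs] .
  show ?case
  proof (cases "\<exists>w\<in>vecs E. (\<forall>g\<in>\<Phi>. g w = 0) \<and> f w \<noteq> 0")
    case True
    then obtain w where w: "w \<in> vecs E" "\<forall>g\<in>\<Phi>. g w = 0" "f w \<noteq> 0" by blast
    have "\<exists>y\<in>vs.span (insert w B). \<forall>g\<in>insert f \<Phi>. g (x - y) = 0" if x: "x \<in> vecs E" for x
    proof -
      obtain y where y: "y \<in> vs.span B" "\<forall>g\<in>\<Phi>. g (x - y) = 0" using B(3) x by blast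
      have yv: "x - y \<in> vecs E" using y(1) span[OF B(2)] x diff_mem by blast
      define c where "c = f (x - y) / f w"
      have app: "g (x - (y + smul E c w)) = g (x - y) - c * g w" if "g \<in> vecs (dual E)" for g
        using dual_diff[OF that yv smul_mem[OF w(1)], of c] dual_smul[OF that w(1), of c]
        by (simp add: diff_diff_eq)
      have "\<forall>g\<in>insert f \<Phi>. g (x - (y + smul E c w)) = 0"
      proof
        fix g assume g: "g \<in> insert f \<Phi>"
        then have "g \<in> vecs (dual E)" using f \<Phi> by blast
        from app[OF this] g show "g (x - (y + smul E c w)) = 0"
          using y(2) w by (auto simp: c_def)
      qed
      moreover have "y + smul E c w \<in> vs.span (insert w B)"
        using subsetD[OF vs.span_mono[OF subset_insertI] y(1)]
        by (intro vs.span_add vs.span_scale[OF vs.span_base]) simp_all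
      ultimately show ?thesis by blast
    qed
    then show ?thesis using B(1,2) w(1) by (intro exI[of _ "insert w B"]) auto
  next
    case False
    have "\<exists>y\<in>vs.span B. \<forall>g\<in>insert f \<Phi>. g (x - y) = 0" if x: "x \<in> vecs E" for x
    proof -
      obtain y where y: "y \<in> vs.span B" "\<forall>g\<in>\<Phi>. g (x - y) = 0" using B(3) x by blast
      have "x - y \<in> vecs E" using y(1) span[OF B(2)] x diff_mem by blast
      then have "f (x - y) = 0" using False y(2) by blast
      then show ?thesis using y by blast
    qed
    then show ?thesis using B(1,2) by blast
  qed
qed

lemma common_kernel_vector:
  assumes "infinite_dim E" "finite \<Phi>" "\<Phi> \<subseteq> vecs (dual E)"
  obtains w where "w \<in> vecs E" "w \<noteq> 0" "\<And>f. f \<in> \<Phi> \<Longrightarrow> f w = 0"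
proof -
  obtain B where B: "finite B" "B \<subseteq> vecs E" "\<forall>x\<in>vecs E. \<exists>y\<in>vs.span B. \<forall>f\<in>\<Phi>. f (x - y) = 0"
    using finite_functionals_separate[OF assms(2,3)] by blast
  have sub: "vs.span B \<subseteq> vecs E" by (rule vs.span_minimal[OF B(2) subspace_vecs])
  then have "vs.span B \<noteq> vecs E" using assms(1) B(1) unfolding infinite_dim_def by blast
  then obtain x where x: "x \<in> vecs E" "x \<notin> vs.span B" using sub by blast
  obtain y where y: "y \<in> vs.span B" "\<forall>f\<in>\<Phi>. f (x - y) = 0" using B(3) x(1) by blast
  show thesis
    by (rule that[of "x - y"]) (use x y sub diff_mem in auto)
qed

text \<open>Two good vectors can be continued by the same \<open>u\<close>, and adding
  \<open>u\<close> commutes with convex combinations.\<close>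

lemma good_convex:
  "good C n x \<Longrightarrow> good C n y \<Longrightarrow> x \<in> vecs E \<Longrightarrow> y \<in> vecs E \<Longrightarrow> 0 \<le> r \<Longrightarrow> r \<le> 1 \<Longrightarrow>
    good C n (smul E (of_real r) x + smul E (of_real (1 - r)) y)"
proof (induction n arbitrary: x y)
  case 0
  have "nrm E (smul E (of_real r) x + smul E (of_real (1 - r)) y) \<le> r * nrm E x + (1 - r) * nrm E y"
    using nrm_add[OF smul_mem[OF 0(3)] smul_mem[OF 0(4)], of "of_real r" "of_real (1 - r)"] 0(3-6)
    by (simp add: nrm_smul del: of_real_diff)
  also have "\<dots> \<le> r * C + (1 - r) * C"
    using 0 by (intro add_mono mult_left_mono) (auto simp: good_0)
  finally show ?case by (simp add: good_0 algebra_simps)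
next
  case (Suc n)
  have "eventually (\<lambda>u. good C n (x + u) \<and> good C n (y + u) \<and> u \<in> nball E) (weak0 (nball E))"
    using Suc.prems(1,2) eventually_weak0_mem[of "nball E"] unfolding good_Suc by eventually_elim simp
  then show ?case
    unfolding good_Suc
  proof eventually_elim
    case (elim u)
    then have u: "u \<in> vecs E" using nballD by blast
    have eq: "smul E (of_real r) u + smul E (of_real (1 - r)) u = u"
      by (simp flip: vs.scale_left_distrib)
    have "smul E (of_real r) (x + u) + smul E (of_real (1 - r)) (y + u) =
        (smul E (of_real r) x + smul E (of_real (1 - r)) y) +
        (smul E (of_real r) u + smul E (of_real (1 - r)) u)"
      by (simp only: vs.scale_right_distrib add.assoc add.left_commute)
    moreover have "good C n (smul E (of_real r) (x + u) + smul E (of_real (1 - r)) (y + u))"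
      using elim Suc.prems u add_mem by (intro Suc.IH) auto
    ultimately show ?case by (simp only: eq)
  qed
qed

lemma nrm_one_on_ray:
  assumes y: "y \<in> nball E" and w: "w \<in> vecs E" "w \<noteq> 0"
  obtains t where "0 \<le> t" "nrm E (y + smul E (of_real t) w) = 1"
proof -
  have yv: "y \<in> vecs E" "nrm E y \<le> 1" using y nballD by auto
  have pos: "0 < nrm E w" using nrm_nonneg[OF w(1)] nrm_eq_0D[OF w(1)] w(2) by fastforce
  define h where "h t = nrm E (y + smul E (of_real t) w)" for t
  have mem: "y + smul E (of_real t) w \<in> vecs E" for t using yv(1) w(1) by (simp add: add_mem smul_mem)
  have lip: "h s - h t \<le> nrm E w * dist s t" for s t
  proof -
    have "(y + smul E (of_real s) w) - (y + smul E (of_real t) w) = smul E (of_real (s - t)) w"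
      by (simp add: vs.scale_left_diff_distrib)
    then show ?thesis
      using nrm_triangle_sub[OF mem[of s] mem[of t]] nrm_smul[OF w(1), of "of_real (s - t)"]
      by (simp add: h_def dist_real_def mult.commute del: of_real_diff)
  qed
  have "(nrm E w)-lipschitz_on {0..2 / nrm E w} h"
  proof (rule lipschitz_onI)
    fix s t show "dist (h s) (h t) \<le> nrm E w * dist s t"
      using lip[of s t] lip[of t s] by (simp add: dist_real_def abs_le_iff abs_minus_commute)
  qed (use pos in simp)
  then have "continuous_on {0..2 / nrm E w} h" by (rule lipschitz_on_continuous_on)
  moreover have "h 0 \<le> 1" using yv by (simp add: h_def)
  \<comment> \<open>At this parameter the added vector has norm 2, while \<open>y\<close> has norm
    at most 1.\<close>
  moreover have "1 \<le> h (2 / nrm E w)"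
  proof -
    have "nrm E (smul E (of_real (2 / nrm E w)) w) = 2"
      using nrm_smul[OF w(1), of "of_real (2 / nrm E w)"] pos by (simp add: norm_divide)
    then show ?thesis
      using nrm_diff[OF mem yv(1), of "2 / nrm E w"] yv(2) by (simp add: h_def)
  qed
  ultimately obtain t where "0 \<le> t" "h t = 1" using IVT'[of h 0 1 "2 / nrm E w"] pos by auto
  then show thesis using that by (simp add: h_def)
qed

text \<open>Every vector of the ball is a convex combination of two vectors of the sphere which agree on
  prescribed finitely many functionals. So it suffices to play with vectors of the sphere.\<close>

lemma good_of_nested_sphere:
  assumes inf: "infinite_dim E"
  shows "x \<in> vecs E \<Longrightarrow> nested (weak0 (nsphere E)) n (\<lambda>l. nrm E (x + sum_list l) \<le> C) \<Longrightarrow> good C n x"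
proof (induction n arbitrary: x)
  case (Suc n)
  obtain \<Phi> e where \<Phi>: "finite \<Phi>" "\<Phi> \<subseteq> vecs (dual E)" "0 < e"
    "\<forall>y\<in>nsphere E. (\<forall>f\<in>\<Phi>. norm (f y) < e) \<longrightarrow>
      nested (weak0 (nsphere E)) n (\<lambda>l. nrm E (x + sum_list (y # l)) \<le> C)"
    using Suc.prems(2) unfolding nested.simps eventually_weak0 by blast
  have sphere: "good C n (x + y)" if "y \<in> nsphere E" "\<forall>f\<in>\<Phi>. norm (f y) < e" for y
  proof (rule Suc.IH)
    show "x + y \<in> vecs E" using that(1) nsphere_subset(1) Suc.prems(1) add_mem by blast
    show "nested (weak0 (nsphere E)) n (\<lambda>l. nrm E ((x + y) + sum_list l) \<le> C)"
      using \<Phi>(4) that by (simp add: add.assoc)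
  qed
  obtain w where w: "w \<in> vecs E" "w \<noteq> 0" "\<And>f. f \<in> \<Phi> \<Longrightarrow> f w = 0"
    using common_kernel_vector[OF inf \<Phi>(1,2)] by blast
  have "good C n (x + y)" if y: "y \<in> nball E" "\<forall>f\<in>\<Phi>. norm (f y) < e" for y
  proof -
    have yv: "y \<in> vecs E" using y(1) nballD by blast
    obtain s where s: "0 \<le> s" "nrm E (y + smul E (of_real s) w) = 1"
      using nrm_one_on_ray[OF y(1) w(1,2)] by blast
    obtain t where t: "0 \<le> t" "nrm E (y + smul E (of_real t) (- w)) = 1"
      using nrm_one_on_ray[OF y(1) uminus_mem[OF w(1)]] w(2) by auto
    \<comment> \<open>Moving along \<open>w\<close> in both directions does not change the
      functionals in \<open>\<Phi>\<close> and reaches the sphere on either side of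
      \<open>y\<close>.\<close>
    define u where "u = y + smul E (of_real s) w"
    define v where "v = y + smul E (of_real t) (- w)"
    have mem: "u \<in> vecs E" "v \<in> vecs E"
      using yv w(1) by (simp_all add: u_def v_def add_mem smul_mem uminus_mem del: vs.scale_minus_right)
    have f: "f u = f y \<and> f v = f y" if "f \<in> \<Phi>" for f
    proof -
      have fd: "f \<in> vecs (dual E)" using that \<Phi>(2) by blast
      show ?thesis
        using dual_add[OF fd yv smul_mem[OF w(1)], of "of_real s"] dual_smul[OF fd w(1), of "of_real s"]
          dual_add[OF fd yv smul_mem[OF w(1)], of "- of_real t"] dual_smul[OF fd w(1), of "- of_real t"]
          w(3)[OF that] by (simp add: u_def v_def)
    qed
    have "u \<in> nsphere E" "v \<in> nsphere E"
      using s(2) t(2) mem unfolding nsphere_def u_def v_def by blast+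
    moreover have "\<forall>f\<in>\<Phi>. norm (f u) < e" "\<forall>f\<in>\<Phi>. norm (f v) < e"
      by (metis f y(2))+
    ultimately have gu: "good C n (x + u)" and gv: "good C n (x + v)"
      by (auto intro: sphere)
    show ?thesis
    proof (cases "s + t = 0")
      case True
      then have "s = 0" using s(1) t(1) by simp
      then show ?thesis using gu by (simp add: u_def)
    next
      case False
      then have st: "0 < s + t" using s(1) t(1) by simp
      \<comment> \<open>The weight for which the two displacements along \<open>w\<close>
        cancel.\<close>
      define r where "r = t / (s + t)"
      have r: "0 \<le> r" "r \<le> 1" using s(1) t(1) st by (auto simp: r_def)
      have "r * s - (1 - r) * t = 0" using st by (simp add: r_def field_simps)
      then have 0: "smul E (of_real (r * s)) w + smul E (of_real ((1 - r) * t)) (- w) = 0"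
        by (simp flip: vs.scale_left_diff_distrib of_real_diff)
      have sum1: "smul E (of_real r) z + smul E (of_real (1 - r)) z = z" for z
        by (simp flip: vs.scale_left_distrib)
      have "smul E (of_real r) (x + u) + smul E (of_real (1 - r)) (x + v) =
          (smul E (of_real r) (x + y) + smul E (of_real (1 - r)) (x + y)) +
          (smul E (of_real (r * s)) w + smul E (of_real ((1 - r) * t)) (- w))"
        by (simp only: u_def v_def vs.scale_right_distrib vs.scale_scale of_real_mult
          add.assoc add.left_commute add.commute)
      then have "smul E (of_real r) (x + u) + smul E (of_real (1 - r)) (x + v) = x + y"
        by (simp only: sum1 0 add_0_right)
      then show ?thesis
        using good_convex[OF gu gv _ _ r] mem Suc.prems(1) add_mem by simp
    qed
  qed
  then show ?case unfolding good_Suc eventually_weak0 using \<Phi>(1-3) by blast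
qed (simp add: good_0)

text \<open>A bounded functional that is nonzero at \<open>b0\<close>, supplied by Hahn-Banach,
  defines a projection \<open>P\<close> killing \<open>b0\<close>. A frame for the span of the image
  of \<open>B0\<close>, composed with \<open>P\<close>, is completed by \<open>b0\<close>; so all
  coordinate functionals are bounded. As \<open>n\<close> is only a bound for the cardinality, the
  image may shrink.\<close>

lemma frame_of_finite_span:
  "finite B \<Longrightarrow> B \<subseteq> vecs E \<Longrightarrow> card B \<le> n \<Longrightarrow>
    \<exists>m b f. (\<forall>i<m. b i \<in> vecs E \<and> f i \<in> vecs (dual E)) \<and>
      (\<forall>x\<in>vs.span B. x = (\<Sum>i<m::nat. smul E (f i x) (b i)))"
proof (induction n arbitrary: B)
  case 0
  then show ?case by (intro exI[of _ 0]) auto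
next
  case (Suc n)
  interpret dual: normed_nspace "dual E" by (rule normed_nspace_dual)
  show ?case
  proof (cases "B \<subseteq> {0}")
    case True
    then have "vs.span B \<subseteq> {0}" by (intro vs.span_minimal) (auto simp: vs.subspace_def)
    then show ?thesis by (intro exI[of _ 0]) auto
  next
    case False
    then obtain b0 where b0: "b0 \<in> B" "b0 \<noteq> 0" by blast
    then have b0v: "b0 \<in> vecs E" using Suc.prems(2) by blast
    define B0 where "B0 = B - {b0}"
    have B0: "finite B0" "B0 \<subseteq> vecs E" "card B0 \<le> n" "B = insert b0 B0"
      using b0 Suc.prems by (auto simp: B0_def)
    obtain f0 where f0: "f0 \<in> nball (dual E)" "norm (f0 b0) = nrm E b0" using norming_functional[OF b0v] by blast
    then have f0d: "f0 \<in> vecs (dual E)" and nz: "f0 b0 \<noteq> 0"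
      using dual.nballD(1) nrm_eq_0D[OF b0v] b0(2) by auto
    define P where "P x = x - smul E (f0 x / f0 b0) b0" for x
    have Pv: "P x \<in> vecs E" if "x \<in> vecs E" for x using that b0v by (simp add: P_def diff_mem smul_mem)
    have P_add: "P (x + y) = P x + P y" if "x \<in> vecs E" "y \<in> vecs E" for x y
      using dual_add[OF f0d that] by (simp add: P_def add_divide_distrib vs.scale_left_distrib algebra_simps)
    have P_smul: "P (smul E c x) = smul E c (P x)" if "x \<in> vecs E" for c x
      using dual_smul[OF f0d that, of c] by (simp add: P_def vs.scale_right_diff_distrib)
    have fin: "finite (P ` B0)" "P ` B0 \<subseteq> vecs E" using B0 Pv by auto
    have "card (P ` B0) \<le> n" using card_image_le[OF B0(1), of P] B0(3) by simp
    from Suc.IH[OF fin this] obtain m b f where IH: "\<And>i. i < m \<Longrightarrow> b i \<in> vecs E \<and> f i \<in> vecs (dual E)"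
      "\<And>x. x \<in> vs.span (P ` B0) \<Longrightarrow> x = (\<Sum>i<m::nat. smul E (f i x) (b i))" by blast
    have span_B: "vs.span B \<subseteq> vecs E" by (rule vs.span_minimal[OF Suc.prems(2) subspace_vecs])
    have "vs.span B0 \<subseteq> {y \<in> vecs E. P y \<in> vs.span (P ` B0)}"
    proof (rule vs.span_minimal)
      show "B0 \<subseteq> {y \<in> vecs E. P y \<in> vs.span (P ` B0)}" using B0(2) vs.span_base by blast
      have "P 0 = 0" using P_smul[OF zero_mem, of 0] by simp
      then show "vs.subspace {y \<in> vecs E. P y \<in> vs.span (P ` B0)}"
        by (auto simp: vs.subspace_def zero_mem add_mem smul_mem P_add P_smul
          intro: vs.span_add vs.span_scale vs.span_zero)
    qed
    then have P0: "y \<in> vs.span B0 \<Longrightarrow> y \<in> vecs E \<and> P y \<in> vs.span (P ` B0)" for y by blast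
    have Pspan: "P x \<in> vs.span (P ` B0)" if x: "x \<in> vs.span B" for x
    proof -
      obtain k where k: "x - smul E k b0 \<in> vs.span B0"
        using x unfolding B0(4) vs.span_breakdown_eq by blast
      have "P b0 = 0" using nz by (simp add: P_def)
      then have "P x = P (x - smul E k b0)"
        using P_add[of "x - smul E k b0" "smul E k b0"] P0[OF k] P_smul[OF b0v, of k] smul_mem[OF b0v]
        by simp
      then show ?thesis using P0[OF k] by simp
    qed
    define b' where "b' = (\<lambda>i. if i < m then b i else b0)"
    \<comment> \<open>On the space, for \<open>i < m\<close>, this is \<open>f i\<close> after
      \<open>P\<close>, written as a combination of elements of the dual.\<close>
    define f' where "f' = (\<lambda>i. if i < m then f i - smul (dual E) (f i b0 / f0 b0) f0
      else smul (dual E) (1 / f0 b0) f0)"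
    have "\<forall>i<Suc m. b' i \<in> vecs E \<and> f' i \<in> vecs (dual E)"
      using IH(1) b0v f0d by (auto simp: b'_def f'_def dual.diff_mem dual.smul_mem)
    moreover have "x = (\<Sum>i<Suc m. smul E (f' i x) (b' i))" if x: "x \<in> vs.span B" for x
    proof -
      have xv: "x \<in> vecs E" using x span_B by blast
      have "f i (P x) = f' i x" if "i < m" for i
      proof -
        have fd: "f i \<in> vecs (dual E)" using IH(1) that by blast
        have "f i (P x) = f i x - (f0 x / f0 b0) * f i b0"
          using dual_diff[OF fd xv smul_mem[OF b0v]] dual_smul[OF fd b0v] by (simp add: P_def)
        then show ?thesis using that by (simp add: f'_def smul_dual)
      qed
      then have "P x = (\<Sum>i<m. smul E (f' i x) (b' i))"
        by (subst IH(2)[OF Pspan[OF x]]) (simp add: b'_def)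
      moreover have "x = P x + smul E (f0 x / f0 b0) b0" by (simp add: P_def)
      moreover have "smul E (f' m x) (b' m) = smul E (f0 x / f0 b0) b0"
        by (simp add: f'_def b'_def smul_dual)
      ultimately show ?thesis by simp
    qed
    ultimately show ?thesis by blast
  qed
qed

lemma finite_dim_frame:
  assumes "\<not> infinite_dim E"
  obtains m :: nat and b f where "\<And>i. i < m \<Longrightarrow> b i \<in> vecs E" "\<And>i. i < m \<Longrightarrow> f i \<in> vecs (dual E)"
    "\<And>x. x \<in> vecs E \<Longrightarrow> x = (\<Sum>i<m. smul E (f i x) (b i))"
proof -
  obtain B where B: "finite B" "vs.span B = vecs E" using assms unfolding infinite_dim_def by blast
  then have "B \<subseteq> vecs E" using vs.span_superset by blast
  from frame_of_finite_span[OF B(1) this order_refl] obtain m :: nat and b f where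
    fr: "\<And>i. i < m \<Longrightarrow> b i \<in> vecs E \<and> f i \<in> vecs (dual E)"
      "\<And>x. x \<in> vs.span B \<Longrightarrow> x = (\<Sum>i<m. smul E (f i x) (b i))"
    by blast
  show thesis
    by (rule that[of m b f]) (use fr B(2) in blast)+
qed

text \<open>In finite dimension the weak filter on the ball converges to 0 in norm, so partial sums
  can be kept below norm 1.\<close>

lemma bounded_branches_of_finite_dim:
  assumes "\<not> infinite_dim E"
  shows "bounded_branches"
proof -
  obtain m :: nat and b f where fr: "\<And>i. i < m \<Longrightarrow> b i \<in> vecs E" "\<And>i. i < m \<Longrightarrow> f i \<in> vecs (dual E)"
    "\<And>x. x \<in> vecs E \<Longrightarrow> x = (\<Sum>i<m. smul E (f i x) (b i))"
    using finite_dim_frame[OF assms] by blast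
  have "((\<lambda>y. \<Sum>i<m. norm (f i y) * nrm E (b i)) \<longlongrightarrow> (\<Sum>i<m. norm (0 :: 'k) * nrm E (b i))) (weak0 (nball E))"
    by (intro tendsto_sum tendsto_mult tendsto_norm tendsto_weak0 tendsto_const fr(2)) simp
  then have "((\<lambda>y. \<Sum>i<m. norm (f i y) * nrm E (b i)) \<longlongrightarrow> 0) (weak0 (nball E))" by simp
  then have small: "eventually (\<lambda>y. y \<in> nball E \<and> nrm E y < e) (weak0 (nball E))" if "0 < e" for e
  proof -
    have "eventually (\<lambda>y. (\<Sum>i<m. norm (f i y) * nrm E (b i)) < e) (weak0 (nball E))"
      using order_tendstoD(2)[OF \<open>((\<lambda>y. \<Sum>i<m. norm (f i y) * nrm E (b i)) \<longlongrightarrow> 0) (weak0 (nball E))\<close> that] .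
    then show ?thesis
      using eventually_weak0_mem[of "nball E"]
    proof eventually_elim
      case (elim y)
      then have y: "y \<in> vecs E" using nballD by blast
      have "nrm E y \<le> (\<Sum>i<m. nrm E (smul E (f i y) (b i)))"
        by (subst fr(3)[OF y], rule nrm_sum) (simp add: fr(1) smul_mem)
      also have "\<dots> = (\<Sum>i<m. norm (f i y) * nrm E (b i))"
        by (intro sum.cong refl) (simp add: nrm_smul fr(1))
      finally show ?case using elim by simp
    qed
  qed
  have "x \<in> vecs E \<Longrightarrow> nrm E x < 1 \<Longrightarrow> good 1 n x" for n x
  proof (induction n arbitrary: x)
    case (Suc n)
    have "eventually (\<lambda>y. y \<in> nball E \<and> nrm E y < 1 - nrm E x) (weak0 (nball E))"
      by (rule small) (use Suc.prems in simp)
    then show ?case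
      unfolding good_Suc
    proof eventually_elim
      case (elim y)
      then have "y \<in> vecs E" using nballD by blast
      then show ?case
        using nrm_add[OF Suc.prems(1), of y] elim Suc.prems(1) by (intro Suc.IH add_mem) auto
    qed
  qed (simp add: good_0)
  then have "good 1 n 0" for n using zero_mem by simp
  then show ?thesis unfolding bounded_branches_def by blast
qed

end

section \<open>Asymptotic norms from branches with large sums\<close>

context normed_nspace
begin

text \<open>The norm is a cluster point of the functions \<open>m l\<close> along bad branches. The
  branches close to it are frequent for the nested filter, and therefore contain all branches of
  some weakly null tree.\<close>

lemma asymptotic_norm_of_not_good:
  assumes inf: "infinite_dim E" and n: "1 \<le> n" and ng: "\<not> good C n 0"
  obtains p where "p \<in> asymptotic_norms E n" "C \<le> p (\<lambda>i. if i \<in> {1..n} then 1 else 0)"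
proof -
  define F where "F = nested_filter (weak0 (nsphere E)) n"
  define N where "N = inf F (principal {l. \<not> nrm E (sum_list l) \<le> C})"
  have "\<not> nested (weak0 (nsphere E)) n (\<lambda>l. nrm E (0 + sum_list l) \<le> C)"
    using good_of_nested_sphere[OF inf zero_mem] ng by blast
  then have N: "N \<noteq> bot"
    by (simp add: N_def F_def inf_principal_not_bot frequently_def eventually_nested_filter)
  define m where "m l a = nrm E (lincomb a l)" for l and a :: "nat \<Rightarrow> 'k"
  have len: "eventually (\<lambda>l. length l = n \<and> set l \<subseteq> nsphere E) F"
    unfolding F_def eventually_nested_filter by (rule nested_lists[OF eventually_weak0_mem])
  then have lenN: "eventually (\<lambda>l. length l = n \<and> set l \<subseteq> nsphere E) N"
    unfolding N_def by (rule filter_leD[rotated]) simp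
  then have "eventually (\<lambda>l. m l \<in> {h. \<forall>a. h a \<in> cball 0 (\<Sum>i<n. norm (a i))}) N"
  proof eventually_elim
    case (elim l)
    then have "lincomb a l \<in> vecs E" for a using nsphere_subset(1) by (intro lincomb_mem) blast
    then show ?case using nrm_lincomb_le[of l] elim nrm_nonneg by (simp add: m_def)
  qed
  from compact_filter_cluster[OF compact_pointwise_bounded[OF compact_cball] N this]
  obtain q where q: "inf N (filtercomap m (nhds q)) \<noteq> bot" .
  define W where "W = inf N (filtercomap m (nhds q))"
  have W: "W \<noteq> bot" using q by (simp add: W_def)
  have "(m \<longlongrightarrow> q) W"
    unfolding W_def by (rule filterlim_mono[OF filterlim_filtercomap order_refl]) simp
  then have lim: "((\<lambda>l. m l a) \<longlongrightarrow> q a) W" for a by (rule tendsto_coordinate)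
  have WN: "W \<le> N" and WF: "W \<le> F" by (simp_all add: W_def N_def le_infI1)
  have lenW: "eventually (\<lambda>l. length l = n \<and> set l \<subseteq> vecs E) W"
    using filter_leD[OF WN lenN] by eventually_elim (use nsphere_subset in blast)
  have mem: "lincomb a l \<in> vecs E" if "length l = n \<and> set l \<subseteq> vecs E" for a l
    using that by (intro lincomb_mem) blast
  have q_add: "q (\<lambda>i. a i + b i) \<le> q a + q b" for a b
  proof (rule tendsto_le[OF W tendsto_add[OF lim lim] lim])
    show "eventually (\<lambda>l. m l (\<lambda>i. a i + b i) \<le> m l a + m l b) W"
      using lenW by eventually_elim (simp add: m_def lincomb_add nrm_add mem)
  qed
  have q_scale: "q (\<lambda>i. c * a i) = norm c * q a" for c a
  proof (rule tendsto_unique[OF W lim])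
    have "eventually (\<lambda>l. m l (\<lambda>i. c * a i) = norm c * m l a) W"
      using lenW by eventually_elim (simp add: m_def lincomb_scale nrm_smul mem)
    from tendsto_cong[OF this] show "((\<lambda>l. m l (\<lambda>i. c * a i)) \<longlongrightarrow> norm c * q a) W"
      using tendsto_mult[OF tendsto_const lim] by blast
  qed
  \<comment> \<open>This estimate holds along the whole nested filter, so it passes to the cluster
    point and makes \<open>q\<close> definite in the first \<open>n\<close> coordinates.\<close>
  have q_lower: "norm (a k) / 4 \<le> q a" if "k < n" for a k
  proof (cases "a k = 0")
    case True
    have "eventually (\<lambda>l. 0 \<le> m l a) W" using lenW by eventually_elim (simp add: m_def nrm_nonneg mem)
    then show ?thesis using tendsto_lowerbound[OF lim _ W] True by simp
  next
    case False
    have "eventually (\<lambda>l. norm (a k) / 4 \<le> nrm E (0 + lincomb a l)) F"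
      unfolding F_def eventually_nested_filter
      by (rule nested_lower_estimate[OF zero_mem that]) (use False in auto)
    then have "eventually (\<lambda>l. norm (a k) / 4 \<le> m l a) W"
      using filter_leD[OF WF] by (simp add: m_def)
    then show ?thesis by (rule tendsto_lowerbound[OF lim _ W])
  qed
  have m_lip: "m l a - m l b \<le> (\<Sum>i<n. norm (a i - b i))" if l: "length l = n" "set l \<subseteq> nsphere E" for l a b
  proof -
    have "length l = n \<and> set l \<subseteq> vecs E" using l nsphere_subset by blast
    from nrm_triangle_sub[OF mem[OF this] mem[OF this], of a b]
    show ?thesis
      using nrm_lincomb_le[OF l(2), of "\<lambda>i. a i - b i"] l(1) by (simp add: m_def lincomb_diff)
  qed
  have q_lip: "q a - q b \<le> (\<Sum>i<n. norm (a i - b i))" for a b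
  proof (rule tendsto_upperbound[OF tendsto_diff[OF lim lim] _ W])
    show "eventually (\<lambda>l. m l a - m l b \<le> (\<Sum>i<n. norm (a i - b i))) W"
      using filter_leD[OF WN lenN] by eventually_elim (simp add: m_lip)
  qed
  define p where "p a = q (\<lambda>i. a (Suc i))" for a
  have p_lower: "norm (a k) / 4 \<le> p a" if "k \<in> {1..n}" for a k
    using q_lower[of "k - 1" "\<lambda>i. a (Suc i)"] that by (cases k) (auto simp: p_def)
  have "norm_on_tuples n p"
    unfolding norm_on_tuples_def
  proof (intro conjI ballI allI)
    fix a :: "nat \<Rightarrow> 'k" assume a: "a \<in> tuples n"
    show "0 \<le> p a" using p_lower[of 1 a] n order_trans[of 0 "norm (a 1) / 4" "p a"] by simp
    show "p a = 0 \<longleftrightarrow> a = 0"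
    proof
      assume "p a = 0"
      then have "a i = 0" for i
        using p_lower[of i a] a by (cases "i \<in> {1..n}") (auto simp: tuples_def)
      then show "a = 0" by auto
    next
      assume "a = 0"
      then show "p a = 0" using q_scale[of 0 "\<lambda>i. 0"] by (simp add: p_def zero_fun_def)
    qed
    show "p (\<lambda>i. c * a i) = norm c * p a" for c
      using q_scale[of c "\<lambda>i. a (Suc i)"] by (simp add: p_def)
    show "p (a + b) \<le> p a + p b" for b
      using q_add[of "\<lambda>i. a (Suc i)" "\<lambda>i. b (Suc i)"] by (simp add: p_def)
  qed
  moreover have "\<exists>(D :: 'e set set) le x. tree_represents E n p b D le x" if b: "1 < b" for b
  proof -
    \<comment> \<open>Chosen so that \<open>4 * \<eta> = 1 - inverse b\<close>: as
      \<open>p a\<close> is at least \<open>1 / 4\<close>, an additive error \<open>\<eta>\<close>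
      is covered by a factor \<open>b\<close>.\<close>
    define \<eta> where "\<eta> = (b - 1) / (4 * b)"
    have \<eta>: "0 < \<eta>" using b by (simp add: \<eta>_def)
    define \<delta> where "\<delta> = \<eta> / (3 * real n)"
    have \<delta>: "0 < \<delta>" using \<eta> n by (simp add: \<delta>_def)
    \<comment> \<open>Convergence is pointwise in the coefficients. A finite net and the common
      Lipschitz bound make it uniform for coefficients of modulus at most 1, with three errors of
      \<open>\<eta> / 3\<close>.\<close>
    obtain S where S: "finite S" "cball (0::'k) 1 \<subseteq> (\<Union>s\<in>S. ball s \<delta>)"
      using compact_cball_scalar[of 1] \<delta> unfolding compact_eq_totally_bounded by metis
    define A where "A = (\<lambda>l i. if i < n then l ! i else 0) ` {l. set l \<subseteq> S \<and> length l = n}"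
    have "finite A" unfolding A_def by (intro finite_imageI finite_lists_length_eq S(1))
    then have "eventually (\<lambda>l. \<forall>a\<in>A. dist (m l a) (q a) < \<eta> / 3) W"
      using tendstoD[OF lim, of "\<eta> / 3"] \<eta> by (intro eventually_ball_finite) auto
    with filter_leD[OF WN lenN]
    have ev: "eventually (\<lambda>l. \<forall>a. (\<forall>i. norm (a i) \<le> 1) \<longrightarrow> \<bar>m l a - q a\<bar> \<le> \<eta>) W"
    proof eventually_elim
      case (elim l)
      show ?case
      proof (intro allI impI)
        fix a :: "nat \<Rightarrow> 'k" assume a: "\<forall>i. norm (a i) \<le> 1"
        have "\<forall>i. \<exists>s\<in>S. norm (a i - s) < \<delta>"
        proof
          fix i
          have "a i \<in> cball 0 1" using a by simp
          then have "a i \<in> (\<Union>s\<in>S. ball s \<delta>)" using S(2) by blast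
          then show "\<exists>s\<in>S. norm (a i - s) < \<delta>" by (auto simp: dist_norm norm_minus_commute)
        qed
        then obtain s where s: "\<And>i. s i \<in> S" "\<And>i. norm (a i - s i) < \<delta>" by metis
        define a' where "a' i = (if i < n then s i else 0)" for i
        have "a' \<in> A" unfolding A_def
          by (rule image_eqI[of _ _ "map s [0..<n]"]) (use s(1) in \<open>auto simp: a'_def\<close>)
        then have 1: "\<bar>m l a' - q a'\<bar> < \<eta> / 3" using elim by (auto simp: dist_real_def)
        have "(\<Sum>i<n. norm (a i - a' i)) \<le> (\<Sum>i<n. \<delta>)"
          using s(2) by (intro sum_mono) (auto simp: a'_def less_imp_le)
        also have "\<dots> = \<eta> / 3" using n by (simp add: \<delta>_def)
        finally have d: "(\<Sum>i<n. norm (a i - a' i)) \<le> \<eta> / 3" .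
        then have d': "(\<Sum>i<n. norm (a' i - a i)) \<le> \<eta> / 3" by (simp add: norm_minus_commute)
        show "\<bar>m l a - q a\<bar> \<le> \<eta>"
          using 1 d d' m_lip[of l a a'] m_lip[of l a' a] q_lip[of a a'] q_lip[of a' a] elim by linarith
      qed
    qed
    \<comment> \<open>Otherwise the negation would hold eventually along \<open>F\<close>, hence
      along the finer proper filter \<open>W\<close>, where closeness has just been shown.\<close>
    have nn: "\<not> nested (weak0 (nsphere E)) n (\<lambda>l. \<not> (\<forall>a. (\<forall>i. norm (a i) \<le> 1) \<longrightarrow> \<bar>m l a - q a\<bar> \<le> \<eta>))"
    proof
      assume "nested (weak0 (nsphere E)) n (\<lambda>l. \<not> (\<forall>a. (\<forall>i. norm (a i) \<le> 1) \<longrightarrow> \<bar>m l a - q a\<bar> \<le> \<eta>))"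
      then have "eventually (\<lambda>l. \<not> (\<forall>a. (\<forall>i. norm (a i) \<le> 1) \<longrightarrow> \<bar>m l a - q a\<bar> \<le> \<eta>)) F"
        unfolding F_def eventually_nested_filter .
      from filter_leD[OF WF this] ev have "eventually (\<lambda>l. False) W" by eventually_elim blast
      then show False using W by simp
    qed
    \<comment> \<open>The indices are sets of vectors, the type that \<open>asymptotic_norms\<close>
      asks for.\<close>
    define D where "D = {U. U \<subseteq> nsphere E \<and> eventually (\<lambda>y. y \<in> U) (weak0 (nsphere E))}"
    have "eventually (\<lambda>y. y \<in> U) (weak0 (nsphere E))" if "U \<in> D" for U using that by (simp add: D_def)
    from not_nested_tree[OF this nn] obtain x :: "'e set list \<Rightarrow> 'e" where
      x: "(\<forall>t. set t \<subseteq> D \<and> t \<noteq> [] \<and> length t \<le> n \<longrightarrow> x t \<in> last t) \<and>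
        (\<forall>t. set t \<subseteq> D \<and> length t = n \<longrightarrow> (\<forall>a. (\<forall>i. norm (a i) \<le> 1) \<longrightarrow>
          \<bar>m (map (\<lambda>i. x (take (Suc i) t)) [0..<n]) a - q a\<bar> \<le> \<eta>))" ..
    note x = x[THEN conjunct1, rule_format, OF conjI, OF _ conjI] x[THEN conjunct2, rule_format, OF conjI]
    have "tree_represents E n p b D (\<lambda>U V. V \<subseteq> U) x"
      unfolding tree_represents_def
    proof (intro conjI ballI allI impI)
      show "directed D (\<lambda>U V. V \<subseteq> U)"
        unfolding directed_def
      proof (intro conjI ballI impI)
        show "D \<noteq> {}" using eventually_weak0_mem[of "nsphere E"] by (auto simp: D_def)
        fix U V assume "U \<in> D" "V \<in> D"
        then have "U \<inter> V \<in> D" by (auto simp: D_def eventually_conj_iff)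
        then show "\<exists>W\<in>D. W \<subseteq> U \<and> W \<subseteq> V" by blast
      qed auto
      show "weakly_null_tree E D (\<lambda>U V. V \<subseteq> U) n x"
        unfolding weakly_null_tree_def weakly_null_net_def
      proof (intro allI impI ballI)
        fix t f and e :: real
        assume t: "set t \<subseteq> D \<and> length t < n" and f: "f \<in> vecs (dual E)" and e: "0 < e"
        let ?U = "{y \<in> nsphere E. norm (f y) < e}"
        have "?U \<in> D"
          using eventually_weak0_less[OF f e, of "nsphere E"] eventually_weak0_mem[of "nsphere E"]
          by (simp add: D_def eventually_conj_iff)
        moreover have "norm (f (x (t @ [V]))) < e" if "V \<in> D" "V \<subseteq> ?U" for V
          using x(1)[of "t @ [V]"] t that by auto
        ultimately show "\<exists>u\<in>D. \<forall>v\<in>D. v \<subseteq> u \<longrightarrow> norm (f (x (t @ [v]))) < e" by blast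
      qed
      fix t assume "set t \<subseteq> D \<and> 1 \<le> length t \<and> length t \<le> n"
      then have "x t \<in> last t" "last t \<in> D" using x(1)[of t] last_in_set[of t] by (cases t; auto)+
      then show "x t \<in> nsphere E" by (auto simp: D_def)
    next
      fix a :: "nat \<Rightarrow> 'k" and t
      assume a: "a \<in> tuples n" "sup_norm n a = 1" and t: "set t \<subseteq> D \<and> length t = n"
      have "norm (a (Suc i)) \<le> 1" for i
        using norm_le_sup_norm[of "Suc i" n a] a by (cases "Suc i \<le> n") (auto simp: tuples_def)
      from x(2)[OF conjunct1[OF t] conjunct2[OF t], of "\<lambda>i. a (Suc i)", OF this]
      have close: "\<bar>nrm E (\<Sum>i=1..n. smul E (a i) (x (take i t))) - p a\<bar> \<le> \<eta>"
        by (simp only: sum_take_eq_lincomb m_def p_def)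
      obtain k where "k \<in> {1..n}" "norm (a k) = 1" using sup_norm_attained[OF n, of a] a(2) by auto
      then have p4: "1 / 4 \<le> p a" using p_lower[of k a] by simp
      have 4: "4 * \<eta> = 1 - inverse b" using b by (simp add: \<eta>_def field_simps)
      have "\<eta> \<le> 4 * \<eta> * p a" using p4 \<eta> by simp
      then have "\<eta> \<le> p a - inverse b * p a" by (simp only: 4 left_diff_distrib mult_1_left)
      then have low: "inverse b * p a \<le> nrm E (\<Sum>i=1..n. smul E (a i) (x (take i t)))"
        and up: "nrm E (\<Sum>i=1..n. smul E (a i) (x (take i t))) \<le> 2 * p a - inverse b * p a"
        using close by linarith+
      show "p a \<le> b * nrm E (\<Sum>i=1..n. smul E (a i) (x (take i t)))"
        using low b by (simp add: field_simps)
      have "2 - inverse b \<le> b"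
      proof -
        have "0 \<le> (b - 1)\<^sup>2 / b" using b by simp
        also have "\<dots> = b - 2 + inverse b" using b by (simp add: field_simps power2_eq_square)
        finally show ?thesis by simp
      qed
      then have "2 * p a - inverse b * p a \<le> b * p a"
        using p4 mult_right_mono[of "2 - inverse b" b "p a"] by (simp add: algebra_simps)
      with up have "nrm E (\<Sum>i=1..n. smul E (a i) (x (take i t))) \<le> b * p a" by (rule order_trans)
      then show "inverse b * nrm E (\<Sum>i=1..n. smul E (a i) (x (take i t))) \<le> p a"
        using b by (simp add: inverse_eq_divide divide_le_eq mult.commute)
    qed
    then show ?thesis by blast
  qed
  ultimately have "p \<in> asymptotic_norms E n" unfolding asymptotic_norms_def by blast
  moreover have "C \<le> p (\<lambda>i. if i \<in> {1..n} then 1 else 0)"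
  proof -
    let ?u = "\<lambda>i. if i < n then 1 else 0"
    have "eventually (\<lambda>l. \<not> nrm E (sum_list l) \<le> C) W"
      by (rule filter_leD[OF WN]) (simp add: N_def eventually_inf_principal)
    with lenW have "eventually (\<lambda>l. C \<le> m l ?u) W"
      by eventually_elim (simp add: m_def sum_list_eq_lincomb)
    then have "C \<le> q ?u" by (rule tendsto_lowerbound[OF lim _ W])
    then show ?thesis by (simp add: p_def Suc_le_eq)
  qed
  ultimately show thesis by (rule that)
qed

text \<open>If \<open>good (C + 1) n 0\<close> failed, some asymptotic norm would be at least
  \<open>C + 1\<close> at the tuple of ones, whose sup norm is 1.\<close>

lemma bounded_branches_of_asymptotic_c0:
  assumes "asymptotic_c0 E"
  shows "bounded_branches"
proof -
  obtain C where inf: "infinite_dim E" and C: "1 \<le> C"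
    "\<And>n p a. 1 \<le> n \<Longrightarrow> p \<in> asymptotic_norms E n \<Longrightarrow> a \<in> tuples n \<Longrightarrow> p a \<le> C * sup_norm n a"
    using assms unfolding asymptotic_c0_def by blast
  have "good (C + 1) n 0" for n
  proof (cases "1 \<le> n")
    case True
    show ?thesis
    proof (rule ccontr)
      assume "\<not> good (C + 1) n 0"
      from asymptotic_norm_of_not_good[OF inf True this]
      obtain p where p: "p \<in> asymptotic_norms E n" "C + 1 \<le> p (\<lambda>i. if i \<in> {1..n} then 1 else 0)" .
      let ?u = "\<lambda>i. if i \<in> {1..n} then 1 else 0 :: 'k"
      have "norm (?u k) = 1" if "k \<in> {1..n}" for k using that by simp
      then have "sup_norm n ?u = 1" using sup_norm_attained[OF True, of ?u] by force
      then have "p ?u \<le> C" using C(2)[OF True p(1), of ?u] by (simp add: tuples_def)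
      then show False using p(2) by simp
    qed
  next
    case False
    then have "n = 0" by simp
    then show ?thesis using C(1) by (simp add: good_0)
  qed
  then show ?thesis unfolding bounded_branches_def by blast
qed

theorem asymptotic_c0_iff_bounded_branches:
  "infinite_dim E \<Longrightarrow> asymptotic_c0 E \<longleftrightarrow> bounded_branches"
  using asymptotic_c0_of_bounded_branches bounded_branches_of_asymptotic_c0 by blast

end

lemma sum_fun_apply: "(\<Sum>i\<in>I. f i) x = (\<Sum>i\<in>I. f i x)"
  for f :: "'i \<Rightarrow> 'a \<Rightarrow> 'b::comm_monoid_add"
  by (induction I rule: infinite_finite_induct) auto

text \<open>If \<open>F\<close> had finite dimension, the pullbacks of its coordinate functionals
  would have a common nonzero kernel vector in \<open>E\<close>, and \<open>J\<close> would send it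
  to 0.\<close>

lemma (in isometric_embedding) infinite_dim_embedding:
  assumes "infinite_dim E"
  shows "infinite_dim F"
proof (rule ccontr)
  assume "\<not> infinite_dim F"
  from F.finite_dim_frame[OF this] obtain m :: nat and b f where
    fr: "\<And>i. i < m \<Longrightarrow> b i \<in> vecs F" "\<And>i. i < m \<Longrightarrow> f i \<in> vecs (dual F)"
      "\<And>x. x \<in> vecs F \<Longrightarrow> x = (\<Sum>i<m. smul F (f i x) (b i))" by blast
  have "finite ((\<lambda>i. pullback (f i)) ` {..<m})" "(\<lambda>i. pullback (f i)) ` {..<m} \<subseteq> vecs (dual E)"
    using fr(2) pullback_mem by auto
  from E.common_kernel_vector[OF assms this] obtain w where
    w: "w \<in> vecs E" "w \<noteq> 0" "\<And>g. g \<in> (\<lambda>i. pullback (f i)) ` {..<m} \<Longrightarrow> g w = 0" by blast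
  have "f i (J w) = 0" if "i < m" for i
    using w(3)[of "pullback (f i)"] that w(1) by (simp add: pullback_def)
  then have "J w = 0" using fr(3)[OF J_mem[OF w(1)]] by simp
  then have "w = 0" using nrm_J[OF w(1)] E.nrm_eq_0D[OF w(1)] by simp
  then show False using w(2) by simp
qed

section \<open>The injective tensor product\<close>

locale normed_tensor = X: normed_nspace X + Y: normed_nspace Y
  for X :: "('k::real_or_complex, 'x::ab_group_add) nspace"
    and Y :: "('k, 'y::ab_group_add) nspace"
begin

sublocale Yd: normed_nspace "dual Y" by (rule Y.normed_nspace_dual)
sublocale op: normed_nspace_pair "dual Y" X ..
sublocale L: normed_nspace "bounded_ops (dual Y) X" by (rule op.normed_nspace_ops)

abbreviation "T \<equiv> inj_tensor X Y"
abbreviation "tens \<equiv> elem_tensor X Y"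
abbreviation "R \<equiv> {tens x y |x y. x \<in> vecs X \<and> y \<in> vecs Y}"

lemma smul_tensor: "smul T = smul op.L" and nrm_tensor: "nrm T = nrm op.L"
  by (simp_all add: inj_tensor_def Let_def)

lemma tensor_iff: "u \<in> vecs T \<longleftrightarrow> u \<in> vecs op.L \<and> (\<forall>e>0. \<exists>v\<in>L.vs.span R. nrm op.L (u - v) < e)"
  by (simp add: inj_tensor_def Let_def)

lemma tens_apply: "f \<in> vecs (dual Y) \<Longrightarrow> tens x y f = smul X (f y) x"
  by (simp add: elem_tensor_def)

lemma tens_mem:
  assumes x: "x \<in> vecs X" and y: "y \<in> vecs Y"
  shows "tens x y \<in> vecs op.L"
  unfolding op.op_iff
proof (intro conjI ballI allI impI exI[of _ "nrm Y y * nrm X x"])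
  fix f assume f: "f \<in> vecs (dual Y)"
  have "nrm X (tens x y f) = norm (f y) * nrm X x" by (simp add: tens_apply[OF f] X.nrm_smul[OF x])
  also have "\<dots> \<le> (nrm (dual Y) f * nrm Y y) * nrm X x"
    using Y.dual_le[OF f y] X.nrm_nonneg[OF x] by (rule mult_right_mono)
  finally show "nrm X (tens x y f) \<le> nrm Y y * nrm X x * nrm (dual Y) f" by (simp add: mult_ac)
qed (use x in \<open>auto simp: elem_tensor_def X.smul_mem Yd.add_mem Yd.smul_mem Y.smul_dual
  X.vs.scale_left_distrib\<close>)

text \<open>The operator norm is a cross norm, with the lower bound attained at a functional norming
  \<open>y\<close>. This makes both factors embed isometrically.\<close>

lemma nrm_tens:
  assumes x: "x \<in> vecs X" and y: "y \<in> vecs Y"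
  shows "nrm op.L (tens x y) = nrm X x * nrm Y y"
proof (rule antisym)
  have eq: "nrm X (tens x y f) = norm (f y) * nrm X x" if "f \<in> nball (dual Y)" for f
    using Yd.nballD(1)[OF that] by (simp add: tens_apply X.nrm_smul[OF x])
  show "nrm op.L (tens x y) \<le> nrm X x * nrm Y y"
  proof (rule op.nrm_op_least)
    fix f assume f: "f \<in> nball (dual Y)"
    show "nrm X (tens x y f) \<le> nrm X x * nrm Y y"
      using mult_left_mono[OF Y.dual_ball_le[OF f y] X.nrm_nonneg[OF x]] by (simp add: eq[OF f] mult.commute)
  qed
  obtain f where f: "f \<in> nball (dual Y)" "norm (f y) = nrm Y y" using Y.norming_functional[OF y] by blast
  show "nrm X x * nrm Y y \<le> nrm op.L (tens x y)"
    using op.nrm_op_upper[OF tens_mem[OF x y] f(1)] by (simp add: eq[OF f(1)] f(2) mult.commute)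
qed

lemma span_tensors_subset: "L.vs.span R \<subseteq> vecs op.L"
  by (rule L.vs.span_minimal[OF _ L.subspace_vecs]) (auto intro: tens_mem)

lemma span_in_tensor: "v \<in> L.vs.span R \<Longrightarrow> v \<in> vecs T"
  using span_tensors_subset by (auto simp: tensor_iff intro!: bexI[of _ v])

lemma tens_in_tensor: "x \<in> vecs X \<Longrightarrow> y \<in> vecs Y \<Longrightarrow> tens x y \<in> vecs T"
  by (intro span_in_tensor L.vs.span_base) blast

lemma normed_nspace_tensor: "normed_nspace T"
proof
  show "0 \<in> vecs T" by (rule span_in_tensor[OF L.vs.span_zero])
next
  fix u u' assume u: "u \<in> vecs T" and u': "u' \<in> vecs T"
  have "\<exists>v\<in>L.vs.span R. nrm op.L ((u + u') - v) < e" if e: "0 < e" for e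
  proof -
    obtain v where v: "v \<in> L.vs.span R" "nrm op.L (u - v) < e / 2"
      using u half_gt_zero[OF e] unfolding tensor_iff by blast
    obtain v' where v': "v' \<in> L.vs.span R" "nrm op.L (u' - v') < e / 2"
      using u' half_gt_zero[OF e] unfolding tensor_iff by blast
    have eq: "(u + u') - (v + v') = (u - v) + (u' - v')" by simp
    have "nrm op.L ((u - v) + (u' - v')) \<le> nrm op.L (u - v) + nrm op.L (u' - v')"
      using u u' v(1) v'(1) span_tensors_subset by (intro L.nrm_add L.diff_mem) (auto simp: tensor_iff)
    then have "nrm op.L ((u + u') - (v + v')) < e" unfolding eq using v(2) v'(2) by linarith
    then show ?thesis using L.vs.span_add[OF v(1) v'(1)] by blast
  qed
  then show "u + u' \<in> vecs T" using u u' L.add_mem by (simp add: tensor_iff)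
  show "nrm T (u + u') \<le> nrm T u + nrm T u'" using u u' by (simp add: nrm_tensor tensor_iff L.nrm_add)
next
  fix u c assume u: "u \<in> vecs T"
  have "\<exists>v\<in>L.vs.span R. nrm op.L (smul op.L c u - v) < e" if e: "0 < e" for e
  proof -
    have pos: "0 < norm c + 1" by (simp add: add_nonneg_pos)
    then obtain v where v: "v \<in> L.vs.span R" "nrm op.L (u - v) < e / (norm c + 1)"
      using u e unfolding tensor_iff by (meson divide_pos_pos)
    have uv: "u - v \<in> vecs op.L" using u v(1) span_tensors_subset by (intro L.diff_mem) (auto simp: tensor_iff)
    have "nrm op.L (smul op.L c u - smul op.L c v) = norm c * nrm op.L (u - v)"
      using L.nrm_smul[OF uv] by (simp add: L.vs.scale_right_diff_distrib)
    also have "\<dots> \<le> (norm c + 1) * nrm op.L (u - v)"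
      using L.nrm_nonneg[OF uv] by (intro mult_right_mono) auto
    also have "\<dots> < e" using v(2) pos by (simp add: field_simps)
    finally show ?thesis using L.vs.span_scale[OF v(1)] by blast
  qed
  then show "smul T c u \<in> vecs T" using u L.smul_mem by (simp add: tensor_iff smul_tensor)
  show "nrm T (smul T c u) = norm c * nrm T u" using u by (simp add: nrm_tensor smul_tensor tensor_iff L.nrm_smul)
next
  fix u assume "u \<in> vecs T" "nrm T u = 0"
  then show "u = 0" by (simp add: nrm_tensor tensor_iff L.nrm_eq_0D)
qed (simp_all add: smul_tensor L.vs.scale_right_distrib L.vs.scale_left_distrib)

sublocale T: normed_nspace T by (rule normed_nspace_tensor)

lemma tensor_op: "u \<in> vecs T \<Longrightarrow> u \<in> vecs op.L"
  by (simp add: tensor_iff)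

lemma pairing_le:
  assumes u: "u \<in> vecs op.L" and f: "f \<in> nball (dual X)" and g: "g \<in> nball (dual Y)"
  shows "norm (f (u g)) \<le> nrm op.L u"
  using X.dual_ball_le[OF f op.op_mem[OF u], of g] op.nrm_op_upper[OF u g] by (rule order_trans)

text \<open>For an elementary tensor the pairing is a product of one value of each functional, and
  both converge. The operators with this property form a subspace.\<close>

lemma span_tensors_continuous:
  assumes v: "v \<in> L.vs.span R" and f0: "f0 \<in> nball (dual X)" and g0: "g0 \<in> nball (dual Y)"
    and ev: "eventually (\<lambda>y. h y \<in> nball (dual X) \<and> k y \<in> nball (dual Y)) W"
    and h: "(h \<longlongrightarrow> f0) W" and k: "(k \<longlongrightarrow> g0) W"
  shows "((\<lambda>y. h y (v (k y))) \<longlongrightarrow> f0 (v g0)) W"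
proof -
  interpret Xd: normed_nspace "dual X" by (rule X.normed_nspace_dual)
  let ?S = "{v \<in> vecs op.L. ((\<lambda>y. h y (v (k y))) \<longlongrightarrow> f0 (v g0)) W}"
  have fd: "f0 \<in> vecs (dual X)" using f0 Xd.nballD(1) by blast
  have hd: "eventually (\<lambda>y. h y \<in> vecs (dual X)) W" using ev by eventually_elim (simp add: Xd.nballD(1))
  have "L.vs.span R \<subseteq> ?S"
  proof (rule L.vs.span_minimal)
    show "R \<subseteq> ?S"
    proof clarify
      fix x y' assume x: "x \<in> vecs X" and y': "y' \<in> vecs Y"
      have "((\<lambda>y. k y y' * h y x) \<longlongrightarrow> g0 y' * f0 x) W"
        by (rule tendsto_mult[OF tendsto_coordinate[OF k] tendsto_coordinate[OF h]])
      moreover have "eventually (\<lambda>y. h y (tens x y' (k y)) = k y y' * h y x) W"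
        using ev by eventually_elim (simp add: tens_apply Yd.nballD(1) X.dual_smul[OF Xd.nballD(1) x])
      moreover have "f0 (tens x y' g0) = g0 y' * f0 x"
        using g0 by (simp add: tens_apply Yd.nballD(1) X.dual_smul[OF fd x])
      ultimately show "tens x y' \<in> vecs op.L \<and> ((\<lambda>y. h y (tens x y' (k y))) \<longlongrightarrow> f0 (tens x y' g0)) W"
        using tens_mem[OF x y'] by (simp add: tendsto_cong)
    qed
    show "L.vs.subspace ?S"
      unfolding L.vs.subspace_def
    proof (intro conjI ballI allI)
      have "eventually (\<lambda>y. h y 0 = 0) W" using hd by eventually_elim (rule X.dual_zero)
      then show "0 \<in> ?S" using X.dual_zero[OF fd] by (simp add: L.zero_mem tendsto_cong)
    next
      fix u v assume u: "u \<in> ?S" and v: "v \<in> ?S"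
      have "((\<lambda>y. h y (u (k y)) + h y (v (k y))) \<longlongrightarrow> f0 (u g0) + f0 (v g0)) W"
        using u v by (intro tendsto_add) auto
      moreover have "eventually (\<lambda>y. h y ((u + v) (k y)) = h y (u (k y)) + h y (v (k y))) W"
        using hd by eventually_elim (use u v in \<open>simp add: X.dual_add op.op_mem\<close>)
      ultimately show "u + v \<in> ?S"
        using u v X.dual_add[OF fd] by (simp add: L.add_mem op.op_mem tendsto_cong)
    next
      fix c u assume u: "u \<in> ?S"
      have "((\<lambda>y. c * h y (u (k y))) \<longlongrightarrow> c * f0 (u g0)) W"
        using u by (intro tendsto_mult_left) auto
      moreover have "eventually (\<lambda>y. h y (smul op.L c u (k y)) = c * h y (u (k y))) W"
        using hd by eventually_elim (use u in \<open>simp add: op.smul_op X.dual_smul op.op_mem\<close>)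
      moreover have "f0 (smul op.L c u g0) = c * f0 (u g0)"
        using u X.dual_smul[OF fd] by (simp add: op.smul_op op.op_mem)
      ultimately show "smul op.L c u \<in> ?S"
        using u by (simp add: L.smul_mem tendsto_cong)
    qed
  qed
  then show ?thesis using v by blast
qed

sublocale pairing: norming_pairing T X Y "\<lambda>u f g. f (u g)"
proof
  interpret Xd: normed_nspace "dual X" by (rule X.normed_nspace_dual)
  fix f :: "'x \<Rightarrow> 'k" and g :: "'y \<Rightarrow> 'k"
  assume f: "f \<in> nball (dual X)" and g: "g \<in> nball (dual Y)"
  have fd: "f \<in> vecs (dual X)" using f Xd.nballD(1) by blast
  have "norm (f (u g)) \<le> 1 * nrm T u" if "u \<in> vecs T" for u
    using pairing_le[OF tensor_op[OF that] f g] by (simp add: nrm_tensor)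
  then have "\<exists>B. \<forall>u\<in>vecs T. norm (if u \<in> vecs T then f (u g) else 0) \<le> B * nrm T u"
    by (intro exI[of _ 1]) auto
  then show "(\<lambda>u. if u \<in> vecs T then f (u g) else 0) \<in> vecs (dual T)"
    unfolding T.dual_iff
    by (intro conjI) (auto simp: T.add_mem T.smul_mem[unfolded smul_tensor] tensor_op op.op_mem X.dual_add[OF fd]
      smul_tensor op.smul_op X.dual_smul[OF fd])
next
  interpret Xd: normed_nspace "dual X" by (rule X.normed_nspace_dual)
  fix u and f f' :: "'x \<Rightarrow> 'k" and g g' :: "'y \<Rightarrow> 'k"
  assume u: "u \<in> nball T" and f: "f \<in> nball (dual X)" "f' \<in> nball (dual X)"
    and g: "g \<in> nball (dual Y)" "g' \<in> nball (dual Y)"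
  have uL: "u \<in> vecs op.L" and u1: "nrm op.L u \<le> 1"
    using T.nballD[OF u] by (auto simp: tensor_op nrm_tensor)
  have gd: "g \<in> vecs (dual Y)" "g' \<in> vecs (dual Y)" using g Yd.nballD(1) by auto
  have fd: "f \<in> vecs (dual X)" "f' \<in> vecs (dual X)" using f Xd.nballD(1) by auto
  \<comment> \<open>Only one functional is changed at a time.\<close>
  have eq: "f (u g) - f' (u g') = (f - f') (u g) + f' (u (g - g'))"
    using op.op_diff[OF uL gd] X.dual_diff[OF fd(2) op.op_mem[OF uL] op.op_mem[OF uL]] by simp
  have "norm ((f - f') (u g)) \<le> nrm (dual X) (f - f') * 1"
  proof (rule order_trans[OF X.dual_le[OF Xd.diff_mem[OF fd] op.op_mem[OF uL]] mult_left_mono])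
    show "nrm X (u g) \<le> 1" using op.nrm_op_upper[OF uL g(1)] u1 by simp
  qed (rule Xd.nrm_nonneg[OF Xd.diff_mem[OF fd]])
  moreover have "norm (f' (u (g - g'))) \<le> 1 * nrm (dual Y) (g - g')"
  proof -
    have "norm (f' (u (g - g'))) \<le> nrm op.L u * nrm (dual Y) (g - g')"
      using X.dual_ball_le[OF f(2) op.op_mem[OF uL]] op.op_le[OF uL Yd.diff_mem[OF gd]] by (rule order_trans)
    also have "\<dots> \<le> 1 * nrm (dual Y) (g - g')"
      using u1 Yd.nrm_nonneg[OF Yd.diff_mem[OF gd]] by (rule mult_right_mono)
    finally show ?thesis .
  qed
  ultimately show "norm (f (u g) - f' (u g')) \<le> nrm (dual X) (f - f') + nrm (dual Y) (g - g')"
    unfolding eq by (intro norm_triangle_le) linarith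
next
  interpret Xd: normed_nspace "dual X" by (rule X.normed_nspace_dual)
  fix u and f0 :: "'x \<Rightarrow> 'k" and g0 :: "'y \<Rightarrow> 'k" and h k W
  assume u: "u \<in> vecs T" and f0: "f0 \<in> nball (dual X)" and g0: "g0 \<in> nball (dual Y)"
    and ev: "eventually (\<lambda>y :: ('y \<Rightarrow> 'k) \<Rightarrow> 'x. h y \<in> nball (dual X) \<and> k y \<in> nball (dual Y)) W"
    and lim: "(h \<longlongrightarrow> f0) W" "(k \<longlongrightarrow> g0) W"
  show "((\<lambda>y. h y (u (k y))) \<longlongrightarrow> f0 (u g0)) W"
  proof (rule tendstoI)
    fix e :: real assume e: "0 < e"
    \<comment> \<open>This is where the closure of the span enters: the approximation is uniform
      over both dual balls, so continuity passes from finite sums of elementary tensors to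
      \<open>u\<close>.\<close>
    obtain v where v: "v \<in> L.vs.span R" "nrm op.L (u - v) < e / 3"
      using u e unfolding tensor_iff by (meson divide_pos_pos zero_less_numeral)
    have uL: "u \<in> vecs op.L" and vL: "v \<in> vecs op.L"
      using u v(1) span_tensors_subset by (auto simp: tensor_op)
    have close: "dist (f (u g)) (f (v g)) < e / 3" if f: "f \<in> nball (dual X)" and g: "g \<in> nball (dual Y)" for f g
    proof -
      have "f (u g) - f (v g) = f ((u - v) g)"
        using X.dual_diff[OF Xd.nballD(1)[OF f] op.op_mem[OF uL] op.op_mem[OF vL]] by simp
      then show ?thesis
        using pairing_le[OF L.diff_mem[OF uL vL] f g] v(2) unfolding dist_norm by simp
    qed
    have "eventually (\<lambda>y. dist (h y (v (k y))) (f0 (v g0)) < e / 3) W"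
      using tendstoD[OF span_tensors_continuous[OF v(1) f0 g0 ev lim], of "e / 3"] e by simp
    with ev show "eventually (\<lambda>y. dist (h y (u (k y))) (f0 (u g0)) < e) W"
    proof eventually_elim
      case (elim y)
      then have "dist (h y (u (k y))) (h y (v (k y))) < e / 3" by (intro close) auto
      moreover have "dist (f0 (v g0)) (f0 (u g0)) < e / 3" using close[OF f0 g0] by (simp add: dist_commute)
      ultimately show ?case
        using elim(2) dist_triangle[of "h y (u (k y))" "f0 (u g0)" "h y (v (k y))"]
          dist_triangle[of "h y (v (k y))" "f0 (u g0)" "f0 (v g0)"] by linarith
    qed
  qed
next
  fix u and c :: real assume u: "u \<in> vecs T" and c: "c < nrm T u"
  obtain g where g: "g \<in> nball (dual Y)" "c < nrm X (u g)"
    using op.less_nrm_op[OF tensor_op[OF u]] c unfolding nrm_tensor by blast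
  obtain f where "f \<in> nball (dual X)" "norm (f (u g)) = nrm X (u g)"
    using X.norming_functional[OF op.op_mem[OF tensor_op[OF u]]] by blast
  then show "\<exists>f\<in>nball (dual X). \<exists>g\<in>nball (dual Y). c \<le> norm (f (u g))"
    using g by (intro bexI[of _ f] bexI[of _ g]) auto
qed

lemma left_embedding:
  assumes y0: "y0 \<in> vecs Y" "nrm Y y0 = 1"
  shows "isometric_embedding X T (\<lambda>x. tens x y0)"
proof
  fix x x' c assume x: "x \<in> vecs X"
  show "tens x y0 \<in> vecs T" by (rule tens_in_tensor[OF x y0(1)])
  show "nrm T (tens x y0) = nrm X x" by (simp add: nrm_tensor nrm_tens[OF x y0(1)] y0(2))
  show "tens (x + x') y0 = tens x y0 + tens x' y0"
    by (rule ext) (simp add: elem_tensor_def X.vs.scale_right_distrib)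
  show "tens (smul X c x) y0 = smul T c (tens x y0)"
    by (rule ext) (simp add: elem_tensor_def smul_tensor op.smul_op mult.commute)
qed

lemma right_embedding:
  assumes x0: "x0 \<in> vecs X" "nrm X x0 = 1"
  shows "isometric_embedding Y T (tens x0)"
proof
  fix y y' assume y: "y \<in> vecs Y"
  show "tens x0 y \<in> vecs T" by (rule tens_in_tensor[OF x0(1) y])
  show "nrm T (tens x0 y) = nrm Y y" by (simp add: nrm_tensor nrm_tens[OF x0(1) y] x0(2))
  show "tens x0 (smul Y c y) = smul T c (tens x0 y)" for c
    by (rule ext) (simp add: elem_tensor_def smul_tensor op.smul_op Y.dual_smul y)
  show "tens x0 (y + y') = tens x0 y + tens x0 y'" if "y' \<in> vecs Y"
    by (rule ext) (simp add: elem_tensor_def X.vs.scale_left_distrib Y.dual_add y that)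
qed

text \<open>Shows that an infinite-dimensional product has an infinite-dimensional factor. In frames
  of the two spaces, \<open>u\<close> is determined by its matrix
  \<open>\<phi> i (u (\<gamma> j))\<close>.\<close>

lemma finite_dim_tensor:
  assumes "\<not> infinite_dim X" "\<not> infinite_dim Y"
  shows "\<not> infinite_dim T"
proof -
  obtain m :: nat and b \<phi> where b: "\<And>i. i < m \<Longrightarrow> b i \<in> vecs X" "\<And>i. i < m \<Longrightarrow> \<phi> i \<in> vecs (dual X)"
    "\<And>x. x \<in> vecs X \<Longrightarrow> x = (\<Sum>i<m. smul X (\<phi> i x) (b i))" using X.finite_dim_frame[OF assms(1)] by blast
  obtain n :: nat and c \<gamma> where c: "\<And>j. j < n \<Longrightarrow> c j \<in> vecs Y" "\<And>j. j < n \<Longrightarrow> \<gamma> j \<in> vecs (dual Y)"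
    "\<And>y. y \<in> vecs Y \<Longrightarrow> y = (\<Sum>j<n. smul Y (\<gamma> j y) (c j))" using Y.finite_dim_frame[OF assms(2)] by blast
  define B where "B = (\<lambda>(i, j). tens (b i) (c j)) ` ({..<m} \<times> {..<n})"
  have "u \<in> L.vs.span B" if u: "u \<in> vecs T" for u
  proof -
    have uL: "u \<in> vecs op.L" using u by (rule tensor_op)
    have "u = (\<Sum>j<n. \<Sum>i<m. smul op.L (\<phi> i (u (\<gamma> j))) (tens (b i) (c j)))"
    proof
      fix g
      have sum_apply: "(\<Sum>j<n. \<Sum>i<m. smul op.L (\<phi> i (u (\<gamma> j))) (tens (b i) (c j))) g =
          (\<Sum>j<n. \<Sum>i<m. smul X (\<phi> i (u (\<gamma> j))) (tens (b i) (c j) g))"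
        by (simp add: sum_fun_apply op.smul_op)
      show "u g = (\<Sum>j<n. \<Sum>i<m. smul op.L (\<phi> i (u (\<gamma> j))) (tens (b i) (c j))) g"
      proof (cases "g \<in> vecs (dual Y)")
        case True
        have "g = (\<Sum>j<n. smul (dual Y) (g (c j)) (\<gamma> j))"
        proof
          fix y
          show "g y = (\<Sum>j<n. smul (dual Y) (g (c j)) (\<gamma> j)) y"
          proof (cases "y \<in> vecs Y")
            case y: True
            have "g y = g (\<Sum>j<n. smul Y (\<gamma> j y) (c j))" using c(3)[OF y] by simp
            also have "\<dots> = (\<Sum>j<n. g (smul Y (\<gamma> j y) (c j)))"
              by (rule Y.dual_sum[OF True]) (simp add: Y.smul_mem c(1))
            also have "\<dots> = (\<Sum>j<n. g (c j) * \<gamma> j y)"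
              by (intro sum.cong refl) (simp add: Y.dual_smul[OF True] c(1) mult.commute)
            finally show ?thesis by (simp add: sum_fun_apply Y.smul_dual)
          next
            case False
            then show ?thesis by (simp add: sum_fun_apply Y.smul_dual Y.dual_outside[OF True] Y.dual_outside[OF c(2)])
          qed
        qed
        then have "u g = u (\<Sum>j<n. smul (dual Y) (g (c j)) (\<gamma> j))" by simp
        also have "\<dots> = (\<Sum>j<n. u (smul (dual Y) (g (c j)) (\<gamma> j)))"
          by (rule op.op_sum[OF uL]) (simp add: Yd.smul_mem c(2))
        also have "\<dots> = (\<Sum>j<n. smul X (g (c j)) (\<Sum>i<m. smul X (\<phi> i (u (\<gamma> j))) (b i)))"
          by (intro sum.cong refl) (simp add: op.op_smul[OF uL] c(2) flip: b(3)[OF op.op_mem[OF uL]])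
        also have "\<dots> = (\<Sum>j<n. \<Sum>i<m. smul X (\<phi> i (u (\<gamma> j))) (tens (b i) (c j) g))"
          by (intro sum.cong refl) (simp add: X.vs.scale_sum_right tens_apply[OF True] mult.commute)
        finally show ?thesis unfolding sum_apply .
      next
        case False
        then show ?thesis unfolding sum_apply by (simp add: op.op_outside[OF uL] elem_tensor_def)
      qed
    qed
    moreover have "(\<Sum>j<n. \<Sum>i<m. smul op.L (\<phi> i (u (\<gamma> j))) (tens (b i) (c j))) \<in> L.vs.span B"
      by (intro L.vs.span_sum L.vs.span_scale L.vs.span_base) (auto simp: B_def)
    ultimately show ?thesis by simp
  qed
  moreover have "L.vs.span B \<subseteq> L.vs.span R"
    using b(1) c(1) by (intro L.vs.span_mono) (auto simp: B_def)
  ultimately have "L.vs.span B = vecs T" using span_in_tensor by blast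
  moreover have "finite B" by (simp add: B_def)
  ultimately show ?thesis unfolding infinite_dim_def smul_tensor by blast
qed

end

lemma (in normed_nspace) unit_vector_exists:
  assumes "x \<in> vecs E" "x \<noteq> 0"
  obtains u where "u \<in> vecs E" "nrm E u = 1"
proof
  have "0 < nrm E x" using nrm_nonneg[OF assms(1)] nrm_eq_0D[OF assms(1)] assms(2) by fastforce
  then show "nrm E (smul E (of_real (1 / nrm E x)) x) = 1" by (simp add: nrm_smul[OF assms(1)] norm_divide)
qed (rule smul_mem[OF assms(1)])

lemma (in normed_nspace) asymptotic_c0_infinite_dim: "asymptotic_c0 E \<Longrightarrow> infinite_dim E"
  by (simp add: asymptotic_c0_def)

text \<open>Being Asymptotic \<open>c\<^sub>0\<close> includes infinite dimension, so a nonzero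
  finite-dimensional factor never has the property, although the product may: for one-dimensional
  \<open>X0\<close> it is a copy of \<open>X1\<close>. Hence the plain equivalence is claimed when
  both spaces are infinite-dimensional or both are not; as soon as one is, the property is asked of
  the infinite-dimensional factors. The Szlenk version needs no such distinction.\<close>

theorem corollary5p3:
  fixes s0 :: "'k::real_or_complex \<Rightarrow> 'a::banach \<Rightarrow> 'a"
    and s1 :: "'k \<Rightarrow> 'b::banach \<Rightarrow> 'b"
  defines "X0 \<equiv> whole s0" and "X1 \<equiv> whole s1"
  assumes "vector_space s0" and "\<And>c x. norm (s0 c x) = norm c * norm x"
    and "vector_space s1" and "\<And>c y. norm (s1 c y) = norm c * norm y"
    and "\<exists>x::'a. x \<noteq> 0" and "\<exists>y::'b. y \<noteq> 0"
  shows "((infinite_dim X0 \<longleftrightarrow> infinite_dim X1) \<longrightarrow>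
           (asymptotic_c0 (inj_tensor X0 X1) \<longleftrightarrow> asymptotic_c0 X0 \<and> asymptotic_c0 X1)) \<and>
         (infinite_dim X0 \<or> infinite_dim X1 \<longrightarrow>
           (asymptotic_c0 (inj_tensor X0 X1) \<longleftrightarrow>
             (infinite_dim X0 \<longrightarrow> asymptotic_c0 X0) \<and> (infinite_dim X1 \<longrightarrow> asymptotic_c0 X1))) \<and>
         (summable_szlenk (inj_tensor X0 X1) \<longleftrightarrow> summable_szlenk X0 \<and> summable_szlenk X1)"
proof -
  have "normed_nspace X0"
    unfolding X0_def normed_nspace_def whole_def
    using assms(3,4) by (simp add: norm_triangle_ineq)
  moreover have "normed_nspace X1"
    unfolding X1_def normed_nspace_def whole_def
    using assms(5,6) by (simp add: norm_triangle_ineq)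
  ultimately interpret normed_tensor X0 X1 by (simp add: normed_tensor_def)
  obtain x0 where x0: "x0 \<in> vecs X0" "nrm X0 x0 = 1"
    using assms(7) X.unit_vector_exists by (auto simp: X0_def whole_def)
  obtain y0 where y0: "y0 \<in> vecs X1" "nrm X1 y0 = 1"
    using assms(8) Y.unit_vector_exists by (auto simp: X1_def whole_def)
  interpret left: isometric_embedding X0 T "\<lambda>x. tens x y0" by (rule left_embedding[OF y0])
  interpret right: isometric_embedding X1 T "tens x0" by (rule right_embedding[OF x0])
  \<comment> \<open>Restriction to the isometric copies gives one direction, the pairing argument
    the other.\<close>
  have branches: "T.bounded_branches \<longleftrightarrow> X.bounded_branches \<and> Y.bounded_branches"
    using left.bounded_branches_embedding right.bounded_branches_embedding
      pairing.bounded_branches_of_summable_szlenk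
      X.bounded_branches_iff_summable_szlenk Y.bounded_branches_iff_summable_szlenk by blast
  then have szlenk: "summable_szlenk T \<longleftrightarrow> summable_szlenk X0 \<and> summable_szlenk X1"
    by (simp only: X.bounded_branches_iff_summable_szlenk Y.bounded_branches_iff_summable_szlenk
      T.bounded_branches_iff_summable_szlenk)
  have asym: "asymptotic_c0 T \<longleftrightarrow>
      (infinite_dim X0 \<longrightarrow> asymptotic_c0 X0) \<and> (infinite_dim X1 \<longrightarrow> asymptotic_c0 X1)"
    if "infinite_dim X0 \<or> infinite_dim X1"
  proof -
    have "infinite_dim T" using that left.infinite_dim_embedding right.infinite_dim_embedding by blast
    then have "asymptotic_c0 T \<longleftrightarrow> X.bounded_branches \<and> Y.bounded_branches"
      using T.asymptotic_c0_iff_bounded_branches branches by blast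
    moreover have "X.bounded_branches \<longleftrightarrow> (infinite_dim X0 \<longrightarrow> asymptotic_c0 X0)"
      using X.asymptotic_c0_iff_bounded_branches X.bounded_branches_of_finite_dim by blast
    moreover have "Y.bounded_branches \<longleftrightarrow> (infinite_dim X1 \<longrightarrow> asymptotic_c0 X1)"
      using Y.asymptotic_c0_iff_bounded_branches Y.bounded_branches_of_finite_dim by blast
    ultimately show ?thesis by blast
  qed
  \<comment> \<open>If both factors are finite-dimensional, so is the product, and both sides of the
    first equivalence are false.\<close>
  show ?thesis
    using asym szlenk finite_dim_tensor X.asymptotic_c0_infinite_dim T.asymptotic_c0_infinite_dim by blast
qed

end
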